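(* Let $(X,\mathfrak A,\mu)$ be a $\sigma$-finite measure space and let $q$ be an irreducible closed quadratic form on $L^2(X,\mu)$ satisfying the first Beurling-Deny criterion. Assume that the associated semigroup is a semigroup of kernel operators. Then there exists a strictly positive $q$-excessive function.
   Context: A quadratic form $q\colon L^2(X,\mu)\to[0,\infty]$ satisfies $q(\lambda f)=\lambda^2q(f)$ ($0\cdot\infty=0$) and the parallelogram identity; $D(q)=\{q<\infty\}$. It is closed if $D(q)$ is complete with respect to $q(f-g)^{1/2}+\|f-g\|_2$. Standing assumption: $D(q)$ is dense in $L^2(X,\mu)$. First Beurling-Deny criterion: $q(|f|)\le q(f)$ for all $f\in L^2(X,\mu)$. A measurable $A\subseteq X$ is $q$-invariant if $q(1_Af)\le q(f)$ for all $f\in L^2(X,\mu)$; $q$ is irreducible if each $q$-invariant $A$ satisfies $\mu(A)=0$ or $\mu(X\setminus A)=0$. The associated semigroup is $T_t=e^{-tL}$, $t>0$, where $L$ is the nonnegative self-adjoint operator of the closed form $q$. It is a semigroup of kernel operators if for each $t>0$ there is a jointly measurable $k_t\colon X\times X\to[0,\infty)$ with $T_tf(x)=\int_Xk_t(x,y)f(y)\,d\mu(y)$ for a.e. $x$ and all $f\in L^2(X,\mu)$. A strictly positive $q$-excessive function is a measurable $h\colon X\to\mathbb R$ with $h>0$ a.e. and $q(f\wedge h)\le q(f)$ for all $f\in L^2(X,\mu)$, where $f\wedge h=\min\{f,h\}$. *)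

theory Defs
  imports "HOL-Analysis.Analysis"
begin

text \<open>
  Elements of the real Hilbert space \<open>L\<^sup>2(X,\<mu>)\<close> are represented by square-integrable functions;
  two functions stand for the same element iff they agree almost everywhere.
\<close>

definition L2 :: "'a measure \<Rightarrow> ('a \<Rightarrow> real) set" where
  "L2 M = {f \<in> borel_measurable M. integrable M (\<lambda>x. (f x)\<^sup>2)}"

definition l2_inner :: "'a measure \<Rightarrow> ('a \<Rightarrow> real) \<Rightarrow> ('a \<Rightarrow> real) \<Rightarrow> real" where
  "l2_inner M f g = (LINT x|M. f x * g x)"

definition l2_norm :: "'a measure \<Rightarrow> ('a \<Rightarrow> real) \<Rightarrow> real" where
  "l2_norm M f = sqrt (l2_inner M f f)"

text \<open>
  The first condition says that \<open>q\<close> is a function on almost-everywhere classes. In \<^typ>\<open>ennreal\<close> the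
  convention \<open>0 * \<infinity> = 0\<close> is built in. Values of \<open>q\<close> outside \<open>L2 M\<close> are irrelevant.
\<close>

definition quadratic_form :: "'a measure \<Rightarrow> (('a \<Rightarrow> real) \<Rightarrow> ennreal) \<Rightarrow> bool" where
  "quadratic_form M q \<longleftrightarrow>
     (\<forall>f\<in>L2 M. \<forall>g\<in>L2 M. (AE x in M. f x = g x) \<longrightarrow> q f = q g) \<and>
     (\<forall>f\<in>L2 M. \<forall>c::real. q (\<lambda>x. c * f x) = ennreal (c\<^sup>2) * q f) \<and>
     (\<forall>f\<in>L2 M. \<forall>g\<in>L2 M.
        q (\<lambda>x. f x + g x) + q (\<lambda>x. f x - g x) = 2 * q f + 2 * q g)"

definition form_dom :: "'a measure \<Rightarrow> (('a \<Rightarrow> real) \<Rightarrow> ennreal) \<Rightarrow> ('a \<Rightarrow> real) set" where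
  "form_dom M q = {f \<in> L2 M. q f < \<infinity>}"

definition form_dist ::
  "'a measure \<Rightarrow> (('a \<Rightarrow> real) \<Rightarrow> ennreal) \<Rightarrow> ('a \<Rightarrow> real) \<Rightarrow> ('a \<Rightarrow> real) \<Rightarrow> real" where
  "form_dist M q f g =
     sqrt (enn2real (q (\<lambda>x. f x - g x))) + l2_norm M (\<lambda>x. f x - g x)"

text \<open>Every Cauchy sequence in the form domain converges in the form domain.\<close>

definition closed_form :: "'a measure \<Rightarrow> (('a \<Rightarrow> real) \<Rightarrow> ennreal) \<Rightarrow> bool" where
  "closed_form M q \<longleftrightarrow>
     (\<forall>u. (\<forall>n::nat. u n \<in> form_dom M q) \<and>
          (\<forall>e>0. \<exists>N. \<forall>m\<ge>N. \<forall>n\<ge>N. form_dist M q (u m) (u n) < e) \<longrightarrow>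
          (\<exists>f\<in>form_dom M q. (\<lambda>n. form_dist M q (u n) f) \<longlonglongrightarrow> 0))"

definition densely_defined :: "'a measure \<Rightarrow> (('a \<Rightarrow> real) \<Rightarrow> ennreal) \<Rightarrow> bool" where
  "densely_defined M q \<longleftrightarrow>
     (\<forall>f\<in>L2 M. \<forall>e>0. \<exists>g\<in>form_dom M q. l2_norm M (\<lambda>x. f x - g x) < e)"

definition beurling_deny_first :: "'a measure \<Rightarrow> (('a \<Rightarrow> real) \<Rightarrow> ennreal) \<Rightarrow> bool" where
  "beurling_deny_first M q \<longleftrightarrow> (\<forall>f\<in>L2 M. q (\<lambda>x. \<bar>f x\<bar>) \<le> q f)"

definition form_invariant :: "'a measure \<Rightarrow> (('a \<Rightarrow> real) \<Rightarrow> ennreal) \<Rightarrow> 'a set \<Rightarrow> bool" where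
  "form_invariant M q A \<longleftrightarrow>
     A \<in> sets M \<and> (\<forall>f\<in>L2 M. q (\<lambda>x. indicator A x * f x) \<le> q f)"

definition irreducible_form :: "'a measure \<Rightarrow> (('a \<Rightarrow> real) \<Rightarrow> ennreal) \<Rightarrow> bool" where
  "irreducible_form M q \<longleftrightarrow>
     (\<forall>A. form_invariant M q A \<longrightarrow> emeasure M A = 0 \<or> emeasure M (space M - A) = 0)"

definition form_bilinear ::
  "'a measure \<Rightarrow> (('a \<Rightarrow> real) \<Rightarrow> ennreal) \<Rightarrow> ('a \<Rightarrow> real) \<Rightarrow> ('a \<Rightarrow> real) \<Rightarrow> real" where
  "form_bilinear M q f g =
     (enn2real (q (\<lambda>x. f x + g x)) - enn2real (q (\<lambda>x. f x - g x))) / 4"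

text \<open>
  The graph of the nonnegative self-adjoint operator \<open>L\<close> of a closed form: \<open>f \<in> D(L)\<close> and
  \<open>L f = g\<close> iff \<open>f \<in> D(q)\<close> and \<open>q(f,h) = \<langle>g,h\<rangle>\<close> for all \<open>h \<in> D(q)\<close>.
  Since \<open>D(q)\<close> is dense, \<open>g\<close> is unique almost everywhere.
\<close>

definition form_operator ::
  "'a measure \<Rightarrow> (('a \<Rightarrow> real) \<Rightarrow> ennreal) \<Rightarrow> ('a \<Rightarrow> real) \<Rightarrow> ('a \<Rightarrow> real) \<Rightarrow> bool" where
  "form_operator M q f g \<longleftrightarrow>
     f \<in> form_dom M q \<and> g \<in> L2 M \<and>
     (\<forall>h\<in>form_dom M q. form_bilinear M q f h = l2_inner M g h)"

definition orthogonal_projection ::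
  "'a measure \<Rightarrow> (('a \<Rightarrow> real) \<Rightarrow> 'a \<Rightarrow> real) \<Rightarrow> bool" where
  "orthogonal_projection M P \<longleftrightarrow>
     (\<forall>f\<in>L2 M. P f \<in> L2 M) \<and>
     (\<forall>f\<in>L2 M. \<forall>g\<in>L2 M. (AE x in M. f x = g x) \<longrightarrow> (AE x in M. P f x = P g x)) \<and>
     (\<forall>f\<in>L2 M. \<forall>g\<in>L2 M. \<forall>a b::real.
        AE x in M. P (\<lambda>y. a * f y + b * g y) x = a * P f x + b * P g x) \<and>
     (\<forall>f\<in>L2 M. AE x in M. P (P f) x = P f x) \<and>
     (\<forall>f\<in>L2 M. \<forall>g\<in>L2 M. l2_inner M (P f) g = l2_inner M f (P g))"

text \<open>
  Projection-valued measures on the Borel sets of the real line. Countable additivity is required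
  of all scalar measures \<open>B \<mapsto> \<langle>E(B)f,f\<rangle>\<close>, which for projections is equivalent to
  additivity in the strong operator topology.
\<close>

definition spectral_measure ::
  "'a measure \<Rightarrow> (real set \<Rightarrow> ('a \<Rightarrow> real) \<Rightarrow> 'a \<Rightarrow> real) \<Rightarrow> bool" where
  "spectral_measure M E \<longleftrightarrow>
     (\<forall>B\<in>sets borel. orthogonal_projection M (E B)) \<and>
     (\<forall>f\<in>L2 M. AE x in M. E UNIV f x = f x) \<and>
     (\<forall>A\<in>sets borel. \<forall>B\<in>sets borel. \<forall>f\<in>L2 M. AE x in M. E (A \<inter> B) f x = E A (E B f) x) \<and>
     (\<forall>f\<in>L2 M. measure_space UNIV (sets borel) (\<lambda>B. ennreal (l2_inner M (E B f) f)))"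

definition scalar_spectral_measure ::
  "'a measure \<Rightarrow> (real set \<Rightarrow> ('a \<Rightarrow> real) \<Rightarrow> 'a \<Rightarrow> real) \<Rightarrow> ('a \<Rightarrow> real) \<Rightarrow> real measure" where
  "scalar_spectral_measure M E f =
     measure_of UNIV (sets borel) (\<lambda>B. ennreal (l2_inner M (E B f) f))"

text \<open>
  \<open>spectral_integral M E \<phi> f g\<close> says that \<open>f\<close> is in the domain of the operator \<open>\<integral>\<phi> dE\<close>, i.e.
  \<open>\<integral>\<phi>\<^sup>2 d\<langle>E f,f\<rangle> < \<infinity>\<close>, and that this operator maps \<open>f\<close> to \<open>g\<close>, i.e.
  \<open>\<langle>g,h\<rangle> = \<integral>\<phi> d\<langle>E f,h\<rangle>\<close>. The signed measure \<open>\<langle>E f,h\<rangle>\<close> is written by polarization as the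
  difference of two positive ones. The test elements \<open>h\<close> range over the (dense) domain of
  \<open>\<integral>\<phi> dE\<close>, which ensures that both integrals converge.
\<close>

definition spectral_integral ::
  "'a measure \<Rightarrow> (real set \<Rightarrow> ('a \<Rightarrow> real) \<Rightarrow> 'a \<Rightarrow> real) \<Rightarrow> (real \<Rightarrow> real) \<Rightarrow>
    ('a \<Rightarrow> real) \<Rightarrow> ('a \<Rightarrow> real) \<Rightarrow> bool" where
  "spectral_integral M E \<phi> f g \<longleftrightarrow>
     f \<in> L2 M \<and> g \<in> L2 M \<and>
     integrable (scalar_spectral_measure M E f) (\<lambda>s. (\<phi> s)\<^sup>2) \<and>
     (\<forall>h\<in>L2 M. integrable (scalar_spectral_measure M E h) (\<lambda>s. (\<phi> s)\<^sup>2) \<longrightarrow>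
        l2_inner M g h =
          ((LINT s|scalar_spectral_measure M E (\<lambda>x. f x + h x). \<phi> s) -
           (LINT s|scalar_spectral_measure M E (\<lambda>x. f x - h x). \<phi> s)) / 4)"

text \<open>\<open>E\<close> is the spectral measure of the operator with graph \<open>L\<close>, that is, \<open>L = \<integral>s dE(s)\<close>.\<close>

definition spectral_resolution ::
  "'a measure \<Rightarrow> (('a \<Rightarrow> real) \<Rightarrow> ('a \<Rightarrow> real) \<Rightarrow> bool) \<Rightarrow>
    (real set \<Rightarrow> ('a \<Rightarrow> real) \<Rightarrow> 'a \<Rightarrow> real) \<Rightarrow> bool" where
  "spectral_resolution M L E \<longleftrightarrow>
     spectral_measure M E \<and> (\<forall>f g. L f g \<longleftrightarrow> spectral_integral M E (\<lambda>s. s) f g)"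

text \<open>
  \<open>T t = exp(-tL)\<close> for \<open>t > 0\<close> in the sense of the functional calculus of the self-adjoint
  operator \<open>L\<close> of the form. By the spectral theorem \<open>E\<close> exists and is unique, so this determines
  \<open>T t f\<close> up to almost-everywhere equality.
\<close>

definition associated_semigroup ::
  "'a measure \<Rightarrow> (('a \<Rightarrow> real) \<Rightarrow> ennreal) \<Rightarrow> (real \<Rightarrow> ('a \<Rightarrow> real) \<Rightarrow> 'a \<Rightarrow> real) \<Rightarrow> bool" where
  "associated_semigroup M q T \<longleftrightarrow>
     (\<exists>E. spectral_resolution M (form_operator M q) E \<and>
       (\<forall>t>0. \<forall>f\<in>L2 M. spectral_integral M E (\<lambda>s. exp (- t * s)) f (T t f)))"

text \<open>
  The integrability clause is part of the meaning of the kernel formula, since the Bochner integral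
  of a non-integrable function is \<open>0\<close> by convention.
\<close>

definition kernel_operators ::
  "'a measure \<Rightarrow> (real \<Rightarrow> ('a \<Rightarrow> real) \<Rightarrow> 'a \<Rightarrow> real) \<Rightarrow> bool" where
  "kernel_operators M T \<longleftrightarrow>
     (\<forall>t>0. \<exists>k. (\<lambda>(x, y). k x y) \<in> borel_measurable (M \<Otimes>\<^sub>M M) \<and>
        (\<forall>x\<in>space M. \<forall>y\<in>space M. 0 \<le> k x y) \<and>
        (\<forall>f\<in>L2 M. AE x in M.
           integrable M (\<lambda>y. k x y * f y) \<and> T t f x = (LINT y|M. k x y * f y)))"

definition strictly_positive_excessive ::
  "'a measure \<Rightarrow> (('a \<Rightarrow> real) \<Rightarrow> ennreal) \<Rightarrow> ('a \<Rightarrow> real) \<Rightarrow> bool" where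
  "strictly_positive_excessive M q h \<longleftrightarrow>
     h \<in> borel_measurable M \<and> (AE x in M. 0 < h x) \<and>
     (\<forall>f\<in>L2 M. q (\<lambda>x. min (f x) (h x)) \<le> q f)"

end

theory Submission
  imports Defs
begin

text \<open>
  Take a strictly positive \<open>g \<in> L\<^sup>2\<close> and \<open>v\<^sub>p = \<Sum>\<^sub>i \<lambda>\<^sub>p\<^sup>i T(i \<tau>) g\<close> with \<open>\<tau> = 2^(-p)\<close> and
  \<open>\<lambda>\<^sub>p\<close> slightly smaller than \<open>1\<close>: then \<open>T\<^sub>t v\<^sub>p \<le> (1 + o(1)) v\<^sub>p\<close> for dyadic \<open>t\<close>. Rescale \<open>v\<^sub>p\<close> so that its
  median with respect to a finite measure \<open>\<nu> \<sim> \<mu>\<close> lies in \<open>[1, 2]\<close>, and let \<open>h = liminf v\<^sub>p\<close>. By Fatou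
  \<open>T\<^sub>t h \<le> h\<close>, so \<open>{h = 0}\<close> and \<open>{h = \<infinity>}\<close> are invariant, hence null or conull. The upper median
  bound excludes \<open>h = \<infinity>\<close> a.e. The kernels exclude \<open>h = 0\<close> a.e.: by the Chapman-Kolmogorov equation and
  irreducibility, \<open>k\<^sub>t(x, y) > 0\<close> for almost every \<open>(x, y)\<close> and some dyadic \<open>t\<close>, so for \<open>x\<close> in a set of positive measure a finite sum of such kernels is bounded below outside a set of small
  \<open>\<nu>\<close>-measure. Integrating it over \<open>{v\<^sub>p \<ge> 1}\<close> bounds \<open>v\<^sub>p(x)\<close> from below.

  Finally \<open>q(f) = sup\<^sub>t \<langle>f - T\<^sub>t f, f\<rangle> / t\<close>, and with \<open>u = f \<and> h\<close> the inequality \<open>T\<^sub>t u \<le> h\<close> gives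
  \<open>\<langle>u - T\<^sub>t u, f - u\<rangle> \<ge> 0\<close>, whence \<open>q(u) \<le> q(f)\<close>.
\<close>

section \<open>Square-integrable functions\<close>

text \<open>Damping is forced by the recurrent case, in which the undamped sum may diverge; its
  price is a factor that tends to 1 at each fixed time. The resulting functions need not be bounded
  in any norm uniformly in \<open>p\<close>, hence the median, which exists for every positive a.e.
  finite function. Its upper bound passes to the pointwise liminf well enough to exclude
  \<open>\<infinity>\<close>. The lower bound does not, since the set where the functions are at
  least 1 may wander with \<open>p\<close>; a kernel bounded below off a small set sees that set
  wherever it lies, and this is what the kernels contribute. Only dyadic times occur, because the
  exceptional null sets depend on the time and have to be united: these times are countable, closed
  under addition, and fine enough to recover \<open>q\<close> as an increasing limit. Both
  \<open>L\<close> and \<open>T\<close> are given only through pairings with the spectral measure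
  \<open>E\<close>. Symmetry, the semigroup law and \<open>q(f) = \<integral> s d<E f, f>\<close>
  are therefore derived from \<open>E\<close> first; closedness of \<open>q\<close> enters in the
  last of these.\<close>

lemma L2_measurable [measurable_dest]: "f \<in> L2 M \<Longrightarrow> f \<in> borel_measurable M"
  by (simp add: L2_def)

lemma L2_square_integrable: "f \<in> L2 M \<Longrightarrow> integrable M (\<lambda>x. (f x)\<^sup>2)"
  by (simp add: L2_def)

lemma L2_dominated:
  assumes "f \<in> L2 M" "g \<in> borel_measurable M" "AE x in M. \<bar>g x\<bar> \<le> \<bar>f x\<bar>"
  shows "g \<in> L2 M"
proof -
  have "integrable M (\<lambda>x. (g x)\<^sup>2)"
    by (rule Bochner_Integration.integrable_bound[OF L2_square_integrable[OF assms(1)]])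
      (use assms in \<open>auto simp: abs_le_square_iff elim: AE_mp\<close>)
  then show ?thesis using assms(2) by (simp add: L2_def)
qed

lemma L2_cong_AE:
  assumes "f \<in> L2 M" "g \<in> borel_measurable M" "AE x in M. f x = g x"
  shows "g \<in> L2 M"
  by (rule L2_dominated[OF assms(1,2)]) (use assms(3) in auto)

lemma L2_mult_integrable:
  assumes "f \<in> L2 M" "g \<in> L2 M"
  shows "integrable M (\<lambda>x. f x * g x)"
proof (rule Bochner_Integration.integrable_bound)
  show "integrable M (\<lambda>x. (f x)\<^sup>2 + (g x)\<^sup>2)"
    using assms by (intro Bochner_Integration.integrable_add L2_square_integrable)
  show "AE x in M. norm (f x * g x) \<le> norm ((f x)\<^sup>2 + (g x)\<^sup>2)"
  proof (rule AE_I2)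
    fix x
    have "\<bar>f x * g x\<bar> \<le> (f x)\<^sup>2 + (g x)\<^sup>2"
    proof -
      have "0 \<le> \<bar>f x\<bar> * \<bar>g x\<bar>" by simp
      then show ?thesis
        using sum_squares_bound[of "\<bar>f x\<bar>" "\<bar>g x\<bar>"] unfolding abs_mult power2_abs by linarith
    qed
    then show "norm (f x * g x) \<le> norm ((f x)\<^sup>2 + (g x)\<^sup>2)" by simp
  qed
qed (use assms in \<open>auto dest!: L2_measurable\<close>)

lemma L2_scale [intro]: "f \<in> L2 M \<Longrightarrow> (\<lambda>x. c * f x) \<in> L2 M"
  by (auto simp: L2_def power_mult_distrib)

lemma L2_add [intro]:
  assumes "f \<in> L2 M" "g \<in> L2 M"
  shows "(\<lambda>x. f x + g x) \<in> L2 M"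
proof -
  have "integrable M (\<lambda>x. (f x)\<^sup>2 + (g x)\<^sup>2 + 2 * (f x * g x))"
    using assms by (intro Bochner_Integration.integrable_add L2_square_integrable
      Bochner_Integration.integrable_mult_right L2_mult_integrable)
  moreover have "(\<lambda>x. (f x)\<^sup>2 + (g x)\<^sup>2 + 2 * (f x * g x)) = (\<lambda>x. (f x + g x)\<^sup>2)"
    by (auto simp: power2_sum)
  ultimately show ?thesis using assms by (auto simp: L2_def)
qed

lemma L2_diff [intro]:
  assumes "f \<in> L2 M" "g \<in> L2 M"
  shows "(\<lambda>x. f x - g x) \<in> L2 M"
  using L2_add[OF assms(1) L2_scale[OF assms(2), of "-1"]] by simp

lemma L2_zero [simp, intro]: "(\<lambda>x. 0) \<in> L2 M"
  by (simp add: L2_def)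

lemma L2_sum [intro]:
  assumes "\<And>i. i \<in> I \<Longrightarrow> f i \<in> L2 M"
  shows "(\<lambda>x. \<Sum>i\<in>I. f i x) \<in> L2 M"
  using assms by (induction I rule: infinite_finite_induct) auto

lemma L2_indicator_mult:
  assumes "f \<in> L2 M" "A \<in> sets M"
  shows "(\<lambda>x. indicator A x * f x) \<in> L2 M"
  by (rule L2_dominated[OF assms(1)]) (use assms in \<open>auto dest: L2_measurable simp: indicator_def\<close>)

section \<open>Inner product and norm\<close>

lemma l2_inner_commute: "l2_inner M f g = l2_inner M g f"
  by (simp add: l2_inner_def mult.commute)

lemma l2_inner_add_left:
  "f \<in> L2 M \<Longrightarrow> g \<in> L2 M \<Longrightarrow> h \<in> L2 M \<Longrightarrow>
    l2_inner M (\<lambda>x. f x + g x) h = l2_inner M f h + l2_inner M g h"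
  by (simp add: l2_inner_def distrib_right L2_mult_integrable)

lemma l2_inner_diff_left:
  "f \<in> L2 M \<Longrightarrow> g \<in> L2 M \<Longrightarrow> h \<in> L2 M \<Longrightarrow>
    l2_inner M (\<lambda>x. f x - g x) h = l2_inner M f h - l2_inner M g h"
  by (simp add: l2_inner_def left_diff_distrib L2_mult_integrable)

lemma l2_inner_scale_left: "l2_inner M (\<lambda>x. c * f x) h = c * l2_inner M f h"
  by (simp add: l2_inner_def mult.assoc)

lemma l2_inner_add_right:
  "f \<in> L2 M \<Longrightarrow> g \<in> L2 M \<Longrightarrow> h \<in> L2 M \<Longrightarrow>
    l2_inner M h (\<lambda>x. f x + g x) = l2_inner M h f + l2_inner M h g"
  by (simp add: l2_inner_commute[of M h] l2_inner_add_left)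

lemma l2_inner_diff_right:
  "f \<in> L2 M \<Longrightarrow> g \<in> L2 M \<Longrightarrow> h \<in> L2 M \<Longrightarrow>
    l2_inner M h (\<lambda>x. f x - g x) = l2_inner M h f - l2_inner M h g"
  by (simp add: l2_inner_commute[of M h] l2_inner_diff_left)

lemma l2_inner_scale_right: "l2_inner M h (\<lambda>x. c * f x) = c * l2_inner M h f"
  by (simp add: l2_inner_commute[of M h] l2_inner_scale_left)

lemma l2_inner_sum_left:
  assumes "\<And>i. i \<in> I \<Longrightarrow> f i \<in> L2 M" "h \<in> L2 M"
  shows "l2_inner M (\<lambda>x. \<Sum>i\<in>I. f i x) h = (\<Sum>i\<in>I. l2_inner M (f i) h)"
  using assms
  by (induction I rule: infinite_finite_induct) (auto simp: l2_inner_add_left L2_sum, auto simp: l2_inner_def)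

lemma l2_inner_cong_AE:
  assumes "AE x in M. f x = f' x" "AE x in M. g x = g' x"
    "f \<in> L2 M" "f' \<in> L2 M" "g \<in> L2 M" "g' \<in> L2 M"
  shows "l2_inner M f g = l2_inner M f' g'"
  unfolding l2_inner_def by (rule integral_cong_AE) (use assms in \<open>auto dest!: L2_measurable\<close>)

lemma l2_inner_nonneg: "0 \<le> l2_inner M f f"
  by (simp add: l2_inner_def)

lemma l2_inner_eq_0:
  assumes "f \<in> L2 M" "l2_inner M f f = 0"
  shows "AE x in M. f x = 0"
proof -
  have "AE x in M. (f x)\<^sup>2 = 0"
    using assms integral_nonneg_eq_0_iff_AE[OF L2_square_integrable[OF assms(1)]]
    by (simp add: l2_inner_def power2_eq_square)
  then show ?thesis by simp
qed

text \<open>The form in which identities between operators are proved below, since \<open>E\<close>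
  and \<open>T\<close> are accessible through their pairings.\<close>

lemma L2_eq_AE_I:
  assumes "f \<in> L2 M" "g \<in> L2 M" "\<And>h. h \<in> L2 M \<Longrightarrow> l2_inner M f h = l2_inner M g h"
  shows "AE x in M. f x = g x"
proof -
  have "l2_inner M (\<lambda>x. f x - g x) (\<lambda>x. f x - g x) = 0"
    using assms by (simp add: l2_inner_diff_left L2_diff)
  from l2_inner_eq_0[OF L2_diff[OF assms(1,2)] this] show ?thesis by simp
qed

lemma l2_cauchy_schwarz:
  assumes "f \<in> L2 M" "g \<in> L2 M"
  shows "\<bar>l2_inner M f g\<bar> \<le> l2_norm M f * l2_norm M g"
proof -
  let ?a = "l2_inner M f f" and ?b = "l2_inner M g g" and ?c = "l2_inner M f g"
  have q: "0 \<le> ?a - 2 * t * ?c + t\<^sup>2 * ?b" for t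
  proof -
    have "l2_inner M (\<lambda>x. f x - t * g x) (\<lambda>x. f x - t * g x) = ?a - 2 * t * ?c + t\<^sup>2 * ?b"
      using assms
      by (simp add: l2_inner_diff_left l2_inner_diff_right L2_diff L2_scale l2_inner_scale_left
          l2_inner_scale_right l2_inner_commute[of M g f] power2_eq_square algebra_simps)
    then show ?thesis using l2_inner_nonneg[of M "\<lambda>x. f x - t * g x"] by simp
  qed
  have "?c\<^sup>2 \<le> ?a * ?b"
  proof (cases "?b = 0")
    case True
    have "?c = 0"
    proof (rule ccontr)
      assume "?c \<noteq> 0"
      \<comment> \<open>For \<open>?b = 0\<close> the polynomial in \<open>q\<close> is affine in
        \<open>t\<close>; this is the \<open>t\<close> at which it equals -1.\<close>
      then have "?a - 2 * ((?a + 1) / (2 * ?c)) * ?c = -1" by (simp add: field_simps)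
      then show False using q[of "(?a + 1) / (2 * ?c)"] True by simp
    qed
    then show ?thesis using True by simp
  next
    case False
    then have "?b > 0" using l2_inner_nonneg[of M g] by simp
    then show ?thesis using q[of "?c / ?b"] by (simp add: field_simps power2_eq_square)
  qed
  then have "sqrt (?c\<^sup>2) \<le> sqrt (?a * ?b)" by (rule real_sqrt_le_mono)
  then show ?thesis by (simp add: l2_norm_def real_sqrt_mult)
qed

lemma l2_norm_nonneg: "0 \<le> l2_norm M f"
  by (simp add: l2_norm_def l2_inner_nonneg)

lemma l2_norm_power2: "(l2_norm M f)\<^sup>2 = l2_inner M f f"
  by (simp add: l2_norm_def l2_inner_nonneg)

lemma l2_norm_triangle:
  assumes "f \<in> L2 M" "g \<in> L2 M"
  shows "l2_norm M (\<lambda>x. f x + g x) \<le> l2_norm M f + l2_norm M g"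
proof (rule power2_le_imp_le)
  have "(l2_norm M (\<lambda>x. f x + g x))\<^sup>2 = l2_inner M f f + l2_inner M g g + 2 * l2_inner M f g"
    using assms unfolding l2_norm_power2
    by (simp add: l2_inner_add_left l2_inner_add_right L2_add l2_inner_commute[of M g f])
  also have "\<dots> \<le> l2_inner M f f + l2_inner M g g + 2 * (l2_norm M f * l2_norm M g)"
    using l2_cauchy_schwarz[OF assms] by simp
  finally show "(l2_norm M (\<lambda>x. f x + g x))\<^sup>2 \<le> (l2_norm M f + l2_norm M g)\<^sup>2"
    by (simp add: power2_sum l2_norm_power2)
qed (simp add: l2_norm_nonneg)

text \<open>The induction carries the exact partial sum of the geometric series, which the weaker
  final bound could not reproduce.\<close>

lemma l2_norm_telescope:
  assumes u: "\<And>n. u n \<in> L2 M" and c: "\<And>n. l2_norm M (\<lambda>x. u (Suc n) x - u n x) \<le> C * (1/2)^n"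
  shows "l2_norm M (\<lambda>x. u (n + k) x - u n x) \<le> 2 * C * (1/2)^n"
proof -
  have "l2_norm M (\<lambda>x. u (n + k) x - u n x) \<le> 2 * C * ((1/2)^n - (1/2)^(n + k))"
  proof (induction k)
    case 0
    then show ?case by (simp add: l2_norm_def l2_inner_def)
  next
    case (Suc k)
    have "l2_norm M (\<lambda>x. u (n + Suc k) x - u n x)
      = l2_norm M (\<lambda>x. (u (Suc (n + k)) x - u (n + k) x) + (u (n + k) x - u n x))"
      by simp
    also have "\<dots> \<le> C * (1/2)^(n + k) + 2 * C * ((1/2)^n - (1/2)^(n + k))"
      by (rule order_trans[OF l2_norm_triangle[OF L2_diff[OF u u] L2_diff[OF u u]]])
        (intro add_mono c Suc)
    also have "\<dots> = 2 * C * ((1/2)^n - (1/2)^(n + Suc k))"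
      by (simp add: algebra_simps)
    finally show ?case .
  qed
  also have "\<dots> \<le> 2 * C * (1/2)^n"
  proof -
    have "0 \<le> C" using order_trans[OF l2_norm_nonneg c[of 0]] by simp
    then show ?thesis by (simp add: algebra_simps)
  qed
  finally show ?thesis .
qed

lemma l2_nn_integral:
  assumes "f \<in> L2 M"
  shows "(\<integral>\<^sup>+x. ennreal ((f x)\<^sup>2) \<partial>M) = ennreal ((l2_norm M f)\<^sup>2)"
  by (subst nn_integral_eq_integral[OF L2_square_integrable[OF assms]])
    (auto simp: l2_norm_power2 l2_inner_def simp flip: power2_eq_square)

section \<open>Completeness for geometrically fast sequences\<close>

context sigma_finite_measure
begin

lemma exists_positive_L2_bounded:
  "\<exists>g. g \<in> L2 M \<and> integrable M g \<and> (\<forall>x. 0 < g x \<and> g x \<le> 1)"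
proof -
  obtain f where f: "f \<in> borel_measurable M" "integral\<^sup>N M f \<noteq> \<infinity>" "\<And>x. x\<in>space M \<Longrightarrow> 0 < f x" "\<And>x. x\<in>space M \<Longrightarrow> f x < \<infinity>"
    using Ex_finite_integrable_function by blast
  \<comment> \<open>The cap at 1 gives \<open>g\<^sup>2 \<le> g\<close>, so integrability implies
    membership in \<open>L2 M\<close>; the value 1 off the space makes positivity
    unconditional.\<close>
  define g where "g = (\<lambda>x. if x \<in> space M then min 1 (enn2real (f x)) else 1)"
  have [measurable]: "g \<in> borel_measurable M" using f(1)
    by (auto simp: g_def cong: measurable_cong)
  have pos: "0 < g x \<and> g x \<le> 1" for x
    using f(3,4)[of x] by (auto simp: g_def enn2real_positive_iff less_top)
  have "(\<integral>\<^sup>+x. ennreal (norm (g x)) \<partial>M) \<le> integral\<^sup>N M f"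
  proof (rule nn_integral_mono)
    fix x assume x: "x \<in> space M"
    have "ennreal (g x) \<le> ennreal (enn2real (f x))" by (auto simp: g_def x intro!: ennreal_leI)
    also have "\<dots> = f x" using f(4)[OF x] by (simp add: less_top)
    finally show "ennreal (norm (g x)) \<le> f x" using pos[of x] by simp
  qed
  then have int: "integrable M g" using f(2)
    by (intro integrableI_bounded) (auto simp: less_top top_unique)
  have "integrable M (\<lambda>x. (g x)\<^sup>2)"
    by (rule Bochner_Integration.integrable_bound[OF int])
     (use pos in \<open>auto intro!: AE_I2 simp: power2_eq_square mult_left_le less_imp_le\<close>)
  then show ?thesis using int pos by (auto simp: L2_def)
qed

text \<open>On a space of infinite measure the increments need not be integrable. Multiplied by a
  strictly positive \<open>g0\<close> in \<open>L2 M\<close> they are, with a summable bound by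
  Cauchy-Schwarz, so the sequence converges a.e.\<close>

lemma L2_fast_Cauchy_limit:
  assumes u: "\<And>n. u n \<in> L2 M" and c: "\<And>n. l2_norm M (\<lambda>x. u (Suc n) x - u n x) \<le> C * (1/2)^n"
  shows "\<exists>g\<in>L2 M. \<forall>n. l2_norm M (\<lambda>x. u n x - g x) \<le> 2 * C * (1/2)^n"
proof -
  have [measurable]: "\<And>n. u n \<in> borel_measurable M" using u by (auto dest: L2_measurable)
  obtain g0 where g0: "g0 \<in> L2 M" "\<And>x. 0 < g0 x" using exists_positive_L2_bounded by blast
  have [measurable]: "g0 \<in> borel_measurable M" using g0 by (auto dest: L2_measurable)
  have C: "0 \<le> C" using order_trans[OF l2_norm_nonneg c[of 0]] by simp
  have "(\<integral>\<^sup>+x. (\<Sum>n. ennreal (\<bar>u (Suc n) x - u n x\<bar> * g0 x)) \<partial>M)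
     = (\<Sum>n. \<integral>\<^sup>+x. ennreal (\<bar>u (Suc n) x - u n x\<bar> * g0 x) \<partial>M)"
    by (rule nn_integral_suminf) measurable
  also have "\<dots> \<le> (\<Sum>n. ennreal (C * l2_norm M g0 * (1/2)^n))"
  proof (rule suminf_le)
    fix n
    let ?d = "\<lambda>x. \<bar>u (Suc n) x - u n x\<bar>"
    have d: "?d \<in> L2 M"
      by (rule L2_dominated[OF L2_diff[OF u u]]) (auto intro!: AE_I2)
    have "(\<integral>\<^sup>+x. ennreal (?d x * g0 x) \<partial>M) = ennreal (l2_inner M ?d g0)"
      unfolding l2_inner_def
      by (rule nn_integral_eq_integral[OF L2_mult_integrable[OF d g0(1)]]) (use g0 in \<open>auto simp: less_imp_le\<close>)
    also have "\<dots> \<le> ennreal (C * l2_norm M g0 * (1/2)^n)"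
    proof (rule ennreal_leI)
      have "l2_inner M ?d g0 \<le> l2_norm M ?d * l2_norm M g0"
        using l2_cauchy_schwarz[OF d g0(1)] by simp
      also have "l2_norm M ?d = l2_norm M (\<lambda>x. u (Suc n) x - u n x)"
        by (simp add: l2_norm_def l2_inner_def)
      also have "\<dots> * l2_norm M g0 \<le> C * (1/2)^n * l2_norm M g0"
        by (intro mult_right_mono c l2_norm_nonneg)
      finally show "l2_inner M ?d g0 \<le> C * l2_norm M g0 * (1/2)^n" by (simp add: ac_simps)
    qed
    finally show "(\<integral>\<^sup>+x. ennreal (?d x * g0 x) \<partial>M) \<le> ennreal (C * l2_norm M g0 * (1/2)^n)" .
  qed auto
  also have "\<dots> < \<infinity>"
  proof -
    have "summable (\<lambda>n. C * l2_norm M g0 * (1/2)^n)" by (intro summable_mult summable_geometric) simp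
    then have "(\<Sum>n. ennreal (C * l2_norm M g0 * (1/2)^n)) = ennreal (\<Sum>n. C * l2_norm M g0 * (1/2)^n)"
      by (intro suminf_ennreal2) (auto intro!: mult_nonneg_nonneg C l2_norm_nonneg)
    then show ?thesis by simp
  qed
  finally have "AE x in M. (\<Sum>n. ennreal (\<bar>u (Suc n) x - u n x\<bar> * g0 x)) \<noteq> \<infinity>"
    by (intro nn_integral_noteq_infinite) auto
  then have conv: "AE x in M. convergent (\<lambda>n. u n x)"
  proof eventually_elim
    case (elim x)
    have "summable (\<lambda>n. \<bar>u (Suc n) x - u n x\<bar> * g0 x)"
      by (rule summable_suminf_not_top) (use elim g0(2)[of x] in \<open>auto simp: less_imp_le\<close>)
    from summable_mult2[OF this, of "inverse (g0 x)"] have "summable (\<lambda>n. \<bar>u (Suc n) x - u n x\<bar>)"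
      using g0(2)[of x] by (simp add: mult.assoc)
    then have "summable (\<lambda>n. u (Suc n) x - u n x)" by (rule summable_rabs_cancel)
    then have "convergent (\<lambda>n. \<Sum>i<n. u (Suc i) x - u i x)" by (simp add: summable_iff_convergent)
    then have "convergent (\<lambda>n. u n x - u 0 x)"
      unfolding sum_lessThan_telescope[of "\<lambda>n. u n x"] .
    then show ?case using convergent_diff_const_right_iff by blast
  qed
  define g where "g = (\<lambda>x. lim (\<lambda>n. u n x))"
  have [measurable]: "g \<in> borel_measurable M" unfolding g_def by measurable
  \<comment> \<open>The telescope bound is uniform in \<open>k\<close>, so Fatou yields both that
    the limit is in \<open>L2 M\<close> and the rate.\<close>
  have fatou: "(\<integral>\<^sup>+x. ennreal ((u n x - g x)\<^sup>2) \<partial>M) \<le> ennreal ((2 * C * (1/2)^n)\<^sup>2)" for n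
  proof -
    have "(\<integral>\<^sup>+x. ennreal ((u n x - g x)\<^sup>2) \<partial>M)
       = (\<integral>\<^sup>+x. liminf (\<lambda>k. ennreal ((u (n + k) x - u n x)\<^sup>2)) \<partial>M)"
    proof (rule nn_integral_cong_AE)
      from conv show "AE x in M. ennreal ((u n x - g x)\<^sup>2) = liminf (\<lambda>k. ennreal ((u (n + k) x - u n x)\<^sup>2))"
      proof eventually_elim
        case (elim x)
        then have "(\<lambda>k. u k x) \<longlonglongrightarrow> g x" by (simp add: g_def convergent_LIMSEQ_iff)
        then have l: "(\<lambda>k. u (n + k) x) \<longlonglongrightarrow> g x" using LIMSEQ_ignore_initial_segment[of "\<lambda>k. u k x" "g x" n] by (simp add: add.commute)
        then have "(\<lambda>k. ennreal ((u (n + k) x - u n x)\<^sup>2)) \<longlonglongrightarrow> ennreal ((g x - u n x)\<^sup>2)"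
          by (intro tendsto_intros)
        then show ?case using lim_imp_Liminf[OF sequentially_bot] by (metis power2_commute)
      qed
    qed
    also have "\<dots> \<le> liminf (\<lambda>k. \<integral>\<^sup>+x. ennreal ((u (n + k) x - u n x)\<^sup>2) \<partial>M)"
      by (rule nn_integral_liminf) measurable
    also have "\<dots> \<le> liminf (\<lambda>k. ennreal ((2 * C * (1/2)^n)\<^sup>2))"
      by (intro Liminf_mono always_eventually allI)
        (auto simp only: l2_nn_integral[OF L2_diff[OF u u]] intro!: ennreal_leI power_mono l2_norm_telescope[OF u c] l2_norm_nonneg)
    also have "\<dots> = ennreal ((2 * C * (1/2)^n)\<^sup>2)" by (rule Liminf_const) simp
    finally show ?thesis .
  qed
  have d: "(\<lambda>x. u n x - g x) \<in> L2 M" for n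
  proof -
    have "integrable M (\<lambda>x. (u n x - g x)\<^sup>2)"
      by (rule integrableI_bounded) (use le_less_trans[OF fatou[of n] ennreal_less_top] in auto)
    then show ?thesis by (simp add: L2_def)
  qed
  have "(\<lambda>x. u 0 x - (u 0 x - g x)) \<in> L2 M" by (intro L2_diff u d)
  then have "g \<in> L2 M" by simp
  moreover have "l2_norm M (\<lambda>x. u n x - g x) \<le> 2 * C * (1/2)^n" for n
    using fatou[of n] unfolding l2_nn_integral[OF d]
    by (subst (asm) ennreal_le_iff) (auto intro: power2_le_imp_le simp: C)
  ultimately show ?thesis by blast
qed

end

section \<open>Spectral measures\<close>

text \<open>Equality of two signed measures \<open>a - d\<close> and \<open>c - b\<close>, stated
  without subtraction. The signed measures \<open><E f, h>\<close> are handled only in this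
  shape.\<close>

lemma nn_integral_add_measure_cong:
  assumes sets: "sets a = sets N" "sets b = sets N" "sets c = sets N" "sets d = sets N"
    and eq: "\<And>C. C \<in> sets N \<Longrightarrow> emeasure a C + emeasure b C = emeasure c C + emeasure d C"
    and "\<phi> \<in> borel_measurable N"
  shows "(\<integral>\<^sup>+x. \<phi> x \<partial>a) + (\<integral>\<^sup>+x. \<phi> x \<partial>b) = (\<integral>\<^sup>+x. \<phi> x \<partial>c) + (\<integral>\<^sup>+x. \<phi> x \<partial>d)"
proof -
  note [measurable_cong] = sets
  from assms(6) show ?thesis
  proof (induction rule: borel_measurable_induct)
    case (cong f g)
    have "(\<integral>\<^sup>+x. f x \<partial>m) = (\<integral>\<^sup>+x. g x \<partial>m)" if "sets m = sets N" for m
      by (rule nn_integral_cong) (use cong sets_eq_imp_space_eq[OF that] in auto)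
    then show ?case using cong sets by simp
  next
    case (set A)
    then show ?case by (simp add: sets eq)
  next
    case (mult u k)
    note [measurable] = mult.hyps(2)
    have "(\<integral>\<^sup>+x. k * u x \<partial>m) = k * (\<integral>\<^sup>+x. u x \<partial>m)" if [measurable_cong]: "sets m = sets N" for m
      by (rule nn_integral_cmult) auto
    then show ?case using mult.IH sets by (simp flip: distrib_left)
  next
    case (add u v)
    note [measurable] = add.hyps(1,3)
    have "(\<integral>\<^sup>+x. u x + v x \<partial>m) = (\<integral>\<^sup>+x. u x \<partial>m) + (\<integral>\<^sup>+x. v x \<partial>m)" if [measurable_cong]: "sets m = sets N" for m
      by (rule nn_integral_add) auto
    then have s: "(\<integral>\<^sup>+x. v x + u x \<partial>m) = (\<integral>\<^sup>+x. u x \<partial>m) + (\<integral>\<^sup>+x. v x \<partial>m)" if "sets m = sets N" for m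
      using that by (simp add: add.commute)
    have ac: "(p + q) + (r + t) = (p + r) + (q + t)" for p q r t :: ennreal
      by (simp only: ac_simps)
    show ?case unfolding s[OF sets(1)] s[OF sets(2)] s[OF sets(3)] s[OF sets(4)]
      by (subst (1 2) ac) (simp only: add.IH)
  next
    case (seq U)
    note [measurable] = seq.hyps(1)
    have s: "(\<integral>\<^sup>+x. (SUP i. U i) x \<partial>m) = (SUP i. \<integral>\<^sup>+x. U i x \<partial>m)" if [measurable_cong]: "sets m = sets N" for m
      unfolding SUP_apply by (rule nn_integral_monotone_convergence_SUP) (use seq.hyps(3) in auto)
    have i: "incseq (\<lambda>i. \<integral>\<^sup>+x. U i x \<partial>m)" for m
      using seq.hyps(3) by (auto simp: incseq_def le_fun_def intro!: nn_integral_mono)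
    show ?case
      by (simp only: s sets ennreal_SUP_add[OF i i, symmetric] seq.IH)
  qed
qed

text \<open>The nonnegative version is applied to the positive and to the negative part of
  \<open>\<phi>\<close>; finiteness allows the passage back to real numbers.\<close>

lemma integral_add_measure_cong:
  fixes \<phi> :: "'b \<Rightarrow> real"
  assumes sets: "sets a = sets N" "sets b = sets N" "sets c = sets N" "sets d = sets N"
    and eq: "\<And>C. C \<in> sets N \<Longrightarrow> emeasure a C + emeasure b C = emeasure c C + emeasure d C"
    and int: "integrable a \<phi>" "integrable b \<phi>" "integrable c \<phi>" "integrable d \<phi>"
  shows "(\<integral>x. \<phi> x \<partial>a) + (\<integral>x. \<phi> x \<partial>b) = (\<integral>x. \<phi> x \<partial>c) + (\<integral>x. \<phi> x \<partial>d)"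
proof -
  have [measurable]: "\<phi> \<in> borel_measurable N"
    using borel_measurable_integrable[OF int(1)] by (simp add: measurable_cong_sets[OF sets(1) refl])
  have fin: "(\<integral>\<^sup>+x. ennreal (\<phi> x) \<partial>m) < top" "(\<integral>\<^sup>+x. ennreal (- \<phi> x) \<partial>m) < top" if "integrable m \<phi>" for m
    using that by (auto simp: real_integrable_def less_top)
  have "enn2real (\<integral>\<^sup>+x. ennreal (\<psi> x) \<partial>a) + enn2real (\<integral>\<^sup>+x. ennreal (\<psi> x) \<partial>b)
     = enn2real (\<integral>\<^sup>+x. ennreal (\<psi> x) \<partial>c) + enn2real (\<integral>\<^sup>+x. ennreal (\<psi> x) \<partial>d)"
    if "\<psi> = \<phi> \<or> \<psi> = (\<lambda>x. - \<phi> x)" for \<psi>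
  proof -
    have [measurable]: "\<psi> \<in> borel_measurable N" using that by auto
    have "(\<integral>\<^sup>+x. ennreal (\<psi> x) \<partial>a) + (\<integral>\<^sup>+x. ennreal (\<psi> x) \<partial>b)
      = (\<integral>\<^sup>+x. ennreal (\<psi> x) \<partial>c) + (\<integral>\<^sup>+x. ennreal (\<psi> x) \<partial>d)"
      by (rule nn_integral_add_measure_cong[OF sets eq]) auto
    then show ?thesis using fin[OF int(1)] fin[OF int(2)] fin[OF int(3)] fin[OF int(4)] that
      by (auto simp flip: enn2real_plus)
  qed
  from this[of \<phi>] this[of "\<lambda>x. - \<phi> x"] show ?thesis
    by (simp add: real_lebesgue_integral_def int)
qed

text \<open>The integral of \<open>\<phi>\<close> against the signed measure
  \<open><E f, h>\<close>, polarised as in \<open>spectral_integral\<close>. It behaves bilinearly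
  only where the integrals converge.\<close>

definition spectral_form ::
  "'a measure \<Rightarrow> (real set \<Rightarrow> ('a \<Rightarrow> real) \<Rightarrow> 'a \<Rightarrow> real) \<Rightarrow> (real \<Rightarrow> real) \<Rightarrow>
    ('a \<Rightarrow> real) \<Rightarrow> ('a \<Rightarrow> real) \<Rightarrow> real" where
  "spectral_form M E \<phi> f h =
    ((LINT s|scalar_spectral_measure M E (\<lambda>x. f x + h x). \<phi> s) -
     (LINT s|scalar_spectral_measure M E (\<lambda>x. f x - h x). \<phi> s)) / 4"

section \<open>Scalar spectral measures and their polarised integrals\<close>

locale spectral = sigma_finite_measure M for M :: "'a measure" +
  fixes E :: "real set \<Rightarrow> ('a \<Rightarrow> real) \<Rightarrow> 'a \<Rightarrow> real"
  assumes spectral: "spectral_measure M E"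
begin

abbreviation "\<mu> f \<equiv> scalar_spectral_measure M E f"
abbreviation "ip f g \<equiv> l2_inner M f g"
abbreviation "I \<phi> f h \<equiv> spectral_form M E \<phi> f h"

lemma E_projection: "B \<in> sets borel \<Longrightarrow> orthogonal_projection M (E B)"
  using spectral by (simp add: spectral_measure_def)

lemma E_L2 [simp, intro]: "B \<in> sets borel \<Longrightarrow> f \<in> L2 M \<Longrightarrow> E B f \<in> L2 M"
  using E_projection[of B] by (simp add: orthogonal_projection_def)

lemma E_sym: "B \<in> sets borel \<Longrightarrow> f \<in> L2 M \<Longrightarrow> g \<in> L2 M \<Longrightarrow> ip (E B f) g = ip f (E B g)"
  using E_projection[of B] by (simp add: orthogonal_projection_def)

lemma E_Int:
  assumes "A \<in> sets borel" "B \<in> sets borel" "f \<in> L2 M" "h \<in> L2 M"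
  shows "ip (E A (E B f)) h = ip (E (A \<inter> B) f) h"
proof -
  have "AE x in M. E (A \<inter> B) f x = E A (E B f) x"
    using spectral assms by (simp add: spectral_measure_def)
  then show ?thesis using assms by (intro l2_inner_cong_AE) auto
qed

lemma E_linear:
  assumes "B \<in> sets borel" "f \<in> L2 M" "g \<in> L2 M" "h \<in> L2 M"
  shows "ip (E B (\<lambda>x. a * f x + b * g x)) h = a * ip (E B f) h + b * ip (E B g) h"
proof -
  have "AE x in M. E B (\<lambda>y. a * f y + b * g y) x = a * E B f x + b * E B g x"
    using E_projection[of B] assms by (simp add: orthogonal_projection_def)
  then have "ip (E B (\<lambda>x. a * f x + b * g x)) h = ip (\<lambda>x. a * E B f x + b * E B g x) h"
    using assms by (intro l2_inner_cong_AE) (auto intro!: L2_add L2_scale E_L2)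
  then show ?thesis using assms by (simp add: l2_inner_add_left L2_scale l2_inner_scale_left)
qed

lemma E_UNIV: "f \<in> L2 M \<Longrightarrow> h \<in> L2 M \<Longrightarrow> ip (E UNIV f) h = ip f h"
  using spectral by (intro l2_inner_cong_AE) (auto simp: spectral_measure_def)

lemma E_inner_self: "B \<in> sets borel \<Longrightarrow> f \<in> L2 M \<Longrightarrow> ip (E B f) f = ip (E B f) (E B f)"
  using E_Int[of B B f f] E_sym[of B "E B f" f] by simp

lemma sets_mu [simp, measurable_cong]: "sets (\<mu> f) = sets borel"
  and space_mu [simp]: "space (\<mu> f) = UNIV"
  by (auto simp: scalar_spectral_measure_def)
    (metis sets.sigma_sets_eq sets_measure_of space_borel sets.space_closed)+

lemma emeasure_mu:
  assumes "f \<in> L2 M" "B \<in> sets borel"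
  shows "emeasure (\<mu> f) B = ennreal (ip (E B f) f)"
proof -
  have "measure_space UNIV (sets borel) (\<lambda>B. ennreal (ip (E B f) f))"
    using spectral assms by (simp add: spectral_measure_def)
  then show ?thesis unfolding scalar_spectral_measure_def measure_space_def
    by (intro emeasure_measure_of_sigma) (use assms in auto)
qed

lemma measure_mu: "f \<in> L2 M \<Longrightarrow> B \<in> sets borel \<Longrightarrow> measure (\<mu> f) B = ip (E B f) f"
  by (simp add: measure_def emeasure_mu E_inner_self l2_inner_nonneg)

lemma finite_measure_mu: "f \<in> L2 M \<Longrightarrow> finite_measure (\<mu> f)"
  by (rule finite_measureI) (simp add: emeasure_mu)

lemma measure_mu_UNIV: "f \<in> L2 M \<Longrightarrow> measure (\<mu> f) UNIV = ip f f"
  by (simp add: measure_mu E_UNIV)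

lemma E_inner_commute:
  "B \<in> sets borel \<Longrightarrow> f \<in> L2 M \<Longrightarrow> h \<in> L2 M \<Longrightarrow> ip (E B f) h = ip (E B h) f"
  by (metis E_sym l2_inner_commute)

lemma measure_mu_add:
  assumes [simp]: "f \<in> L2 M" "h \<in> L2 M" "B \<in> sets borel"
  shows "measure (\<mu> (\<lambda>x. f x + h x)) B = measure (\<mu> f) B + measure (\<mu> h) B + 2 * ip (E B f) h"
    and "measure (\<mu> (\<lambda>x. f x - h x)) B = measure (\<mu> f) B + measure (\<mu> h) B - 2 * ip (E B f) h"
proof -
  have [simp]: "(\<lambda>x. f x + h x) \<in> L2 M" "(\<lambda>x. f x - h x) \<in> L2 M" by (auto intro: L2_add L2_diff)
  have 1: "ip (E B (\<lambda>x. f x + h x)) k = ip (E B f) k + ip (E B h) k"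
    and 2: "ip (E B (\<lambda>x. f x - h x)) k = ip (E B f) k - ip (E B h) k" if "k \<in> L2 M" for k
    using E_linear[of B f h k 1 1] E_linear[of B f h k 1 "-1"] that by auto
  show "measure (\<mu> (\<lambda>x. f x + h x)) B = measure (\<mu> f) B + measure (\<mu> h) B + 2 * ip (E B f) h"
    by (simp add: measure_mu 1 l2_inner_add_right E_inner_commute[of B h f])
  show "measure (\<mu> (\<lambda>x. f x - h x)) B = measure (\<mu> f) B + measure (\<mu> h) B - 2 * ip (E B f) h"
    by (simp add: measure_mu 2 l2_inner_diff_right E_inner_commute[of B h f])
qed

lemma emeasure_mu_eq_measure: "f \<in> L2 M \<Longrightarrow> emeasure (\<mu> f) B = ennreal (measure (\<mu> f) B)"
  by (simp add: finite_measure.emeasure_eq_measure finite_measure_mu)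

text \<open>The parallelogram law holds for the measures themselves, as the mixed terms
  \<open><E B f, h>\<close> cancel. It transfers integrability from \<open>f\<close> and
  \<open>h\<close> to \<open>f + h\<close> and \<open>f - h\<close>, where the polarised integrals
  live.\<close>

lemma nn_integral_mu_parallelogram:
  assumes f: "f \<in> L2 M" "h \<in> L2 M" and [measurable]: "\<phi> \<in> borel_measurable borel"
  shows "(\<integral>\<^sup>+s. \<phi> s \<partial>\<mu> (\<lambda>x. f x + h x)) + (\<integral>\<^sup>+s. \<phi> s \<partial>\<mu> (\<lambda>x. f x - h x))
    = 2 * (\<integral>\<^sup>+s. \<phi> s \<partial>\<mu> f) + 2 * (\<integral>\<^sup>+s. \<phi> s \<partial>\<mu> h)"
proof -
  have "(\<integral>\<^sup>+s. \<phi> s \<partial>\<mu> (\<lambda>x. f x + h x)) + (\<integral>\<^sup>+s. \<phi> s \<partial>\<mu> (\<lambda>x. f x - h x))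
    = (\<integral>\<^sup>+s. \<phi> s \<partial>density (\<mu> f) (\<lambda>_. 2)) + (\<integral>\<^sup>+s. \<phi> s \<partial>density (\<mu> h) (\<lambda>_. 2))"
  proof (rule nn_integral_add_measure_cong[where N = borel])
    fix C :: "real set" assume C: "C \<in> sets borel"
    have "emeasure (density (\<mu> g) (\<lambda>_. 2)) C = ennreal (2 * measure (\<mu> g) C)" if "g \<in> L2 M" for g
      using C that by (simp add: emeasure_density nn_integral_cmult emeasure_mu_eq_measure ennreal_mult')
    then show "emeasure (\<mu> (\<lambda>x. f x + h x)) C + emeasure (\<mu> (\<lambda>x. f x - h x)) C
        = emeasure (density (\<mu> f) (\<lambda>_. 2)) C + emeasure (density (\<mu> h) (\<lambda>_. 2)) C"
      using f C by (simp add: emeasure_mu_eq_measure L2_add L2_diff flip: ennreal_plus)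
        (simp add: measure_mu_add)
  qed auto
  then show ?thesis by (simp add: nn_integral_density nn_integral_cmult)
qed

lemma integrable_mu_add_diff:
  fixes \<phi> :: "real \<Rightarrow> real"
  assumes "f \<in> L2 M" "h \<in> L2 M" and int: "integrable (\<mu> f) \<phi>" "integrable (\<mu> h) \<phi>"
  shows "integrable (\<mu> (\<lambda>x. f x + h x)) \<phi>" "integrable (\<mu> (\<lambda>x. f x - h x)) \<phi>"
proof -
  have [measurable]: "\<phi> \<in> borel_measurable borel"
    using borel_measurable_integrable[OF int(1)] by (simp add: measurable_cong_sets[OF sets_mu refl])
  have "(\<integral>\<^sup>+s. norm (\<phi> s) \<partial>\<mu> (\<lambda>x. f x + h x)) + (\<integral>\<^sup>+s. norm (\<phi> s) \<partial>\<mu> (\<lambda>x. f x - h x)) < \<infinity>"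
    using int by (subst nn_integral_mu_parallelogram[OF assms(1,2)])
      (auto simp: integrable_iff_bounded ennreal_mult_less_top)
  then show "integrable (\<mu> (\<lambda>x. f x + h x)) \<phi>" "integrable (\<mu> (\<lambda>x. f x - h x)) \<phi>"
    by (auto simp: integrable_iff_bounded)
qed

lemma integrable_mu_bounded:
  fixes \<phi> :: "real \<Rightarrow> real"
  assumes "f \<in> L2 M" "\<phi> \<in> borel_measurable borel" "\<And>s. \<bar>\<phi> s\<bar> \<le> R"
  shows "integrable (\<mu> f) \<phi>"
  using assms by (intro finite_measure.integrable_const_bound[OF finite_measure_mu, where B = R])
    (auto simp: measurable_cong_sets[OF sets_mu refl])

lemma spectral_form_indicator:
  assumes "f \<in> L2 M" "h \<in> L2 M" "B \<in> sets borel"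
  shows "I (indicator B) f h = ip (E B f) h"
  using assms by (simp add: spectral_form_def measure_mu_add)

text \<open>This is \<open>d\<langle>E f\<^sub>1, h\<^sub>1\<rangle> = \<psi> d\<langle>E f\<^sub>2, h\<^sub>2\<rangle>\<close>, integrated against \<open>\<phi>\<close>.\<close>

lemma spectral_form_density:
  assumes L2 [simp]: "f\<^sub>1 \<in> L2 M" "h\<^sub>1 \<in> L2 M" "f\<^sub>2 \<in> L2 M" "h\<^sub>2 \<in> L2 M"
    and [measurable]: "\<psi> \<in> borel_measurable borel" and nn: "\<And>s. 0 \<le> \<psi> s"
    and int\<psi>: "integrable (\<mu> f\<^sub>2) \<psi>" "integrable (\<mu> h\<^sub>2) \<psi>"
    and int\<phi>: "integrable (\<mu> f\<^sub>1) \<phi>" "integrable (\<mu> h\<^sub>1) \<phi>"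
    and int: "integrable (\<mu> f\<^sub>2) (\<lambda>s. \<phi> s * \<psi> s)" "integrable (\<mu> h\<^sub>2) (\<lambda>s. \<phi> s * \<psi> s)"
    and eq: "\<And>C. C \<in> sets borel \<Longrightarrow> ip (E C f\<^sub>1) h\<^sub>1 = I (\<lambda>s. indicator C s * \<psi> s) f\<^sub>2 h\<^sub>2"
  shows "I \<phi> f\<^sub>1 h\<^sub>1 = I (\<lambda>s. \<phi> s * \<psi> s) f\<^sub>2 h\<^sub>2"
proof -
  have [simp]: "(\<lambda>x. f\<^sub>1 x + h\<^sub>1 x) \<in> L2 M" "(\<lambda>x. f\<^sub>1 x - h\<^sub>1 x) \<in> L2 M"
     "(\<lambda>x. f\<^sub>2 x + h\<^sub>2 x) \<in> L2 M" "(\<lambda>x. f\<^sub>2 x - h\<^sub>2 x) \<in> L2 M" by (auto intro: L2_add L2_diff)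
  have [measurable]: "\<phi> \<in> borel_measurable borel"
    using borel_measurable_integrable[OF int\<phi>(1)] by (simp add: measurable_cong_sets[OF sets_mu refl])
  note i\<psi> = integrable_mu_add_diff[OF L2(3,4) int\<psi>] and i\<phi> = integrable_mu_add_diff[OF L2(1,2) int\<phi>]
    and i = integrable_mu_add_diff[OF L2(3,4) int]
  have dens: "integrable (density (\<mu> g) \<psi>) \<phi>" if "integrable (\<mu> g) (\<lambda>s. \<phi> s * \<psi> s)" for g
    using that nn by (subst integrable_density) (auto simp: mult.commute)
  have dens': "(\<integral>s. \<phi> s \<partial>density (\<mu> g) \<psi>) = (\<integral>s. \<phi> s * \<psi> s \<partial>\<mu> g)" for g
    using nn by (subst integral_density) (auto simp: mult.commute)
  have em: "emeasure (density (\<mu> g) \<psi>) C = ennreal (\<integral>s. indicator C s * \<psi> s \<partial>\<mu> g)"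
    if "C \<in> sets borel" "integrable (\<mu> g) \<psi>" for C g
  proof -
    have "(\<integral>\<^sup>+s. ennreal (\<psi> s) * indicator C s \<partial>\<mu> g) = (\<integral>\<^sup>+s. ennreal (indicator C s * \<psi> s) \<partial>\<mu> g)"
      by (intro nn_integral_cong) (auto simp: indicator_def)
    also have "\<dots> = ennreal (\<integral>s. indicator C s * \<psi> s \<partial>\<mu> g)"
      by (rule nn_integral_eq_integral)
        (use that nn in \<open>auto intro!: integrable_real_mult_indicator simp: mult.commute[of "indicator _ _"]\<close>)
    finally show ?thesis using that by (simp add: emeasure_density)
  qed
  \<comment> \<open>The assumed identity of signed measures, with the negative members moved across
    so that only positive measures occur. Nonnegativity of \<open>\<psi>\<close> makes the densities
    measures.\<close>
  have "(\<integral>s. \<phi> s \<partial>\<mu> (\<lambda>x. f\<^sub>1 x + h\<^sub>1 x)) + (\<integral>s. \<phi> s \<partial>density (\<mu> (\<lambda>x. f\<^sub>2 x - h\<^sub>2 x)) \<psi>)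
      = (\<integral>s. \<phi> s \<partial>\<mu> (\<lambda>x. f\<^sub>1 x - h\<^sub>1 x)) + (\<integral>s. \<phi> s \<partial>density (\<mu> (\<lambda>x. f\<^sub>2 x + h\<^sub>2 x)) \<psi>)"
  proof (rule integral_add_measure_cong[where N = borel])
    fix C :: "real set" assume C: "C \<in> sets borel"
    have "measure (\<mu> (\<lambda>x. f\<^sub>1 x + h\<^sub>1 x)) C + (\<integral>s. indicator C s * \<psi> s \<partial>\<mu> (\<lambda>x. f\<^sub>2 x - h\<^sub>2 x))
      = measure (\<mu> (\<lambda>x. f\<^sub>1 x - h\<^sub>1 x)) C + (\<integral>s. indicator C s * \<psi> s \<partial>\<mu> (\<lambda>x. f\<^sub>2 x + h\<^sub>2 x))"
      using eq[OF C] C by (simp add: measure_mu_add spectral_form_def)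
    then show "emeasure (\<mu> (\<lambda>x. f\<^sub>1 x + h\<^sub>1 x)) C + emeasure (density (\<mu> (\<lambda>x. f\<^sub>2 x - h\<^sub>2 x)) \<psi>) C
      = emeasure (\<mu> (\<lambda>x. f\<^sub>1 x - h\<^sub>1 x)) C + emeasure (density (\<mu> (\<lambda>x. f\<^sub>2 x + h\<^sub>2 x)) \<psi>) C"
      using C nn by (simp add: em i\<psi> emeasure_mu_eq_measure flip: ennreal_plus)
  qed (use i\<phi> i dens in auto)
  then show ?thesis by (simp add: spectral_form_def dens')
qed

text \<open>The measure of \<open>f + f\<close> is four times that of \<open>f\<close> and the
  measure of \<open>f - f\<close> vanishes, which the factor 1/4 absorbs.\<close>

lemma spectral_form_diag:
  assumes f: "f \<in> L2 M" and int: "integrable (\<mu> f) \<phi>"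
  shows "I \<phi> f f = (\<integral>s. \<phi> s \<partial>\<mu> f)"
proof -
  have [measurable]: "\<phi> \<in> borel_measurable borel"
    using borel_measurable_integrable[OF int(1)] by (simp add: measurable_cong_sets[OF sets_mu refl])
  have m: "measure (\<mu> (\<lambda>x. f x + f x)) C = 4 * measure (\<mu> f) C"
    "measure (\<mu> (\<lambda>x. f x - f x)) C = 0" if "C \<in> sets borel" for C
    unfolding measure_mu_add[OF f f that] using f that by (simp_all add: measure_mu)
  have 1: "\<mu> (\<lambda>x. f x + f x) = density (\<mu> f) (\<lambda>_. ennreal 4)"
  proof (rule measure_eqI)
    fix C assume "C \<in> sets (\<mu> (\<lambda>x. f x + f x))"
    then have C: "C \<in> sets borel" by simp
    show "emeasure (\<mu> (\<lambda>x. f x + f x)) C = emeasure (density (\<mu> f) (\<lambda>_. ennreal 4)) C"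
      unfolding emeasure_mu_eq_measure[OF L2_add[OF f f]] m(1)[OF C]
      using C f by (simp add: emeasure_density nn_integral_cmult emeasure_mu_eq_measure ennreal_mult')
  qed simp
  have "emeasure (\<mu> (\<lambda>x. f x - f x)) UNIV = 0"
    using m(2)[of UNIV] emeasure_mu_eq_measure[OF L2_diff[OF f f], of UNIV] by simp
  then have "AE s in \<mu> (\<lambda>x. f x - f x). \<phi> s = 0"
    by (intro AE_I[where N = UNIV]) auto
  then have 2: "(\<integral>s. \<phi> s \<partial>\<mu> (\<lambda>x. f x - f x)) = 0" by (rule integral_eq_zero_AE)
  show ?thesis unfolding spectral_form_def 2 1 by (subst integral_density) auto
qed

lemma spectral_form_commute:
  assumes "f \<in> L2 M" "h \<in> L2 M"
  shows "I \<phi> f h = I \<phi> h f"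
proof -
  have "\<mu> (\<lambda>x. f x - h x) = \<mu> (\<lambda>x. h x - f x)"
    by (rule measure_eqI)
      (use assms in \<open>auto simp: emeasure_mu_eq_measure L2_diff measure_mu_add E_inner_commute[of _ f h] add.commute\<close>)
  moreover have "(\<lambda>x. f x + h x) = (\<lambda>x. h x + f x)" by auto
  ultimately show ?thesis by (simp add: spectral_form_def)
qed

text \<open>Each of the two integrals is at most \<open>\<epsilon>\<close> times a total mass, and
  the masses add up to \<open>2 * (ip f f + ip h h)\<close>. A sum of squares on the right suffices,
  since \<open>h\<close> will be absorbed.\<close>

lemma spectral_form_bound:
  assumes [simp]: "f \<in> L2 M" "h \<in> L2 M"
    and [measurable]: "\<phi> \<in> borel_measurable borel" and b: "\<And>s. \<bar>\<phi> s\<bar> \<le> \<epsilon>"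
  shows "\<bar>I \<phi> f h\<bar> \<le> \<epsilon> * (ip f f + ip h h) / 2"
proof -
  have *: "\<bar>\<integral>s. \<phi> s \<partial>\<mu> g\<bar> \<le> \<epsilon> * measure (\<mu> g) UNIV" if "g \<in> L2 M" for g
  proof -
    interpret finite_measure "\<mu> g" using that by (rule finite_measure_mu)
    have "\<bar>\<integral>s. \<phi> s \<partial>\<mu> g\<bar> \<le> (\<integral>s. \<bar>\<phi> s\<bar> \<partial>\<mu> g)" by (rule integral_abs_bound)
    also have "\<dots> \<le> (\<integral>s. \<epsilon> \<partial>\<mu> g)"
      using b by (intro integral_mono integrable_abs integrable_mu_bounded[OF that]) auto
    finally show ?thesis by (simp add: mult.commute)
  qed
  have "\<bar>I \<phi> f h\<bar> \<le> (\<epsilon> * measure (\<mu> (\<lambda>x. f x + h x)) UNIV + \<epsilon> * measure (\<mu> (\<lambda>x. f x - h x)) UNIV) / 4"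
    using *[OF L2_add, of f h] *[OF L2_diff, of f h] by (simp add: spectral_form_def)
  also have "\<dots> = \<epsilon> * (ip f f + ip h h) / 2"
    by (simp add: measure_mu_add measure_mu_UNIV field_simps)
  finally show ?thesis .
qed

lemma spectral_form_diff:
  assumes "f \<in> L2 M" "h \<in> L2 M" "integrable (\<mu> f) \<phi>" "integrable (\<mu> h) \<phi>"
    "integrable (\<mu> f) \<psi>" "integrable (\<mu> h) \<psi>"
  shows "I (\<lambda>s. \<phi> s - \<psi> s) f h = I \<phi> f h - I \<psi> f h"
  using integrable_mu_add_diff[OF assms(1-4)] integrable_mu_add_diff[OF assms(1,2,5,6)]
  by (simp add: spectral_form_def diff_divide_distrib)

lemma spectral_form_simple:
  assumes f: "f \<in> L2 M" "h \<in> L2 M" and "finite J" and B: "\<And>i. i \<in> J \<Longrightarrow> B i \<in> sets borel"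
  shows "I (\<lambda>s. \<Sum>i\<in>J. c i * indicator (B i) s) f h = ip (\<lambda>x. \<Sum>i\<in>J. c i * E (B i) f x) h"
proof -
  have "(\<integral>s. (\<Sum>i\<in>J. c i * indicator (B i) s) \<partial>\<mu> g) = (\<Sum>i\<in>J. c i * measure (\<mu> g) (B i))"
    if "g \<in> L2 M" for g
  proof -
    interpret finite_measure "\<mu> g" using that by (rule finite_measure_mu)
    have "integrable (\<mu> g) (\<lambda>s. c i * indicator (B i) s)" if "i \<in> J" for i
      using B[OF that] by (intro integrable_mult_right integrable_real_indicator) (auto simp: emeasure_eq_measure)
    then have "(\<integral>s. (\<Sum>i\<in>J. c i * indicator (B i) s) \<partial>\<mu> g) = (\<Sum>i\<in>J. \<integral>s. c i * indicator (B i) s \<partial>\<mu> g)"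
      by (rule Bochner_Integration.integral_sum)
    then show ?thesis using B by simp
  qed
  then have "I (\<lambda>s. \<Sum>i\<in>J. c i * indicator (B i) s) f h = (\<Sum>i\<in>J. c i * ip (E (B i) f) h)"
    using f B by (simp add: spectral_form_def L2_add L2_diff measure_mu_add sum_divide_distrib
        flip: sum_subtractf right_diff_distrib)
  also have "\<dots> = ip (\<lambda>x. \<Sum>i\<in>J. c i * E (B i) f x) h"
    using f B by (subst l2_inner_sum_left) (auto simp: l2_inner_scale_left)
  finally show ?thesis .
qed

text \<open>The vector is the limit of \<open>\<integral>\<Phi>\<^sub>n dE f\<close> for step
  functions \<open>\<Phi>\<^sub>n\<close> converging uniformly to \<open>\<phi>\<close>. It is
  needed to exhibit \<open>L (E B f)\<close> for bounded \<open>B\<close>.\<close>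

lemma bounded_functional_calculus:
  assumes f [simp]: "f \<in> L2 M" and [measurable]: "\<phi> \<in> borel_measurable borel" and b: "\<And>s. \<bar>\<phi> s\<bar> \<le> R"
  shows "\<exists>g\<in>L2 M. \<forall>h\<in>L2 M. ip g h = I \<phi> f h"
proof -
  \<comment> \<open>The mesh is \<open>4^-n\<close> because the estimate below bounds squared norms;
    the square root leaves the rate \<open>2^-n\<close> that \<open>L2_fast_Cauchy_limit\<close>
    expects.\<close>
  define \<Phi> where "\<Phi> n s = real_of_int \<lfloor>4^n * \<phi> s\<rfloor> / 4^n" for n s
  define B where "B n i = {s. \<lfloor>4^n * \<phi> s\<rfloor> = i}" for n i
  define J where "J n = {- \<lceil>4^n * R\<rceil> - 1 .. \<lceil>4^n * R\<rceil>}" for n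
  define u where "u n = (\<lambda>x. \<Sum>i\<in>J n. (real_of_int i / 4^n) * E (B n i) f x)" for n
  have [measurable]: "\<Phi> n \<in> borel_measurable borel" for n unfolding \<Phi>_def by measurable
  have B [measurable]: "B n i \<in> sets borel" for n i unfolding B_def by measurable
  have J: "\<lfloor>4^n * \<phi> s\<rfloor> \<in> J n" for n s
  proof -
    have "\<bar>4^n * \<phi> s\<bar> = 4^n * \<bar>\<phi> s\<bar>" by (simp add: abs_mult)
    also have "\<dots> \<le> 4^n * R" using b[of s] by (intro mult_left_mono) auto
    finally have "\<bar>4^n * \<phi> s\<bar> \<le> 4^n * R" .
    then have "4^n * \<phi> s \<le> 4^n * R" "- (4^n * R) \<le> 4^n * \<phi> s" by linarith+
    then show ?thesis unfolding J_def by (auto; linarith)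
  qed
  have \<Phi>_sum: "\<Phi> n = (\<lambda>s. \<Sum>i\<in>J n. (real_of_int i / 4^n) * indicator (B n i) s)" for n
  proof
    fix s
    have "(\<Sum>i\<in>J n. (real_of_int i / 4^n) * indicator (B n i) s)
       = (\<Sum>i\<in>J n. if i = \<lfloor>4^n * \<phi> s\<rfloor> then \<Phi> n s else 0)"
      by (intro sum.cong) (auto simp: B_def \<Phi>_def)
    also have "\<dots> = \<Phi> n s" using J[of n s] by (simp add: J_def)
    finally show "\<Phi> n s = (\<Sum>i\<in>J n. (real_of_int i / 4^n) * indicator (B n i) s)" ..
  qed
  have u [simp]: "u n \<in> L2 M" for n unfolding u_def by (intro L2_sum L2_scale E_L2 B f)
  have ip_u: "ip (u n) h = I (\<Phi> n) f h" if "h \<in> L2 M" for n h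
    unfolding u_def \<Phi>_sum by (rule spectral_form_simple[symmetric]) (auto simp: that J_def)
  have \<Phi>: "\<bar>\<Phi> n s - \<phi> s\<bar> \<le> (1/4)^n" for n s
  proof -
    have "\<Phi> n s - \<phi> s = (real_of_int \<lfloor>4^n * \<phi> s\<rfloor> - 4^n * \<phi> s) / 4^n"
      by (simp add: \<Phi>_def field_simps)
    moreover have "\<bar>real_of_int \<lfloor>4^n * \<phi> s\<rfloor> - 4^n * \<phi> s\<bar> \<le> 1" by linarith
    ultimately show ?thesis by (simp add: abs_divide power_one_over divide_right_mono)
  qed
  have \<Phi>_Suc: "\<bar>\<Phi> (Suc n) s - \<Phi> n s\<bar> \<le> (1/4)^n" for n s
  proof -
    have "\<Phi> (Suc n) s - \<Phi> n s = (real_of_int \<lfloor>4 * (4^n * \<phi> s)\<rfloor> / 4 - real_of_int \<lfloor>4^n * \<phi> s\<rfloor>) / 4^n"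
      by (simp add: \<Phi>_def field_simps)
    moreover have "\<bar>real_of_int \<lfloor>4 * y\<rfloor> / 4 - real_of_int \<lfloor>y\<rfloor>\<bar> \<le> 1" for y :: real by linarith
    ultimately show ?thesis by (simp add: abs_divide power_one_over divide_right_mono)
  qed
  have \<Phi>_bd: "\<bar>\<Phi> n s\<bar> \<le> R + 1" for n s
  proof -
    have "(1/4::real)^n \<le> 1" by (rule power_le_one) auto
    then show ?thesis using \<Phi>[of n s] b[of s] by linarith
  qed
  have int [simp]: "integrable (\<mu> g) (\<Phi> n)" "integrable (\<mu> g) \<phi>" if "g \<in> L2 M" for g n
    using that by (auto intro: integrable_mu_bounded[OF _ _ \<Phi>_bd] integrable_mu_bounded[OF _ _ b])
  have c: "l2_norm M (\<lambda>x. u (Suc n) x - u n x) \<le> l2_norm M f * (1/2)^n" for n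
  proof -
    define d where "d = (\<lambda>x. u (Suc n) x - u n x)"
    have [simp]: "d \<in> L2 M" unfolding d_def by (intro L2_diff u)
    \<comment> \<open>The increment is paired with itself. The bound then contains
      \<open>ip d d\<close> on the right with a factor at most 1/2, which the left side
      absorbs.\<close>
    have "ip d d = I (\<lambda>s. \<Phi> (Suc n) s - \<Phi> n s) f d"
      by (subst spectral_form_diff) (simp_all add: d_def l2_inner_diff_left L2_diff flip: ip_u)
    also have "\<dots> \<le> (1/4)^n * (ip f f + ip d d) / 2"
      using spectral_form_bound[of f d "\<lambda>s. \<Phi> (Suc n) s - \<Phi> n s", OF _ _ _ \<Phi>_Suc] by simp
    finally have 1: "2 * ip d d \<le> (1/4)^n * ip f f + (1/4)^n * ip d d" by (simp add: field_simps)
    have "(1/4)^n * ip d d \<le> 1 * ip d d" by (intro mult_right_mono power_le_one l2_inner_nonneg) auto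
    with 1 have "ip d d \<le> (1/4)^n * ip f f" by simp
    then have "sqrt (ip d d) \<le> sqrt ((1/4)^n * ip f f)" by (rule real_sqrt_le_mono)
    then show ?thesis by (simp add: l2_norm_def real_sqrt_mult real_sqrt_power d_def mult.commute real_sqrt_divide)
  qed
  from L2_fast_Cauchy_limit[of u, OF u c] obtain g where g: "g \<in> L2 M"
    and lim: "\<And>n. l2_norm M (\<lambda>x. u n x - g x) \<le> 2 * l2_norm M f * (1/2)^n" by blast
  have "ip g h = I \<phi> f h" if h [simp]: "h \<in> L2 M" for h
  proof (rule LIMSEQ_unique)
    have z: "(\<lambda>n. (1/4::real)^n) \<longlonglongrightarrow> 0" "(\<lambda>n. (1/2::real)^n) \<longlonglongrightarrow> 0"
      by (rule LIMSEQ_power_zero; simp)+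
    show "(\<lambda>n. ip (u n) h) \<longlonglongrightarrow> I \<phi> f h"
    proof (rule LIM_zero_cancel, rule Lim_null_comparison)
      show "\<forall>\<^sub>F n in sequentially. norm (ip (u n) h - I \<phi> f h) \<le> (1/4)^n * (ip f f + ip h h) / 2"
      proof (intro always_eventually allI)
        fix n
        have "ip (u n) h - I \<phi> f h = I (\<lambda>s. \<Phi> n s - \<phi> s) f h"
          by (subst spectral_form_diff) (auto simp: ip_u)
        then show "norm (ip (u n) h - I \<phi> f h) \<le> (1/4)^n * (ip f f + ip h h) / 2"
          using spectral_form_bound[of f h "\<lambda>s. \<Phi> n s - \<phi> s", OF _ _ _ \<Phi>] by simp
      qed
      show "(\<lambda>n. (1/4)^n * (ip f f + ip h h) / 2) \<longlonglongrightarrow> 0"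
        using tendsto_mult_left_zero[OF z(1), of "(ip f f + ip h h) / 2"] by simp
    qed
    show "(\<lambda>n. ip (u n) h) \<longlonglongrightarrow> ip g h"
    proof (rule LIM_zero_cancel, rule Lim_null_comparison)
      show "\<forall>\<^sub>F n in sequentially. norm (ip (u n) h - ip g h) \<le> (1/2)^n * (2 * l2_norm M f * l2_norm M h)"
      proof (intro always_eventually allI)
        fix n
        have "norm (ip (u n) h - ip g h) = \<bar>ip (\<lambda>x. u n x - g x) h\<bar>"
          by (simp add: l2_inner_diff_left g)
        also have "\<dots> \<le> l2_norm M (\<lambda>x. u n x - g x) * l2_norm M h"
          by (intro l2_cauchy_schwarz L2_diff u g h)
        also have "\<dots> \<le> 2 * l2_norm M f * (1/2)^n * l2_norm M h"
          by (intro mult_right_mono lim l2_norm_nonneg)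
        finally show "norm (ip (u n) h - ip g h) \<le> (1/2)^n * (2 * l2_norm M f * l2_norm M h)"
          by (simp add: ac_simps)
      qed
      show "(\<lambda>n. (1/2)^n * (2 * l2_norm M f * l2_norm M h)) \<longlonglongrightarrow> 0"
        using tendsto_mult_left_zero[OF z(2)] by simp
    qed
  qed
  with g show ?thesis by blast
qed

end

section \<open>The form as a spectral energy\<close>

lemma form_dom_L2: "f \<in> form_dom M q \<Longrightarrow> f \<in> L2 M"
  by (simp add: form_dom_def)

context
  fixes M :: "'a measure" and q :: "('a \<Rightarrow> real) \<Rightarrow> ennreal"
  assumes qf: "quadratic_form M q"
begin

lemma form_cong_AE:
  "f \<in> L2 M \<Longrightarrow> g \<in> L2 M \<Longrightarrow> AE x in M. f x = g x \<Longrightarrow> q f = q g"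
  using qf unfolding quadratic_form_def by blast

lemma form_scale: "f \<in> L2 M \<Longrightarrow> q (\<lambda>x. c * f x) = ennreal (c\<^sup>2) * q f"
  using qf unfolding quadratic_form_def by blast

lemma form_parallelogram:
  "f \<in> L2 M \<Longrightarrow> g \<in> L2 M \<Longrightarrow>
    q (\<lambda>x. f x + g x) + q (\<lambda>x. f x - g x) = 2 * q f + 2 * q g"
  using qf unfolding quadratic_form_def by blast

lemma form_diff_commute:
  "f \<in> L2 M \<Longrightarrow> g \<in> L2 M \<Longrightarrow> q (\<lambda>x. f x - g x) = q (\<lambda>x. g x - f x)"
  using form_scale[of "\<lambda>x. g x - f x" "-1"] by (simp add: L2_diff)

lemma form_dist_commute:
  "f \<in> L2 M \<Longrightarrow> g \<in> L2 M \<Longrightarrow> form_dist M q f g = form_dist M q g f"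
  by (simp add: form_dist_def form_diff_commute[of f g] l2_norm_def l2_inner_def algebra_simps)

lemma form_dom_add_diff:
  assumes "f \<in> form_dom M q" "g \<in> form_dom M q"
  shows "(\<lambda>x. f x + g x) \<in> form_dom M q" "(\<lambda>x. f x - g x) \<in> form_dom M q"
proof -
  have "q (\<lambda>x. f x + g x) + q (\<lambda>x. f x - g x) < \<infinity>"
    using assms by (subst form_parallelogram) (auto simp: form_dom_def ennreal_mult_less_top)
  then show "(\<lambda>x. f x + g x) \<in> form_dom M q" "(\<lambda>x. f x - g x) \<in> form_dom M q"
    using assms by (auto simp: form_dom_def intro: L2_add L2_diff)
qed

lemma form_bilinear_self:
  assumes "f \<in> L2 M"
  shows "form_bilinear M q f f = enn2real (q f)"
  using form_scale[OF assms, of 2] form_scale[OF assms, of 0]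
  by (simp add: form_bilinear_def enn2real_mult)

text \<open>Vanishing of the bilinear form says exactly that \<open>q\<close> agrees on sum and
  difference, so the parallelogram identity counts the same value twice.\<close>

lemma form_pythagoras:
  assumes "f \<in> form_dom M q" "g \<in> form_dom M q" "form_bilinear M q f g = 0"
  shows "q (\<lambda>x. f x + g x) = q f + q g"
proof -
  from form_dom_add_diff[OF assms(1,2)] assms(3)
  have "q (\<lambda>x. f x - g x) = q (\<lambda>x. f x + g x)"
    by (auto simp: form_bilinear_def form_dom_def) (metis ennreal_enn2real)
  with form_parallelogram[of f g] assms(1,2)
  have *: "2 * q (\<lambda>x. f x + g x) = 2 * (q f + q g)"
    by (simp add: form_dom_L2 mult_2 algebra_simps)
  then show ?thesis unfolding ennreal_mult_cancel_left by simp
qed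

end

locale form_spectral = spectral M E for M :: "'a measure" and E +
  fixes q :: "('a \<Rightarrow> real) \<Rightarrow> ennreal" and T :: "real \<Rightarrow> ('a \<Rightarrow> real) \<Rightarrow> 'a \<Rightarrow> real"
  assumes qf: "quadratic_form M q" and closed: "closed_form M q"
    and op: "\<And>f g. form_operator M q f g \<longleftrightarrow> spectral_integral M E (\<lambda>s. s) f g"
    and T: "\<And>t f. 0 < t \<Longrightarrow> f \<in> L2 M \<Longrightarrow> spectral_integral M E (\<lambda>s. exp (- t * s)) f (T t f)"
begin

section \<open>Spectral cutoffs and the energy\<close>

lemma mu_E:
  assumes "f \<in> L2 M" "B \<in> sets borel"
  shows "\<mu> (E B f) = density (\<mu> f) (indicator B)"
proof (rule measure_eqI)
  fix C assume "C \<in> sets (\<mu> (E B f))"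
  then have C: "C \<in> sets borel" by simp
  have "ip (E C (E B f)) (E B f) = ip (E (C \<inter> B) f) (E B f)"
    using assms C by (simp add: E_Int)
  also have "\<dots> = ip (E B (E (C \<inter> B) f)) f"
    using assms C E_sym[of B "E (C \<inter> B) f" f] by simp
  also have "\<dots> = ip (E (B \<inter> C) f) f"
    using assms C by (simp add: E_Int inf.left_commute Int_commute)
  finally show "emeasure (\<mu> (E B f)) C = emeasure (density (\<mu> f) (indicator B)) C"
    using assms C by (simp add: emeasure_mu emeasure_density Int_commute flip: indicator_inter_arith)
qed simp

lemma integrable_mu_E:
  fixes \<phi> :: "real \<Rightarrow> real"
  assumes "f \<in> L2 M" "B \<in> sets borel" "\<phi> \<in> borel_measurable borel"
    and "integrable (\<mu> f) (\<lambda>s. indicator B s * \<phi> s)"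
  shows "integrable (\<mu> (E B f)) \<phi>"
proof -
  have "density (\<mu> f) (indicator B) = density (\<mu> f) (\<lambda>s. ennreal (indicator B s))"
    by (simp add: ennreal_indicator)
  then show ?thesis unfolding mu_E[OF assms(1,2)] using assms
    by (simp add: integrable_density)
qed

lemma spectral_form_E_left:
  assumes [simp]: "f \<in> L2 M" "h \<in> L2 M" "B \<in> sets borel"
    and int: "integrable (\<mu> (E B f)) \<phi>" "integrable (\<mu> h) \<phi>"
    "integrable (\<mu> f) (\<lambda>s. \<phi> s * indicator B s)"
  shows "I \<phi> (E B f) h = I (\<lambda>s. \<phi> s * indicator B s) f h"
proof (rule spectral_form_density)
  show "integrable (\<mu> f) (indicat_real B)" "integrable (\<mu> h) (indicat_real B)"
    by (rule integrable_mu_bounded[where R = 1], simp, rule borel_measurable_indicator, simp, simp add: indicator_def)+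
  show "integrable (\<mu> h) (\<lambda>s. \<phi> s * indicat_real B s)"
    using integrable_real_mult_indicator[OF _ int(2), of B] by (simp add: mult.commute)
  show "ip (E C (E B f)) h = I (\<lambda>s. indicator C s * indicator B s) f h" if "C \<in> sets borel" for C
  proof -
    have "(\<lambda>s. indicator C s * indicator B s :: real) = indicator (C \<inter> B)"
      by (auto simp: indicator_def)
    then show ?thesis using that by (simp add: E_Int spectral_form_indicator sets.Int)
  qed
qed (use int borel_measurable_indicator[of B borel] in auto)

text \<open>The bridge from \<open>E\<close> to \<open>q\<close>: on a bounded spectral window
  \<open>s\<close> is a bounded function, so the candidate \<open>g\<close> for
  \<open>L (E B f)\<close> comes from the bounded calculus, and \<open>op\<close> read from right to
  left makes it the value of the form operator. The two pairings agree, which later gives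
  orthogonality.\<close>

lemma form_operator_cutoff:
  assumes f [simp]: "f \<in> L2 M" and B [measurable, simp]: "B \<in> sets borel" and R: "B \<subseteq> {-R..R}"
  obtains g where "g \<in> L2 M" "form_operator M q (E B f) g"
    "ip g (E B f) = (\<integral>s. indicator B s * s \<partial>\<mu> f)" "ip g f = (\<integral>s. indicator B s * s \<partial>\<mu> f)"
proof -
  have bd: "\<bar>indicator B s * s\<bar> \<le> \<bar>R\<bar>" "\<bar>indicator B s * s\<^sup>2\<bar> \<le> R\<^sup>2" for s :: real
  proof -
    have "\<bar>s\<bar> \<le> \<bar>R\<bar>" if "s \<in> B"
    proof -
      have "- R \<le> s" "s \<le> R" using R that by auto
      then show ?thesis by linarith
    qed
    then show "\<bar>indicator B s * s\<bar> \<le> \<bar>R\<bar>" "\<bar>indicator B s * s\<^sup>2\<bar> \<le> R\<^sup>2"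
      by (auto simp: indicator_def abs_le_square_iff)
  qed
  have int: "integrable (\<mu> h) (\<lambda>s. indicator B s * s)" "integrable (\<mu> h) (\<lambda>s. indicator B s * s\<^sup>2)"
    if "h \<in> L2 M" for h
    using that by (auto intro: integrable_mu_bounded[OF _ _ bd(1)] integrable_mu_bounded[OF _ _ bd(2)])
  obtain g where g: "g \<in> L2 M" and ip_g: "\<And>h. h \<in> L2 M \<Longrightarrow> ip g h = I (\<lambda>s. indicator B s * s) f h"
    using bounded_functional_calculus[OF f, of "\<lambda>s. indicator B s * s", OF _ bd(1)] by auto
  have "spectral_integral M E (\<lambda>s. s) (E B f) g"
    unfolding spectral_integral_def spectral_form_def[symmetric]
  proof (intro conjI ballI impI)
    show "integrable (\<mu> (E B f)) (\<lambda>s. s\<^sup>2)"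
      by (rule integrable_mu_E) (auto simp: int)
    fix h assume h [simp]: "h \<in> L2 M" and sq: "integrable (\<mu> h) (\<lambda>s. s\<^sup>2)"
    \<comment> \<open>Finite second moment and finite total mass give a finite first moment, through
      \<open>\<bar>s\<bar> \<le> 1 + s\<^sup>2\<close>.\<close>
    have "integrable (\<mu> h) (\<lambda>s. s)"
    proof (rule Bochner_Integration.integrable_bound)
      show "integrable (\<mu> h) (\<lambda>s. 1 + s\<^sup>2)"
        by (rule Bochner_Integration.integrable_add[OF integrable_mu_bounded[OF h, where R = 1] sq]) auto
      have "\<bar>s\<bar> \<le> 1 + s\<^sup>2" for s :: real
      proof -
        have "0 \<le> (\<bar>s\<bar> - 1)\<^sup>2" "0 \<le> s\<^sup>2" by simp_all
        then show ?thesis unfolding power2_diff power2_abs by simp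
      qed
      then show "AE s in \<mu> h. norm s \<le> norm (1 + s\<^sup>2)" by simp
    qed (auto simp: measurable_cong_sets[OF sets_mu refl])
    note id_h = this
    have c: "(\<lambda>s. s * indicator B s) = (\<lambda>s::real. indicator B s * s)" by (auto simp: indicator_def)
    have "integrable (\<mu> (E B f)) (\<lambda>s. s)"
      by (rule integrable_mu_E[OF f B _ int(1)[OF f]]) simp
    then have "I (\<lambda>s. s) (E B f) h = I (\<lambda>s. s * indicator B s) f h"
      by (rule spectral_form_E_left[OF f h B _ id_h]) (unfold c, rule int(1)[OF f])
    then show "ip g h = I (\<lambda>s. s) (E B f) h" unfolding c using ip_g[OF h] by simp
  qed (use g in auto)
  then have "form_operator M q (E B f) g" by (simp add: op)
  moreover have "ip g f = (\<integral>s. indicator B s * s \<partial>\<mu> f)"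
    by (simp add: ip_g spectral_form_diag int)
  moreover have "ip g (E B f) = (\<integral>s. indicator B s * s \<partial>\<mu> f)"
  proof -
    have *: "indicat_real B s * s * indicat_real B s = indicator B s * s" for s by (simp add: indicator_def)
    have "ip g (E B f) = I (\<lambda>s. indicator B s * s) (E B f) f"
      by (subst spectral_form_commute) (simp_all add: ip_g)
    also have "\<dots> = I (\<lambda>s. indicator B s * s * indicator B s) f f"
      by (rule spectral_form_E_left) (auto simp: int *)
    also have "\<dots> = (\<integral>s. indicator B s * s \<partial>\<mu> f)"
      by (simp add: spectral_form_diag int *)
    finally show ?thesis .
  qed
  ultimately show ?thesis using that g by blast
qed

text \<open>The third clause holds because \<open>L (E B f)\<close> pairs equally with
  \<open>f\<close> and with \<open>E B f\<close>; hence \<open>E B f\<close> and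
  \<open>f - E B f\<close> are orthogonal for the form.\<close>

lemma form_cutoff:
  assumes f: "f \<in> L2 M" and B: "B \<in> sets borel" and R: "B \<subseteq> {-R..R}"
  shows "E B f \<in> form_dom M q" "enn2real (q (E B f)) = (\<integral>s. indicator B s * s \<partial>\<mu> f)"
    "f \<in> form_dom M q \<Longrightarrow> q f = q (E B f) + q (\<lambda>x. f x - E B f x)"
proof -
  obtain g where g: "g \<in> L2 M" "form_operator M q (E B f) g"
    "ip g (E B f) = (\<integral>s. indicator B s * s \<partial>\<mu> f)" "ip g f = (\<integral>s. indicator B s * s \<partial>\<mu> f)"
    using form_operator_cutoff[OF assms] .
  show dom: "E B f \<in> form_dom M q" using g(2) by (simp add: form_operator_def)
  have g': "form_bilinear M q (E B f) h = ip g h" if "h \<in> form_dom M q" for h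
    using g(2) that by (simp add: form_operator_def)
  show "enn2real (q (E B f)) = (\<integral>s. indicator B s * s \<partial>\<mu> f)"
    using form_bilinear_self[OF qf, of "E B f"] g'[OF dom] g(3) f B by simp
  assume fd: "f \<in> form_dom M q"
  have d: "(\<lambda>x. f x - E B f x) \<in> form_dom M q" by (rule form_dom_add_diff[OF qf fd dom])
  have "q (\<lambda>x. E B f x + (f x - E B f x)) = q (E B f) + q (\<lambda>x. f x - E B f x)"
    by (rule form_pythagoras[OF qf dom d]) (use g f B in \<open>simp add: g'[OF d] l2_inner_diff_right\<close>)
  then show "q f = q (E B f) + q (\<lambda>x. f x - E B f x)" by simp
qed

text \<open>The energy of \<open>E B f\<close> for \<open>B = {-n..<0}\<close> is the integral of a
  nonpositive function, yet \<open>q\<close> is nonnegative. So the integral is zero and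
  \<open>B\<close> carries no mass.\<close>

lemma spectrum_nonneg:
  assumes f: "f \<in> L2 M"
  shows "AE s in \<mu> f. 0 \<le> s"
proof -
  have "AE s in \<mu> f. \<not> s \<in> {- real n..<0}" for n
  proof -
    let ?B = "{- real n..<0}"
    have int: "integrable (\<mu> f) (\<lambda>s. - (indicator ?B s * s))"
      by (rule integrable_mu_bounded[OF f, where R = "real n"]) (auto simp: indicator_def)
    have "0 \<le> (\<integral>s. indicator ?B s * s \<partial>\<mu> f)"
      by (subst form_cutoff(2)[OF f, of ?B "real n", symmetric]) auto
    moreover have "0 \<le> (\<integral>s. - (indicator ?B s * s) \<partial>\<mu> f)"
      by (rule integral_nonneg_AE) (auto simp: indicator_def)
    ultimately have "(\<integral>s. - (indicator ?B s * s) \<partial>\<mu> f) = 0" by simp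
    then have "AE s in \<mu> f. - (indicator ?B s * s) = 0"
      by (subst (asm) integral_nonneg_eq_0_iff_AE[OF int]) (auto simp: indicator_def)
    then show ?thesis by eventually_elim (auto simp: indicator_def)
  qed
  then have "AE s in \<mu> f. \<forall>n::nat. \<not> s \<in> {- real n..<0}" unfolding AE_all_countable by blast
  then show ?thesis
  proof eventually_elim
    case (elim s)
    obtain n where "- s \<le> real n" using real_arch_simple by blast
    then have "- real n \<le> s" by simp
    then show ?case using elim by (metis atLeastLessThan_iff not_less)
  qed
qed

lemma norm_diff_E:
  assumes "f \<in> L2 M" "B \<in> sets borel"
  shows "ip (\<lambda>x. f x - E B f x) (\<lambda>x. f x - E B f x) = measure (\<mu> f) (- B)"
proof -
  interpret finite_measure "\<mu> f" using assms(1) by (rule finite_measure_mu)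
  have "ip (\<lambda>x. f x - E B f x) (\<lambda>x. f x - E B f x) = ip f f - ip (E B f) f"
    using assms by (simp add: l2_inner_diff_left l2_inner_diff_right L2_diff E_inner_self[symmetric] l2_inner_commute[of M f "E B f"])
  also have "\<dots> = measure (\<mu> f) (- B)"
    using assms finite_measure_compl[of B] by (simp add: measure_mu E_UNIV Compl_eq_Diff_UNIV)
  finally show ?thesis .
qed

text \<open>A spectral measure is required to be additive only in its scalar measures; polarisation
  turns this into additivity of the projections.\<close>

lemma E_Diff_AE:
  assumes "f \<in> L2 M" "A \<in> sets borel" "B \<in> sets borel" "A \<subseteq> B"
  shows "AE x in M. E B f x - E A f x = E (B - A) f x"
proof (rule L2_eq_AE_I)
  fix h assume h: "h \<in> L2 M"
  have m: "measure (\<mu> g) (B - A) = measure (\<mu> g) B - measure (\<mu> g) A" if "g \<in> L2 M" for g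
    using finite_measure.finite_measure_Diff[OF finite_measure_mu[OF that], of B A] assms by simp
  have "4 * ip (E C f) h = measure (\<mu> (\<lambda>x. f x + h x)) C - measure (\<mu> (\<lambda>x. f x - h x)) C"
    if "C \<in> sets borel" for C
    using assms h that by (simp add: measure_mu_add)
  from this[of A] this[of B] this[of "B - A"]
  show "ip (\<lambda>x. E B f x - E A f x) h = ip (E (B - A) f) h"
    using assms h m[OF L2_add, of f h] m[OF L2_diff, of f h] by (simp add: l2_inner_diff_left)
qed (use assms in \<open>auto intro: L2_diff\<close>)

abbreviation "cutoff n f \<equiv> E {0..<real n} f"

lemma form_cutoff_nn:
  assumes f: "f \<in> L2 M" and "0 \<le> a"
  shows "q (E {a..<b} f) = (\<integral>\<^sup>+s. ennreal s * indicator {a..<b} s \<partial>\<mu> f)"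
proof -
  have sub: "{a..<b} \<subseteq> {-\<bar>b\<bar>..\<bar>b\<bar>}" using assms by auto
  have Q: "q (E {a..<b} f) < top" using form_cutoff(1)[OF f _ sub] by (simp add: form_dom_def)
  have "q (E {a..<b} f) = ennreal (\<integral>s. indicator {a..<b} s * s \<partial>\<mu> f)"
    unfolding form_cutoff(2)[OF f atLeastLessThan_borel sub, symmetric] using Q by simp
  also have "\<dots> = (\<integral>\<^sup>+s. ennreal (indicator {a..<b} s * s) \<partial>\<mu> f)"
    by (rule nn_integral_eq_integral[symmetric])
      (use assms in \<open>auto intro!: integrable_mu_bounded[OF f, where R = "\<bar>b\<bar>"] simp: indicator_def\<close>)
  also have "\<dots> = (\<integral>\<^sup>+s. ennreal s * indicator {a..<b} s \<partial>\<mu> f)"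
    by (intro nn_integral_cong) (auto simp: indicator_def)
  finally show ?thesis .
qed

text \<open>Monotone convergence. Since \<open>ennreal s\<close> is 0 for negative \<open>s\<close>,
  windows starting at 0 exhaust the integrand.\<close>

lemma energy_SUP_cutoff:
  assumes f: "f \<in> L2 M"
  shows "(\<integral>\<^sup>+s. ennreal s \<partial>\<mu> f) = (SUP n. q (cutoff n f))"
proof -
  have "(\<integral>\<^sup>+s. ennreal s \<partial>\<mu> f) = (\<integral>\<^sup>+s. (SUP n. ennreal s * indicator {0..<real n} s) \<partial>\<mu> f)"
  proof (intro nn_integral_cong)
    fix s :: real
    show "ennreal s = (SUP n. ennreal s * indicator {0..<real n} s)"
    proof (rule antisym)
      show "ennreal s \<le> (SUP n. ennreal s * indicator {0..<real n} s)"
      proof (cases "s \<ge> 0")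
        case True
        obtain n where "s < real n" using reals_Archimedean2 by blast
        with True show ?thesis by (intro SUP_upper2[of n]) auto
      qed (simp add: ennreal_neg)
    qed (auto intro!: SUP_least simp: indicator_def)
  qed
  also have "\<dots> = (SUP n. \<integral>\<^sup>+s. ennreal s * indicator {0..<real n} s \<partial>\<mu> f)"
    by (rule nn_integral_monotone_convergence_SUP)
      (auto simp: incseq_def le_fun_def indicator_def measurable_cong_sets[OF sets_mu refl])
  finally show ?thesis using f by (simp add: form_cutoff_nn)
qed

text \<open>The orthogonal splitting of \<open>form_cutoff\<close> shows that no cutoff has more
  energy than \<open>f\<close>.\<close>

lemma energy_le_form:
  assumes f: "f \<in> L2 M"
  shows "(\<integral>\<^sup>+s. ennreal s \<partial>\<mu> f) \<le> q f"
proof (cases "f \<in> form_dom M q")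
  case True
  show ?thesis unfolding energy_SUP_cutoff[OF f]
  proof (rule SUP_least)
    fix n :: nat
    show "q (cutoff n f) \<le> q f"
      by (subst form_cutoff(3)[OF f _ _ True, of "{0..<real n}" "real n"]) auto
  qed
next
  case False
  then have "q f = top" using f by (simp add: form_dom_def not_less top_unique)
  then show ?thesis by simp
qed

text \<open>Finite energy makes the cutoffs form-Cauchy, so closedness puts \<open>f\<close> into the domain.\<close>

lemma form_le_energy:
  assumes f: "f \<in> L2 M"
  shows "q f \<le> (\<integral>\<^sup>+s. ennreal s \<partial>\<mu> f)"
proof (cases "(\<integral>\<^sup>+s. ennreal s \<partial>\<mu> f) = \<infinity>")
  case False
  interpret finite_measure "\<mu> f" using f by (rule finite_measure_mu)
  \<comment> \<open>The tail of the energy. It controls both parts of the form distance between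
    cutoffs.\<close>
  define r where "r n = (\<integral>\<^sup>+s. ennreal s * indicator {real n..} s \<partial>\<mu> f)" for n
  have r_le: "r n \<le> (\<integral>\<^sup>+s. ennreal s \<partial>\<mu> f)" for n
    unfolding r_def by (intro nn_integral_mono) (auto simp: indicator_def)
  have r_fin: "r n < top" for n using r_le[of n] False by (auto simp: less_top top_unique)
  have r0: "r \<longlonglongrightarrow> 0"
  proof -
    have "(\<lambda>n. \<integral>\<^sup>+s. ennreal s * indicator {real n..} s \<partial>\<mu> f) \<longlonglongrightarrow> (\<integral>\<^sup>+s. 0 \<partial>\<mu> f)"
    proof (rule nn_integral_dominated_convergence[where w = ennreal])
      show "AE s in \<mu> f. (\<lambda>n. ennreal s * indicator {real n..} s) \<longlonglongrightarrow> 0"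
      proof (rule AE_I2, rule tendsto_eventually)
        fix s :: real
        obtain N where N: "s < real N" using reals_Archimedean2 by blast
        show "\<forall>\<^sub>F n in sequentially. ennreal s * indicator {real n..} s = 0"
          using eventually_ge_at_top[of N] by eventually_elim (use N in \<open>auto simp: indicator_def\<close>)
      qed
    qed (use False in \<open>auto simp: indicator_def less_top measurable_cong_sets[OF sets_mu refl]\<close>)
    then show ?thesis unfolding r_def by simp
  qed
  have c [simp]: "cutoff n f \<in> L2 M" for n using f by simp
  have cdom: "cutoff n f \<in> form_dom M q" for n
    by (rule form_cutoff(1)[OF f, of _ "real n"]) auto
  \<comment> \<open>From \<open>1 \<le> n\<close> follows \<open>1 \<le> s\<close> on the window, so
    its mass is bounded by its energy as well. The factor 2 counts the form part and the norm
    part.\<close>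
  have dist: "form_dist M q (cutoff m f) (cutoff n f) \<le> 2 * sqrt (enn2real (r n))"
    if nm: "n \<le> m" "1 \<le> n" for m n
  proof -
    have AE: "AE x in M. cutoff m f x - cutoff n f x = E {real n..<real m} f x"
    proof -
      have "{0..<real m} - {0..<real n} = {real n..<real m}" using nm by auto
      then show ?thesis using E_Diff_AE[OF f, of "{0..<real n}" "{0..<real m}"] nm by auto
    qed
    have Q: "q (\<lambda>x. cutoff m f x - cutoff n f x) = (\<integral>\<^sup>+s. ennreal s * indicator {real n..<real m} s \<partial>\<mu> f)"
      using form_cong_AE[OF qf _ _ AE] f by (simp add: L2_diff form_cutoff_nn)
    have le: "(\<integral>\<^sup>+s. ennreal s * indicator {real n..<real m} s \<partial>\<mu> f) \<le> r n"
      unfolding r_def by (intro nn_integral_mono) (auto simp: indicator_def)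
    have "ip (\<lambda>x. cutoff m f x - cutoff n f x) (\<lambda>x. cutoff m f x - cutoff n f x)
      = ip (E {real n..<real m} f) (E {real n..<real m} f)"
      using AE f by (intro l2_inner_cong_AE) (auto intro: L2_diff)
    also have "\<dots> = measure (\<mu> f) {real n..<real m}" using f by (simp add: measure_mu E_inner_self)
    finally have N: "ennreal (ip (\<lambda>x. cutoff m f x - cutoff n f x) (\<lambda>x. cutoff m f x - cutoff n f x))
       = (\<integral>\<^sup>+s. indicator {real n..<real m} s \<partial>\<mu> f)" by (simp add: emeasure_eq_measure)
    have "\<dots> \<le> (\<integral>\<^sup>+s. ennreal s * indicator {real n..<real m} s \<partial>\<mu> f)"
      using nm by (intro nn_integral_mono) (auto simp: indicator_def)
    with le N have "ennreal (ip (\<lambda>x. cutoff m f x - cutoff n f x) (\<lambda>x. cutoff m f x - cutoff n f x)) \<le> r n"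
      by simp
    then have "ip (\<lambda>x. cutoff m f x - cutoff n f x) (\<lambda>x. cutoff m f x - cutoff n f x) \<le> enn2real (r n)"
      using enn2real_mono[OF _ r_fin] by (metis enn2real_ennreal l2_inner_nonneg)
    moreover have "enn2real (q (\<lambda>x. cutoff m f x - cutoff n f x)) \<le> enn2real (r n)"
      unfolding Q by (rule enn2real_mono[OF le r_fin])
    ultimately show ?thesis unfolding form_dist_def l2_norm_def
      using real_sqrt_le_mono by (smt (verit))
  qed
  have z: "(\<lambda>n. 2 * sqrt (enn2real (r n))) \<longlonglongrightarrow> 0"
  proof -
    have "(\<lambda>n. enn2real (r n)) \<longlonglongrightarrow> 0" 
    proof (rule tendsto_enn2real)
      show "r \<longlonglongrightarrow> ennreal 0" using r0 by simp
    qed simp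
    then have "(\<lambda>n. 2 * sqrt (enn2real (r n))) \<longlonglongrightarrow> 2 * sqrt 0"
      by (intro tendsto_mult tendsto_const tendsto_real_sqrt)
    then show ?thesis by simp
  qed
  have "\<forall>e>0. \<exists>N. \<forall>m\<ge>N. \<forall>n\<ge>N. form_dist M q (cutoff m f) (cutoff n f) < e"
  proof (intro allI impI)
    fix e :: real assume "0 < e"
    from order_tendstoD(2)[OF z this] obtain N where N: "\<And>n. n \<ge> N \<Longrightarrow> 2 * sqrt (enn2real (r n)) < e"
      by (auto simp: eventually_sequentially)
    show "\<exists>N. \<forall>m\<ge>N. \<forall>n\<ge>N. form_dist M q (cutoff m f) (cutoff n f) < e"
    proof (intro exI[of _ "max 1 N"] allI impI)
      fix m n assume mn: "max 1 N \<le> m" "max 1 N \<le> n"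
      show "form_dist M q (cutoff m f) (cutoff n f) < e"
      proof (cases "n \<le> m")
        case True
        then show ?thesis using dist[of n m] N[of n] mn by auto
      next
        case False
        then show ?thesis using dist[of m n] N[of m] mn form_dist_commute[OF qf c c, of m n] by auto
      qed
    qed
  qed
  then have "\<exists>f'\<in>form_dom M q. (\<lambda>n. form_dist M q (cutoff n f) f') \<longlonglongrightarrow> 0"
    using closed[unfolded closed_form_def, rule_format, of "\<lambda>n. cutoff n f"] cdom by simp
  then obtain f' where f': "f' \<in> form_dom M q" and lim: "(\<lambda>n. form_dist M q (cutoff n f) f') \<longlonglongrightarrow> 0"
    by blast
  have [simp]: "f' \<in> L2 M" using f' by (rule form_dom_L2)
  have lim1: "(\<lambda>n. sqrt (enn2real (q (\<lambda>x. cutoff n f x - f' x)))) \<longlonglongrightarrow> 0"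
    and lim2: "(\<lambda>n. l2_norm M (\<lambda>x. cutoff n f x - f' x)) \<longlonglongrightarrow> 0"
    by (rule Lim_null_comparison[OF always_eventually lim], simp add: form_dist_def l2_norm_nonneg)+
  \<comment> \<open>The cutoffs converge to \<open>f\<close> in norm, because nonnegativity of the
    spectrum leaves no mass outside the windows. This identifies the form limit \<open>f'\<close>
    with \<open>f\<close>.\<close>
  have lim3: "(\<lambda>n. l2_norm M (\<lambda>x. f x - cutoff n f x)) \<longlonglongrightarrow> 0"
  proof -
    have "(\<lambda>n. measure (\<mu> f) (- {0..<real n})) \<longlonglongrightarrow> measure (\<mu> f) (\<Inter>n. - {0..<real n})"
      by (rule finite_Lim_measure_decseq) (auto simp: decseq_def)
    also have "measure (\<mu> f) (\<Inter>n. - {0..<real n}) = measure (\<mu> f) {}"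
    proof (rule measure_eq_AE)
      show "AE s in \<mu> f. (s \<in> (\<Inter>n. - {0..<real n})) = (s \<in> {})"
        using spectrum_nonneg[OF f]
      proof eventually_elim
        case (elim s)
        obtain n where "s < real n" using reals_Archimedean2 by blast
        then show ?case using elim by auto
      qed
    qed auto
    finally have "(\<lambda>n. sqrt (measure (\<mu> f) (- {0..<real n}))) \<longlonglongrightarrow> sqrt 0"
      by (intro tendsto_intros) simp
    then show ?thesis using f by (simp add: l2_norm_def norm_diff_E)
  qed
  have "l2_norm M (\<lambda>x. f x - f' x) \<le> 0"
  proof (rule LIMSEQ_le_const)
    show "(\<lambda>n. l2_norm M (\<lambda>x. f x - cutoff n f x) + l2_norm M (\<lambda>x. cutoff n f x - f' x)) \<longlonglongrightarrow> 0"
      using tendsto_add[OF lim3 lim2] by simp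
    have "l2_norm M (\<lambda>x. f x - f' x) \<le> l2_norm M (\<lambda>x. f x - cutoff n f x) + l2_norm M (\<lambda>x. cutoff n f x - f' x)" for n
      using l2_norm_triangle[of "\<lambda>x. f x - cutoff n f x" M "\<lambda>x. cutoff n f x - f' x"] f by (simp add: L2_diff)
    then show "\<exists>N. \<forall>n\<ge>N. l2_norm M (\<lambda>x. f x - f' x) \<le> l2_norm M (\<lambda>x. f x - cutoff n f x) + l2_norm M (\<lambda>x. cutoff n f x - f' x)"
      by blast
  qed
  then have "l2_norm M (\<lambda>x. f x - f' x) = 0" using l2_norm_nonneg by (metis antisym)
  then have "AE x in M. f x - f' x = 0"
    using f by (intro l2_inner_eq_0 L2_diff) (auto simp flip: l2_norm_power2)
  then have AE: "AE x in M. f x = f' x" by simp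
  have dom: "f \<in> form_dom M q" using form_cong_AE[OF qf f _ AE] f f' by (simp add: form_dom_def)
  \<comment> \<open>Once \<open>f\<close> is in the domain, \<open>q f\<close> splits exactly into
    the energy of the cutoff and a remainder that equals \<open>q\<close> of
    \<open>cutoff n f - f'\<close> and tends to 0.\<close>
  have bound: "enn2real (q f) \<le> enn2real (\<integral>\<^sup>+s. ennreal s \<partial>\<mu> f) + enn2real (q (\<lambda>x. cutoff n f x - f' x))" for n
  proof -
    have d: "(\<lambda>x. cutoff n f x - f' x) \<in> form_dom M q" by (rule form_dom_add_diff[OF qf cdom f'])
    have "AE x in M. cutoff n f x - f x = cutoff n f x - f' x" using AE by auto
    then have 1: "q (\<lambda>x. f x - cutoff n f x) = q (\<lambda>x. cutoff n f x - f' x)"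
      using form_diff_commute[OF qf f c] form_cong_AE[OF qf L2_diff[OF c f] L2_diff[OF c]] by auto
    have "q f = q (cutoff n f) + q (\<lambda>x. cutoff n f x - f' x)"
      unfolding 1[symmetric] by (rule form_cutoff(3)[OF f _ _ dom, of _ "real n"]) auto
    also have "\<dots> \<le> (\<integral>\<^sup>+s. ennreal s \<partial>\<mu> f) + q (\<lambda>x. cutoff n f x - f' x)"
      unfolding energy_SUP_cutoff[OF f] by (intro add_right_mono SUP_upper) simp
    finally have "enn2real (q f) \<le> enn2real ((\<integral>\<^sup>+s. ennreal s \<partial>\<mu> f) + q (\<lambda>x. cutoff n f x - f' x))"
      by (rule enn2real_mono) (use d False in \<open>auto simp: form_dom_def less_top\<close>)
    also have "\<dots> = enn2real (\<integral>\<^sup>+s. ennreal s \<partial>\<mu> f) + enn2real (q (\<lambda>x. cutoff n f x - f' x))"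
      by (rule enn2real_plus) (use d False in \<open>auto simp: form_dom_def less_top\<close>)
    finally show ?thesis .
  qed
  have "(\<lambda>n. enn2real (q (\<lambda>x. cutoff n f x - f' x))) \<longlonglongrightarrow> 0"
    using tendsto_power[OF lim1, of 2] by simp
  then have "(\<lambda>n. enn2real (\<integral>\<^sup>+s. ennreal s \<partial>\<mu> f) + enn2real (q (\<lambda>x. cutoff n f x - f' x)))
    \<longlonglongrightarrow> enn2real (\<integral>\<^sup>+s. ennreal s \<partial>\<mu> f) + 0"
    by (intro tendsto_add tendsto_const)
  from LIMSEQ_le_const[OF this] bound have "enn2real (q f) \<le> enn2real (\<integral>\<^sup>+s. ennreal s \<partial>\<mu> f)" by auto
  then have "ennreal (enn2real (q f)) \<le> ennreal (enn2real (\<integral>\<^sup>+s. ennreal s \<partial>\<mu> f))" by (rule ennreal_leI)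
  moreover have "q f < top" "(\<integral>\<^sup>+s. ennreal s \<partial>\<mu> f) < top"
    using dom False by (auto simp: form_dom_def less_top)
  ultimately show ?thesis by (simp only: ennreal_enn2real)
qed simp

lemma form_eq_energy: "f \<in> L2 M \<Longrightarrow> q f = (\<integral>\<^sup>+s. ennreal s \<partial>\<mu> f)"
  by (intro antisym form_le_energy energy_le_form)

section \<open>The semigroup and the approximating forms\<close>

lemma T_L2 [simp, intro]: "0 < t \<Longrightarrow> f \<in> L2 M \<Longrightarrow> T t f \<in> L2 M"
  using T by (auto simp: spectral_integral_def)

lemma integrable_exp:
  assumes "0 < t" "f \<in> L2 M"
  shows "integrable (\<mu> f) (\<lambda>s. exp (- t * s))"
proof -
  interpret finite_measure "\<mu> f" using assms(2) by (rule finite_measure_mu)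
  show ?thesis
    by (rule integrable_const_bound[where B = 1])
      (use spectrum_nonneg[OF assms(2)] assms(1) in \<open>auto simp: measurable_cong_sets[OF sets_mu refl]\<close>)
qed

text \<open>The pairing formula admits only test elements for which the squared exponential is
  integrable; \<open>T\<close> applied to \<open>h\<close> supplies this.\<close>

lemma ip_T:
  assumes "0 < t" "f \<in> L2 M" "h \<in> L2 M"
  shows "ip (T t f) h = I (\<lambda>s. exp (- t * s)) f h"
  using T[OF assms(1,2)] T[OF assms(1,3)] assms(3)
  by (simp add: spectral_integral_def spectral_form_def)

lemma T_sym: "0 < t \<Longrightarrow> f \<in> L2 M \<Longrightarrow> h \<in> L2 M \<Longrightarrow> ip (T t f) h = ip f (T t h)"
  using ip_T[of t f h] ip_T[of t h f] spectral_form_commute[of f h] by (simp add: l2_inner_commute)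

lemma ip_T_self: "0 < t \<Longrightarrow> f \<in> L2 M \<Longrightarrow> ip (T t f) f = (\<integral>s. exp (- t * s) \<partial>\<mu> f)"
  using ip_T spectral_form_diag integrable_exp by simp

text \<open>The signed measure \<open><E (T t f), h>\<close> has density
  \<open>exp (- t * r)\<close> with respect to \<open><E f, h>\<close>. Integrating
  \<open>exp (- s * r)\<close> against it multiplies the exponentials.\<close>

lemma T_semigroup:
  assumes t: "0 < s" "0 < t" and f: "f \<in> L2 M"
  shows "AE x in M. T s (T t f) x = T (s + t) f x"
proof (rule L2_eq_AE_I)
  fix h assume h: "h \<in> L2 M"
  have ee: "exp (- s * r) * exp (- t * r) = exp (- (s + t) * r)" for r :: real
    by (simp add: algebra_simps flip: exp_add)
  have ind: "integrable (\<mu> g) (\<lambda>r. exp (- t * r) * indicator C r)" if "C \<in> sets borel" "g \<in> L2 M" for C g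
    using integrable_real_mult_indicator[OF _ integrable_exp[OF t(2) that(2)], of C] that by simp
  have "ip (T s (T t f)) h = I (\<lambda>r. exp (- s * r)) (T t f) h"
    using t f h by (simp add: ip_T)
  also have "\<dots> = I (\<lambda>r. exp (- s * r) * exp (- t * r)) f h"
  proof (rule spectral_form_density)
    fix C :: "real set" assume C: "C \<in> sets borel"
    \<comment> \<open>The projection is moved to \<open>h\<close>, so that the pairing formula for
      \<open>T t f\<close> applies and the cutoff can be read off from
      \<open>spectral_form_E_left\<close>.\<close>
    have "ip (E C (T t f)) h = ip (T t f) (E C h)" using C t f h by (simp add: E_sym)
    also have "\<dots> = I (\<lambda>r. exp (- t * r)) (E C h) f"
      using C t f h by (subst ip_T) (auto intro: spectral_form_commute)
    also have "\<dots> = I (\<lambda>r. exp (- t * r) * indicator C r) h f"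
      using C t f h ind by (intro spectral_form_E_left integrable_exp) auto
    also have "\<dots> = I (\<lambda>r. indicator C r * exp (- t * r)) f h"
      using f h by (subst spectral_form_commute) (simp_all add: mult.commute)
    finally show "ip (E C (T t f)) h = I (\<lambda>r. indicator C r * exp (- t * r)) f h" .
  qed (use t f h in \<open>simp_all only: ee integrable_exp add_pos_pos T_L2\<close>, auto)
  also have "\<dots> = ip (T (s + t) f) h" unfolding ee using t f h by (intro ip_T[symmetric]) auto
  finally show "ip (T s (T t f)) h = ip (T (s + t) f) h" .
qed (use assms in auto)

lemma T_contraction:
  assumes "0 < t" "f \<in> L2 M"
  shows "ip (T t f) f \<le> ip f f"
proof -
  interpret finite_measure "\<mu> f" using assms(2) by (rule finite_measure_mu)
  have "(\<integral>s. exp (- t * s) \<partial>\<mu> f) \<le> (\<integral>s. 1 \<partial>\<mu> f)"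
    by (rule integral_mono_AE[OF integrable_exp[OF assms]])
      (use spectrum_nonneg[OF assms(2)] assms(1) in auto)
  then show ?thesis using assms by (simp add: ip_T_self measure_mu_UNIV)
qed

lemma T_continuous_at_0:
  assumes f: "f \<in> L2 M"
  shows "(\<lambda>n. ip (T ((1/2)^n) f) f) \<longlonglongrightarrow> ip f f"
proof -
  interpret finite_measure "\<mu> f" using f by (rule finite_measure_mu)
  have "(\<lambda>n. \<integral>s. exp (- ((1/2)^n) * s) \<partial>\<mu> f) \<longlonglongrightarrow> (\<integral>s. 1 \<partial>\<mu> f)"
  proof (rule integral_dominated_convergence[where w = "\<lambda>_. 1"])
    show "AE s in \<mu> f. (\<lambda>n. exp (- ((1/2)^n) * s)) \<longlonglongrightarrow> 1"
    proof (rule AE_I2)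
      fix s :: real
      have "(\<lambda>n. exp (- ((1/2)^n) * s)) \<longlonglongrightarrow> exp (- 0 * s)"
        by (intro tendsto_intros LIMSEQ_power_zero) simp
      then show "(\<lambda>n. exp (- ((1/2)^n) * s)) \<longlonglongrightarrow> 1" by simp
    qed
    show "AE s in \<mu> f. norm (exp (- ((1/2)^n) * s)) \<le> 1" for n
      using spectrum_nonneg[OF f] by eventually_elim simp
  qed (auto simp: measurable_cong_sets[OF sets_mu refl])
  then show ?thesis using f by (simp add: ip_T_self measure_mu_UNIV)
qed

text \<open>The quotients \<open>(1 - exp (- t * s)) / t\<close> along \<open>t = 2^-n\<close>
  increase to \<open>s\<close>; monotone convergence applies to the energy. No domain condition on
  \<open>f\<close> remains, which is why inequalities for \<open>q\<close> are proved through this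
  formula.\<close>

lemma form_eq_SUP_T:
  assumes f: "f \<in> L2 M"
  shows "q f = (SUP n. ennreal (2^n * (ip f f - ip (T ((1/2)^n) f) f)))"
proof -
  interpret finite_measure "\<mu> f" using f by (rule finite_measure_mu)
  define F where "F n s = 2^n * (1 - exp (- ((1/2)^n) * s))" for n and s :: real
  have [measurable]: "F n \<in> borel_measurable borel" for n unfolding F_def by measurable
  have inc: "F n s \<le> F (Suc n) s" for n s
  proof -
    define e where "e = exp (- ((1/2)^Suc n) * s)"
    have "e * e = exp (- ((1/2)^n) * s)" unfolding e_def by (simp flip: exp_add)
    \<comment> \<open>Halving the time replaces \<open>1 - e\<^sup>2\<close> by
      \<open>2 * (1 - e)\<close>, and the difference is a square.\<close>
    then have "F (Suc n) s - F n s = 2^n * (1 - e)\<^sup>2"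
      unfolding F_def e_def[symmetric] by (simp add: power2_eq_square algebra_simps)
    moreover have "0 \<le> 2^n * (1 - e)\<^sup>2" by simp
    ultimately show ?thesis by linarith
  qed
  have lim: "(\<lambda>n. F n s) \<longlonglongrightarrow> s" for s
  proof (cases "s = 0")
    case False
    have "((\<lambda>y. (exp (0 + y) - exp 0) / y) \<longlongrightarrow> exp (0::real)) (at 0)"
      using DERIV_exp[of "0::real"] unfolding has_field_derivative_def by (simp add: DERIV_def has_field_derivative_def[symmetric])
    moreover have "filterlim (\<lambda>n. - ((1/2)^n) * s) (at 0) sequentially"
    proof (rule filterlim_atI)
      have "(\<lambda>n. - ((1/2)^n) * s) \<longlonglongrightarrow> - 0 * s" by (intro tendsto_intros LIMSEQ_power_zero) simp
      then show "(\<lambda>n. - ((1/2)^n) * s) \<longlonglongrightarrow> 0" by simp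
    qed (use False in auto)
    ultimately have "(\<lambda>n. (exp (- ((1/2)^n) * s) - 1) / (- ((1/2)^n) * s)) \<longlonglongrightarrow> 1"
      by (auto dest: filterlim_compose)
    then have "(\<lambda>n. s * ((exp (- ((1/2)^n) * s) - 1) / (- ((1/2)^n) * s))) \<longlonglongrightarrow> s * 1" by (intro tendsto_intros)
    moreover have "s * ((exp (- ((1/2)^n) * s) - 1) / (- ((1/2)^n) * s)) = F n s" for n
      using False by (simp add: F_def field_simps power_one_over)
    ultimately show ?thesis by simp
  qed (simp add: F_def)
  have int: "integrable (\<mu> f) (F n)" for n
    unfolding F_def by (intro integrable_mult_right Bochner_Integration.integrable_diff integrable_exp f)
      auto
  have "q f = (\<integral>\<^sup>+s. (SUP n. ennreal (F n s)) \<partial>\<mu> f)"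
    unfolding form_eq_energy[OF f]
  proof (rule nn_integral_cong)
    fix s
    have "incseq (\<lambda>n. ennreal (F n s))" by (intro incseq_SucI ennreal_leI inc)
    from LIMSEQ_SUP[OF this] show "ennreal s = (SUP n. ennreal (F n s))"
      by (rule LIMSEQ_unique[rotated]) (intro tendsto_ennrealI lim)
  qed
  also have "\<dots> = (SUP n. \<integral>\<^sup>+s. ennreal (F n s) \<partial>\<mu> f)"
    by (rule nn_integral_monotone_convergence_SUP)
      (auto intro!: incseq_SucI le_funI ennreal_leI inc simp: measurable_cong_sets[OF sets_mu refl])
  also have "\<dots> = (SUP n. ennreal (2^n * (ip f f - ip (T ((1/2)^n) f) f)))"
  proof (rule SUP_cong)
    fix n
    have "(\<integral>\<^sup>+s. ennreal (F n s) \<partial>\<mu> f) = ennreal (\<integral>s. F n s \<partial>\<mu> f)"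
      by (rule nn_integral_eq_integral[OF int])
        (use spectrum_nonneg[OF f] in \<open>auto simp: F_def\<close>)
    also have "(\<integral>s. F n s \<partial>\<mu> f) = 2^n * ((\<integral>s. 1 \<partial>\<mu> f) - (\<integral>s. exp (- ((1/2)^n) * s) \<partial>\<mu> f))"
      unfolding F_def
      by (subst integral_mult_right_zero, subst Bochner_Integration.integral_diff)
        (auto simp only: intro!: integrable_exp f integrable_const zero_less_power)
    finally show "(\<integral>\<^sup>+s. ennreal (F n s) \<partial>\<mu> f) = ennreal (2^n * (ip f f - ip (T ((1/2)^n) f) f))"
      using f by (simp add: ip_T_self measure_mu_UNIV)
  qed simp
  finally show ?thesis .
qed

end

section \<open>Kernels and invariant sets\<close>

locale kernel_form = form_spectral M E q T for M :: "'a measure" and E q T +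
  fixes k :: "real \<Rightarrow> 'a \<Rightarrow> 'a \<Rightarrow> real"
  assumes k_measurable: "\<And>t. 0 < t \<Longrightarrow> (\<lambda>(x, y). k t x y) \<in> borel_measurable (M \<Otimes>\<^sub>M M)"
    and k_nonneg: "\<And>t x y. 0 < t \<Longrightarrow> x \<in> space M \<Longrightarrow> y \<in> space M \<Longrightarrow> 0 \<le> k t x y"
    and k_T: "\<And>t f. 0 < t \<Longrightarrow> f \<in> L2 M \<Longrightarrow>
      AE x in M. integrable M (\<lambda>y. k t x y * f y) \<and> T t f x = (LINT y|M. k t x y * f y)"
    and irred: "irreducible_form M q"
begin

text \<open>Setting the kernel to \<open>0\<close> for \<open>t \<le> 0\<close> makes it measurable for every \<open>t\<close>.\<close>

definition kk :: "real \<Rightarrow> 'a \<times> 'a \<Rightarrow> ennreal" where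
  "kk t = (if 0 < t then (\<lambda>(x, y). ennreal (k t x y)) else (\<lambda>_. 0))"

text \<open>The extension of \<open>T t\<close> to all nonnegative measurable functions. Values in
  \<open>ennreal\<close> let suprema, series and Fubini pass without integrability conditions, also
  for functions outside \<open>L2 M\<close>.\<close>

definition K :: "real \<Rightarrow> ('a \<Rightarrow> ennreal) \<Rightarrow> 'a \<Rightarrow> ennreal" where
  "K t u x = (\<integral>\<^sup>+y. kk t (x, y) * u y \<partial>M)"

lemma kk_measurable [measurable]: "kk t \<in> borel_measurable (M \<Otimes>\<^sub>M M)"
  using measurable_compose[OF k_measurable measurable_ennreal, of t]
  by (auto simp: kk_def case_prod_unfold)

lemma K_measurable [measurable (raw)]:
  assumes [measurable]: "u \<in> borel_measurable M"
  shows "K t u \<in> borel_measurable M"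
  unfolding K_def by measurable

lemma K_mono_AE:
  assumes "AE y in M. u y \<le> v y"
  shows "K t u x \<le> K t v x"
  unfolding K_def
proof (rule nn_integral_mono_AE)
  from assms show "AE y in M. kk t (x, y) * u y \<le> kk t (x, y) * v y"
    by eventually_elim (rule mult_left_mono, auto)
qed

lemma K_cong_AE: "AE y in M. u y = v y \<Longrightarrow> K t u x = K t v x"
  unfolding K_def by (rule nn_integral_cong_AE) auto

lemma K_SUP:
  assumes [measurable]: "\<And>i. u i \<in> borel_measurable M" and "incseq u" "x \<in> space M"
  shows "K t (\<lambda>y. SUP i. u i y) x = (SUP i. K t (u i) x)"
proof -
  have "K t (\<lambda>y. SUP i. u i y) x = (\<integral>\<^sup>+y. (SUP i. kk t (x, y) * u i y) \<partial>M)"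
    by (simp add: K_def SUP_mult_left_ennreal)
  also have "\<dots> = (SUP i. \<integral>\<^sup>+y. kk t (x, y) * u i y \<partial>M)"
    using assms by (intro nn_integral_monotone_convergence_SUP)
      (auto simp: incseq_def le_fun_def intro!: mult_left_mono)
  finally show ?thesis by (simp add: K_def)
qed

lemma K_suminf:
  assumes [measurable]: "\<And>i. u i \<in> borel_measurable M" and "x \<in> space M"
  shows "K t (\<lambda>y. \<Sum>i. u i y) x = (\<Sum>i. K t (u i) x)"
proof -
  have "K t (\<lambda>y. \<Sum>i. u i y) x = (\<integral>\<^sup>+y. (\<Sum>i. kk t (x, y) * u i y) \<partial>M)"
    by (simp add: K_def)
  also have "\<dots> = (\<Sum>i. \<integral>\<^sup>+y. kk t (x, y) * u i y \<partial>M)"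
    using assms by (intro nn_integral_suminf) auto
  finally show ?thesis by (simp add: K_def)
qed

lemma K_cmult:
  assumes [measurable]: "u \<in> borel_measurable M" and "x \<in> space M"
  shows "K t (\<lambda>y. c * u y) x = c * K t u x"
proof -
  have "K t (\<lambda>y. c * u y) x = (\<integral>\<^sup>+y. c * (kk t (x, y) * u y) \<partial>M)"
    by (simp add: K_def ac_simps)
  also have "\<dots> = c * K t u x"
    unfolding K_def using assms by (intro nn_integral_cmult) auto
  finally show ?thesis .
qed

lemma K_eq_T:
  assumes t: "0 < t" and f: "f \<in> L2 M" and nn: "\<And>x. 0 \<le> f x"
  shows "AE x in M. K t (\<lambda>y. ennreal (f y)) x = ennreal (T t f x) \<and> 0 \<le> T t f x"
  using k_T[OF t f] AE_space
proof eventually_elim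
  case (elim x)
  have "K t (\<lambda>y. ennreal (f y)) x = (\<integral>\<^sup>+y. ennreal (k t x y * f y) \<partial>M)"
    unfolding K_def using t nn elim by (intro nn_integral_cong) (simp add: kk_def ennreal_mult'')
  also have "\<dots> = ennreal (\<integral>y. k t x y * f y \<partial>M)"
    using elim nn k_nonneg[OF t] by (intro nn_integral_eq_integral) auto
  moreover have "0 \<le> (\<integral>y. k t x y * f y \<partial>M)"
    using elim nn k_nonneg[OF t] by (intro integral_nonneg_AE) auto
  ultimately show ?case using elim by simp
qed

text \<open>For signed \<open>f\<close> the coercion \<open>ennreal\<close> cuts off the negative
  part, so the right side is the kernel applied to the positive part.\<close>

lemma T_le_K:
  assumes t: "0 < t" and f: "f \<in> L2 M"
  shows "AE x in M. ennreal (T t f x) \<le> K t (\<lambda>y. ennreal (f y)) x"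
  using k_T[OF t f] AE_space
proof eventually_elim
  case (elim x)
  have fin: "(\<integral>\<^sup>+y. ennreal (k t x y * f y) \<partial>M) < top"
    using elim by (auto simp: real_integrable_def less_top)
  have "(\<integral>y. k t x y * f y \<partial>M) \<le> enn2real (\<integral>\<^sup>+y. ennreal (k t x y * f y) \<partial>M)"
    using elim by (subst real_lebesgue_integral_def) auto
  then have "ennreal (T t f x) \<le> (\<integral>\<^sup>+y. ennreal (k t x y * f y) \<partial>M)"
    unfolding conjunct2[OF elim(1)] by (subst ennreal_enn2real[OF fin, symmetric]) (rule ennreal_leI)
  also have "\<dots> = K t (\<lambda>y. ennreal (f y)) x"
    unfolding K_def using t elim k_nonneg[OF t] by (intro nn_integral_cong) (simp add: kk_def ennreal_mult')
  finally show ?case .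
qed

text \<open>A nonnegative kernel with integral 0 over \<open>N\<close> vanishes a.e. there, so it
  annihilates signed functions supported in \<open>N\<close> too.\<close>

lemma T_eq_0:
  assumes t: "0 < t" and f: "f \<in> L2 M" and [measurable]: "N \<in> sets M" and 0: "\<And>y. y \<notin> N \<Longrightarrow> f y = 0"
  shows "AE x in M. K t (indicator N) x = 0 \<longrightarrow> T t f x = 0"
  using k_T[OF t f] AE_space
proof eventually_elim
  case (elim x)
  show ?case
  proof
    assume "K t (indicator N) x = 0"
    then have "AE y in M. kk t (x, y) * indicator N y = 0"
      using elim unfolding K_def by (subst (asm) nn_integral_0_iff_AE) auto
    then have "AE y in M. k t x y * f y = 0"
      using AE_space
    proof eventually_elim
      case y: (elim y)
      show ?case
      proof (cases "y \<in> N")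
        case True
        with y t have "k t x y \<le> 0" by (auto simp: kk_def ennreal_eq_0_iff)
        with k_nonneg[OF t, of x y] elim y show ?thesis by simp
      qed (simp add: 0)
    qed
    then show "T t f x = 0" using elim by (simp add: integral_eq_zero_AE)
  qed
qed

text \<open>Each approximating form of \<open>p + d\<close> is that of \<open>p\<close>, plus twice
  the mixed term, plus that of \<open>d\<close>. The hypothesis makes the mixed term nonnegative,
  contractivity the last one. Invariance of sets and the final inequality for minima are both
  obtained from this.\<close>

lemma form_le_add:
  assumes p: "p \<in> L2 M" and d: "d \<in> L2 M"
    and le: "\<And>n. ip (T ((1/2)^n) p) d \<le> ip p d"
  shows "q p \<le> q (\<lambda>x. p x + d x)"
proof -
  have pd: "(\<lambda>x. p x + d x) \<in> L2 M" using p d by (rule L2_add)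
  show ?thesis
    unfolding form_eq_SUP_T[OF p] form_eq_SUP_T[OF pd]
  proof (rule SUP_mono, rule bexI)
    fix n :: nat
    let ?T = "T ((1/2)^n)"
    have t: "(0::real) < (1/2)^n" by simp
    note TL = T_L2[OF t]
    have "ip (?T (\<lambda>x. p x + d x)) (\<lambda>x. p x + d x) = ip (?T p) p + 2 * ip (?T p) d + ip (?T d) d"
      using p d pd TL T_sym[OF t pd p] T_sym[OF t pd d] T_sym[OF t p d]
      by (simp add: l2_inner_add_left l2_inner_add_right l2_inner_commute[of M _ "?T _"])
    moreover have "ip (\<lambda>x. p x + d x) (\<lambda>x. p x + d x) = ip p p + 2 * ip p d + ip d d"
      using p d pd by (simp add: l2_inner_add_left l2_inner_add_right l2_inner_commute[of M d p])
    ultimately have "ip p p - ip (?T p) p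
       \<le> ip (\<lambda>x. p x + d x) (\<lambda>x. p x + d x) - ip (?T (\<lambda>x. p x + d x)) (\<lambda>x. p x + d x)"
      using le[of n] T_contraction[OF t d] by linarith
    then show "ennreal (2^n * (ip p p - ip (?T p) p))
       \<le> ennreal (2^n * (ip (\<lambda>x. p x + d x) (\<lambda>x. p x + d x) - ip (?T (\<lambda>x. p x + d x)) (\<lambda>x. p x + d x)))"
      by (intro ennreal_leI mult_left_mono) auto
  qed simp
qed

text \<open>If the kernels do not lead from the complement into \<open>N\<close>, the mixed term
  between the two parts of \<open>f\<close> vanishes. Symmetry of \<open>T\<close> is built into
  \<open>form_le_add\<close>, so this one direction already gives an invariant set.\<close>

lemma null_or_conull:
  assumes [measurable]: "N \<in> sets M"
    and N: "\<And>n. AE x in M. x \<notin> N \<longrightarrow> K ((1/2)^n) (indicator N) x = 0"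
  shows "(AE x in M. x \<notin> N) \<or> (AE x in M. x \<in> N)"
proof -
  have "form_invariant M q N"
    unfolding form_invariant_def
  proof (intro conjI ballI)
    fix f assume f: "f \<in> L2 M"
    let ?p = "\<lambda>x. indicator N x * f x" and ?d = "\<lambda>x. indicator (space M - N) x * f x"
    have p: "?p \<in> L2 M" and d: "?d \<in> L2 M" using f by (auto intro: L2_indicator_mult)
    have "q ?p \<le> q (\<lambda>x. ?p x + ?d x)"
    proof (rule form_le_add[OF p d])
      fix n
      have t: "(0::real) < (1/2)^n" by simp
      have "AE x in M. T ((1/2)^n) ?p x * ?d x = 0"
      proof -
        have "AE x in M. K ((1/2)^n) (indicator N) x = 0 \<longrightarrow> T ((1/2)^n) ?p x = 0"
          by (rule T_eq_0[OF t p]) auto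
        then show ?thesis using N[of n] by eventually_elim (auto simp: indicator_def)
      qed
      then have "ip (T ((1/2)^n) ?p) ?d = 0"
        unfolding l2_inner_def by (rule integral_eq_zero_AE)
      moreover have "ip ?p ?d = 0"
        unfolding l2_inner_def by (rule integral_eq_zero_AE) (auto simp: indicator_def)
      ultimately show "ip (T ((1/2)^n) ?p) ?d \<le> ip ?p ?d" by simp
    qed
    also have "\<dots> = q f"
      by (rule form_cong_AE[OF qf L2_add[OF p d] f], rule AE_I2) (auto simp: indicator_def)
    finally show "q ?p \<le> q f" .
  qed fact
  then consider "emeasure M N = 0" | "emeasure M (space M - N) = 0"
    using irred unfolding irreducible_form_def by blast
  then show ?thesis
  proof cases
    case 1
    then have "AE x in M. x \<notin> N" by (intro AE_I[where N = N]) auto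
    then show ?thesis ..
  next
    case 2
    then have "AE x in M. x \<in> N" by (intro AE_I[where N = "space M - N"]) auto
    then show ?thesis ..
  qed
qed

section \<open>From the semigroup law to Chapman-Kolmogorov\<close>

lemma K_semigroup_L2:
  assumes t: "0 < s" "0 < t" and f: "f \<in> L2 M" and nn: "\<And>x. 0 \<le> f x"
  shows "AE x in M. K s (K t (\<lambda>y. ennreal (f y))) x = K (s + t) (\<lambda>y. ennreal (f y)) x"
proof -
  \<comment> \<open>A representative of \<open>T t f\<close> that is nonnegative everywhere, as
    \<open>K_eq_T\<close> demands.\<close>
  define g where "g = (\<lambda>x. max 0 (T t f x))"
  have g: "g \<in> L2 M"
    by (rule L2_dominated[OF T_L2[OF t(2) f]])
      (use T_L2[OF t(2) f] in \<open>auto simp: g_def dest: L2_measurable\<close>)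
  have gT: "AE x in M. g x = T t f x"
    using K_eq_T[OF t(2) f nn] by eventually_elim (simp add: g_def)
  \<comment> \<open>That \<open>T s\<close> respects a.e. equality follows from its symmetry, by
    moving it to the test function.\<close>
  have AE1: "AE x in M. T s g x = T s (T t f) x"
  proof (rule L2_eq_AE_I)
    fix h assume h: "h \<in> L2 M"
    have "ip g (T s h) = ip (T t f) (T s h)"
      by (rule l2_inner_cong_AE[OF gT]) (use g t f h in auto)
    then show "ip (T s g) h = ip (T s (T t f)) h" using g t f h by (simp add: T_sym)
  qed (use g t f in auto)
  have "AE y in M. K t (\<lambda>y. ennreal (f y)) y = ennreal (g y)"
    using K_eq_T[OF t(2) f nn] by eventually_elim (simp add: g_def)
  then have eq: "K s (K t (\<lambda>y. ennreal (f y))) x = K s (\<lambda>y. ennreal (g y)) x" for x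
    by (rule K_cong_AE)
  have "AE x in M. K s (\<lambda>y. ennreal (g y)) x = ennreal (T s g x) \<and> 0 \<le> T s g x"
    by (rule K_eq_T[OF t(1) g]) (simp add: g_def)
  then show ?thesis
    using AE1 T_semigroup[OF t f] K_eq_T[OF add_pos_pos[OF t] f nn]
    by eventually_elim (simp add: eq)
qed

text \<open>\<open>B\<close> may have infinite measure, so its indicator is approached from below by
  indicators in \<open>L2 M\<close>.\<close>

lemma K_semigroup_indicator:
  assumes t: "0 < s" "0 < t" and [measurable]: "B \<in> sets M"
  shows "AE x in M. K s (K t (indicator B)) x = K (s + t) (indicator B) x"
proof -
  obtain F where F: "range F \<subseteq> sets M" "(\<Union>i. F i) = space M" "\<And>i. emeasure M (F i) \<noteq> \<infinity>" "incseq F"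
    using sigma_finite_incseq by blast
  then have [measurable]: "F i \<in> sets M" for i by auto
  define u where "u i = (indicator (B \<inter> F i) :: 'a \<Rightarrow> ennreal)" for i
  have [measurable]: "u i \<in> borel_measurable M" for i unfolding u_def by measurable
  have inc: "incseq u" using F(4) by (auto simp: u_def incseq_def le_fun_def indicator_def)
  have ind: "AE x in M. indicator B x = (SUP i. u i x)"
  proof (rule AE_I2)
    fix x assume "x \<in> space M"
    then obtain j where "x \<in> F j" using F(2) by auto
    then show "indicator B x = (SUP i. u i x)"
      by (intro antisym SUP_upper2[of j] SUP_least) (auto simp: u_def indicator_def)
  qed
  have "AE x in M. K s (K t (u i)) x = K (s + t) (u i) x" for i
  proof -
    have "emeasure M (B \<inter> F i) \<le> emeasure M (F i)" by (intro emeasure_mono) auto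
    then have "emeasure M (B \<inter> F i) < \<infinity>" using F(3)[of i] by (auto simp: less_top top_unique)
    then have "integrable M (indicat_real (B \<inter> F i))" by (intro integrable_real_indicator) auto
    then have "indicat_real (B \<inter> F i) \<in> L2 M"
      by (auto simp: L2_def power2_eq_square simp flip: indicator_inter_arith)
    from K_semigroup_L2[OF t this] show ?thesis by (simp add: u_def ennreal_indicator)
  qed
  then have "AE x in M. \<forall>i. K s (K t (u i)) x = K (s + t) (u i) x" by (simp add: AE_all_countable)
  then show ?thesis using AE_space
  proof eventually_elim
    case (elim x)
    have "K t (indicator B) y = (SUP i. K t (u i) y)" if "y \<in> space M" for y
      using K_cong_AE[OF ind, of t y] K_SUP[of u y t] inc that by simp
    then have "K s (K t (indicator B)) x = K s (\<lambda>y. SUP i. K t (u i) y) x"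
      by (intro K_cong_AE AE_I2)
    also have "\<dots> = (SUP i. K s (K t (u i)) x)"
      using elim inc by (intro K_SUP) (auto simp: incseq_def le_fun_def intro!: K_mono_AE)
    also have "\<dots> = (SUP i. K (s + t) (u i) x)" using elim by simp
    also have "\<dots> = K (s + t) (indicator B) x"
      using K_cong_AE[OF ind, of "s + t" x] K_SUP[of u x "s + t"] inc elim by simp
    finally show ?case .
  qed
qed

lemma kk_Fubini:
  assumes [measurable]: "u \<in> borel_measurable M" and x: "x \<in> space M"
  shows "(\<integral>\<^sup>+y. (\<integral>\<^sup>+z. kk s (x, z) * kk t (z, y) \<partial>M) * u y \<partial>M) = K s (K t u) x"
proof -
  interpret P: pair_sigma_finite M M ..
  have "(\<integral>\<^sup>+y. (\<integral>\<^sup>+z. kk s (x, z) * kk t (z, y) \<partial>M) * u y \<partial>M)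
     = (\<integral>\<^sup>+y. (\<integral>\<^sup>+z. kk s (x, z) * kk t (z, y) * u y \<partial>M) \<partial>M)"
    using x by (intro nn_integral_cong nn_integral_multc[symmetric]) measurable
  also have "\<dots> = (\<integral>\<^sup>+z. (\<integral>\<^sup>+y. kk s (x, z) * kk t (z, y) * u y \<partial>M) \<partial>M)"
    using x by (intro P.Fubini') measurable
  also have "\<dots> = (\<integral>\<^sup>+z. kk s (x, z) * (\<integral>\<^sup>+y. kk t (z, y) * u y \<partial>M) \<partial>M)"
    using x by (intro nn_integral_cong) (simp add: mult.assoc nn_integral_cmult)
  finally show ?thesis by (simp add: K_def)
qed

text \<open>The null set in \<open>K_semigroup_indicator\<close> depends on \<open>B\<close>, so
  \<open>x\<close> cannot be fixed first. Instead both sides are compared as densities on the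
  product: they give the same measure on rectangles, hence on all product sets, and densities are
  unique a.e.\<close>

lemma Chapman_Kolmogorov:
  assumes t: "0 < s" "0 < t"
  shows "AE p in M \<Otimes>\<^sub>M M. kk (s + t) p = (\<integral>\<^sup>+z. kk s (fst p, z) * kk t (z, snd p) \<partial>M)"
proof -
  interpret P: pair_sigma_finite M M ..
  define \<kappa> where "\<kappa> p = (\<integral>\<^sup>+z. kk s (fst p, z) * kk t (z, snd p) \<partial>M)" for p
  have [measurable]: "\<kappa> \<in> borel_measurable (M \<Otimes>\<^sub>M M)" unfolding \<kappa>_def by measurable
  obtain F where F: "range F \<subseteq> sets M" "(\<Union>i. F i) = space M" "\<And>i. emeasure M (F i) \<noteq> \<infinity>" "incseq F"
    using sigma_finite_incseq by blast
  then have [measurable]: "F i \<in> sets M" for i by auto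
  have rect: "emeasure (density (M \<Otimes>\<^sub>M M) \<phi>) (A \<times> B)
      = (\<integral>\<^sup>+x. indicator A x * (\<integral>\<^sup>+y. \<phi> (x, y) * indicator B y \<partial>M) \<partial>M)"
    if [measurable]: "\<phi> \<in> borel_measurable (M \<Otimes>\<^sub>M M)" "A \<in> sets M" "B \<in> sets M" for \<phi> A B
  proof -
    have "emeasure (density (M \<Otimes>\<^sub>M M) \<phi>) (A \<times> B) = (\<integral>\<^sup>+p. \<phi> p * indicator (A \<times> B) p \<partial>(M \<Otimes>\<^sub>M M))"
      by (rule emeasure_density) measurable
    also have "\<dots> = (\<integral>\<^sup>+x. (\<integral>\<^sup>+y. \<phi> (x, y) * indicator (A \<times> B) (x, y) \<partial>M) \<partial>M)"
      by (rule nn_integral_fst[symmetric]) measurable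
    also have "\<dots> = (\<integral>\<^sup>+x. indicator A x * (\<integral>\<^sup>+y. \<phi> (x, y) * indicator B y \<partial>M) \<partial>M)"
      by (intro nn_integral_cong) (auto simp: indicator_def)
    finally show ?thesis .
  qed
  have rect1: "emeasure (density (M \<Otimes>\<^sub>M M) (kk (s + t))) (A \<times> B) = (\<integral>\<^sup>+x. indicator A x * K (s + t) (indicator B) x \<partial>M)"
    if "A \<in> sets M" "B \<in> sets M" for A B
    using that by (simp add: rect K_def)
  have rect2: "emeasure (density (M \<Otimes>\<^sub>M M) \<kappa>) (A \<times> B) = (\<integral>\<^sup>+x. indicator A x * K s (K t (indicator B)) x \<partial>M)"
    if "A \<in> sets M" "B \<in> sets M" for A B
  proof -
    have "(\<integral>\<^sup>+y. \<kappa> (x, y) * indicator B y \<partial>M) = K s (K t (indicator B)) x" if "x \<in> space M" for x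
      using kk_Fubini[of "indicator B" x s t] that \<open>B \<in> sets M\<close> by (simp add: \<kappa>_def)
    then show ?thesis using that by (simp add: rect cong: nn_integral_cong)
  qed
  have "density (M \<Otimes>\<^sub>M M) (kk (s + t)) = density (M \<Otimes>\<^sub>M M) \<kappa>"
  proof (rule measure_eqI_generator_eq[OF Int_stable_pair_measure_generator[of M M], where A = "\<lambda>i. F i \<times> F i"])
    show "{a \<times> b |a b. a \<in> sets M \<and> b \<in> sets M} \<subseteq> Pow (space M \<times> space M)"
      using sets.sets_into_space by fast
    fix X assume "X \<in> {a \<times> b |a b. a \<in> sets M \<and> b \<in> sets M}"
    then obtain A B where X: "X = A \<times> B" and [measurable]: "A \<in> sets M" "B \<in> sets M" by auto
    show "emeasure (density (M \<Otimes>\<^sub>M M) (kk (s + t))) X = emeasure (density (M \<Otimes>\<^sub>M M) \<kappa>) X"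
      unfolding X by (subst rect1, simp, simp, subst rect2, simp, simp, rule nn_integral_cong_AE)
        (use K_semigroup_indicator[OF t \<open>B \<in> sets M\<close>] in auto)
  next
    show "range (\<lambda>i. F i \<times> F i) \<subseteq> {a \<times> b |a b. a \<in> sets M \<and> b \<in> sets M}"
      using F(1) by blast
  next
    show "(\<Union>i. F i \<times> F i) = space M \<times> space M"
    proof (intro equalityI subsetI)
      fix p assume "p \<in> space M \<times> space M"
      then have "fst p \<in> (\<Union>i. F i)" "snd p \<in> (\<Union>i. F i)" using F(2) by (auto simp: mem_Times_iff)
      then obtain i j where "fst p \<in> F i" "snd p \<in> F j" by blast
      then have "p \<in> F (max i j) \<times> F (max i j)"
        using incseqD[OF F(4), of i "max i j"] incseqD[OF F(4), of j "max i j"] by (auto simp: mem_Times_iff)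
      then show "p \<in> (\<Union>i. F i \<times> F i)" by blast
    qed (use F(2) in auto)
  next
    fix i
    have "emeasure M (F i) < \<infinity>" using F(3)[of i] by (simp add: less_top)
    then have "integrable M (indicat_real (F i))" by (intro integrable_real_indicator) auto
    then have L: "indicat_real (F i) \<in> L2 M"
      by (auto simp: L2_def power2_eq_square simp flip: indicator_inter_arith)
    have st: "0 < s + t" using t by simp
    let ?g = "T (s + t) (indicat_real (F i))"
    have g: "?g \<in> L2 M" using st L by simp
    \<comment> \<open>Finiteness on the exhausting squares: the integral is the pairing of two
      elements of \<open>L2 M\<close>.\<close>
    have "(\<integral>\<^sup>+x. indicator (F i) x * K (s + t) (indicator (F i)) x \<partial>M) = (\<integral>\<^sup>+x. ennreal (indicator (F i) x * ?g x) \<partial>M)"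
    proof (rule nn_integral_cong_AE)
      have "AE x in M. K (s + t) (indicator (F i)) x = ennreal (?g x) \<and> 0 \<le> ?g x"
        using K_eq_T[OF st L] by (simp only: ennreal_indicator indicator_pos_le if_True simp_thms)
      then show "AE x in M. indicator (F i) x * K (s + t) (indicator (F i)) x = ennreal (indicator (F i) x * ?g x)"
        by eventually_elim (auto simp: indicator_def)
    qed
    also have "\<dots> < \<infinity>" using L2_mult_integrable[OF L g] by (simp add: real_integrable_def less_top)
    finally show "emeasure (density (M \<Otimes>\<^sub>M M) (kk (s + t))) (F i \<times> F i) \<noteq> \<infinity>"
      by (subst rect1) auto
  qed (auto simp: sets_pair_measure)
  then show ?thesis
    unfolding \<kappa>_def[symmetric] by (subst (asm) P.P.density_unique_iff) auto
qed

section \<open>Positivity of the kernels at dyadic times\<close>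

definition dyadic :: "nat \<times> nat \<Rightarrow> real" where
  "dyadic a = real (Suc (fst a)) / 2 ^ snd a"

lemma dyadic_pos [simp]: "0 < dyadic a"
  by (simp add: dyadic_def)

text \<open>Keeps Chapman-Kolmogorov inside the countable family of times.\<close>

lemma dyadic_add: "\<exists>c. dyadic a + dyadic b = dyadic c"
proof -
  have "Suc (fst a) * 2 ^ snd b + Suc (fst b) * 2 ^ snd a \<noteq> 0" by simp
  then obtain j where j: "Suc (fst a) * 2 ^ snd b + Suc (fst b) * 2 ^ snd a = Suc j"
    using not0_implies_Suc by blast
  have "dyadic a + dyadic b = real (Suc (fst a) * 2 ^ snd b + Suc (fst b) * 2 ^ snd a) / 2 ^ (snd a + snd b)"
    by (simp add: dyadic_def field_simps power_add)
  also have "\<dots> = dyadic (j, snd a + snd b)" unfolding j dyadic_def by simp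
  finally show ?thesis by blast
qed

lemma dyadic_half_power: "dyadic (0, n) = (1/2)^n"
  by (simp add: dyadic_def power_one_over)

text \<open>Where every kernel vanishes, \<open>T\<close> is 0 at arbitrarily small times.
  Continuity at time 0 then forces a function supported there to be null.\<close>

lemma AE_K_one_not_0: "AE x in M. \<exists>a. K (dyadic a) (\<lambda>_. 1) x \<noteq> 0"
proof -
  obtain g where g: "g \<in> L2 M" "\<And>x. 0 < g x" using exists_positive_L2_bounded by blast
  define C where "C = {x \<in> space M. \<forall>a. K (dyadic a) (\<lambda>_. 1) x = 0}"
  have [measurable]: "C \<in> sets M" unfolding C_def by measurable
  define f where "f = (\<lambda>x. indicator C x * g x)"
  have f: "f \<in> L2 M" unfolding f_def using g by (intro L2_indicator_mult) auto
  have "ip (T ((1/2)^n) f) f = 0" for n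
  proof -
    have "AE x in M. T ((1/2)^n) f x * f x = 0"
    proof -
      have "AE x in M. K ((1/2)^n) (indicator (space M)) x = 0 \<longrightarrow> T ((1/2)^n) f x = 0"
        by (rule T_eq_0[OF _ f]) (auto simp: f_def C_def)
      then show ?thesis
      proof eventually_elim
        case (elim x)
        show ?case
        proof (cases "x \<in> C")
          case True
          have "K ((1/2)^n) (indicator (space M)) x = K ((1/2)^n) (\<lambda>_. 1) x"
            by (intro K_cong_AE AE_I2) simp
          also have "\<dots> = 0" using True by (auto simp: C_def simp flip: dyadic_half_power)
          finally show ?thesis using elim by simp
        qed (simp add: f_def)
      qed
    qed
    then show ?thesis unfolding l2_inner_def by (rule integral_eq_zero_AE)
  qed
  then have "ip f f = 0" using LIMSEQ_unique[OF T_continuous_at_0[OF f], of 0] by simp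
  from l2_inner_eq_0[OF f this] show ?thesis using AE_space
    by eventually_elim (use g(2) in \<open>auto simp: f_def C_def indicator_def less_le split: if_splits\<close>)
qed

text \<open>By Chapman-Kolmogorov, the common zero set of the \<open>k\<^sub>t(x, \<cdot>)\<close> is invariant for almost every \<open>x\<close>.\<close>

lemma AE_kernel_positive: "AE x in M. AE y in M. \<exists>a. kk (dyadic a) (x, y) \<noteq> 0"
proof -
  interpret P: pair_sigma_finite M M ..
  \<comment> \<open>All null sets of pairs are united before slicing, so that a single null set of
    points \<open>x\<close> serves for all pairs of times.\<close>
  have "AE p in M \<Otimes>\<^sub>M M. \<forall>a b. kk (dyadic a + dyadic b) p
      = (\<integral>\<^sup>+z. kk (dyadic a) (fst p, z) * kk (dyadic b) (z, snd p) \<partial>M)"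
    unfolding AE_all_countable by (intro allI Chapman_Kolmogorov) auto
  from P.AE_pair[OF this] show ?thesis using AE_K_one_not_0 AE_space
  proof eventually_elim
    case (elim x)
    define N where "N = {y \<in> space M. \<forall>a. kk (dyadic a) (x, y) = 0}"
    have [measurable]: "N \<in> sets M" unfolding N_def using elim(3) by measurable
    \<comment> \<open>On \<open>N\<close> the kernel at time \<open>dyadic a + dyadic b\<close>
      vanishes, this time being dyadic. Integrating the composition formula over \<open>N\<close>
      yields a vanishing integral of nonnegative terms.\<close>
    have "AE z in M. kk (dyadic a) (x, z) = 0 \<or> K (dyadic b) (indicator N) z = 0" for a b
    proof -
      have "AE y in M. (\<integral>\<^sup>+z. kk (dyadic a) (x, z) * kk (dyadic b) (z, y) \<partial>M) * indicator N y = 0"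
        using elim(1)
      proof eventually_elim
        case (elim y)
        obtain c where c: "dyadic a + dyadic b = dyadic c" using dyadic_add by blast
        from elim have "kk (dyadic a + dyadic b) (x, y)
          = (\<integral>\<^sup>+z. kk (dyadic a) (x, z) * kk (dyadic b) (z, y) \<partial>M)" by (metis fst_conv snd_conv)
        moreover have "kk (dyadic c) (x, y) = 0" if "y \<in> N" using that unfolding N_def by blast
        ultimately show ?case unfolding c by (cases "y \<in> N") simp_all
      qed
      then have "(\<integral>\<^sup>+y. (\<integral>\<^sup>+z. kk (dyadic a) (x, z) * kk (dyadic b) (z, y) \<partial>M) * indicator N y \<partial>M) = 0"
        by (subst nn_integral_cong_AE[where v = "\<lambda>_. 0"]) simp_all
      then have "(\<integral>\<^sup>+z. kk (dyadic a) (x, z) * K (dyadic b) (indicator N) z \<partial>M) = 0"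
        using elim(3) by (subst (asm) kk_Fubini) (auto simp: K_def)
      then show ?thesis using elim(3) by (subst (asm) nn_integral_0_iff_AE) auto
    qed
    then have "AE z in M. \<forall>a b. kk (dyadic a) (x, z) = 0 \<or> K (dyadic b) (indicator N) z = 0"
      unfolding AE_all_countable by blast
    then have inv: "AE z in M. z \<notin> N \<longrightarrow> (\<forall>b. K (dyadic b) (indicator N) z = 0)"
      using AE_space by eventually_elim (auto simp: N_def)
    have "(AE y in M. y \<notin> N) \<or> (AE y in M. y \<in> N)"
    proof (rule null_or_conull)
      fix n
      from inv show "AE z in M. z \<notin> N \<longrightarrow> K ((1/2)^n) (indicator N) z = 0"
        by eventually_elim (metis dyadic_half_power)
    qed measurable
    \<comment> \<open>A conull \<open>N\<close> would leave \<open>x\<close> with no kernel mass at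
      any time, contrary to \<open>AE_K_one_not_0\<close>.\<close>
    moreover have "\<not> (AE y in M. y \<in> N)"
    proof
      assume *: "AE y in M. y \<in> N"
      have "K (dyadic a) (\<lambda>_. 1) x = 0" for a
      proof -
        from * have "AE y in M. kk (dyadic a) (x, y) * 1 = 0" by eventually_elim (simp add: N_def del: split_paired_All)
        then have "(\<integral>\<^sup>+y. kk (dyadic a) (x, y) * 1 \<partial>M) = (\<integral>\<^sup>+y. 0 \<partial>M)" by (rule nn_integral_cong_AE)
        then show ?thesis by (simp add: K_def)
      qed
      with elim(2) show False by simp
    qed
    ultimately have "AE y in M. y \<notin> N" by blast
    then show ?case using AE_space by eventually_elim (auto simp: N_def)
  qed
qed

end

section \<open>Almost excessive functions\<close>

text \<open>Positivity of \<open>v\<close> provides small admissible levels and a.e. finiteness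
  bounds them from above, so their supremum is positive and finite.\<close>

lemma (in finite_measure) exists_median_scale:
  fixes v :: "'a \<Rightarrow> ennreal"
  assumes [measurable]: "v \<in> borel_measurable M"
    and pos: "\<And>x. x \<in> space M \<Longrightarrow> 0 < v x" and fin: "AE x in M. v x < \<infinity>"
    and c: "0 < measure M (space M)"
  shows "\<exists>r>0. measure M (space M) / 2 \<le> measure M {x\<in>space M. ennreal r \<le> v x} \<and>
    measure M {x\<in>space M. ennreal (2 * r) \<le> v x} < measure M (space M) / 2"
proof -
  let ?c = "measure M (space M)"
  define R where "R = {r. 0 < r \<and> ?c / 2 \<le> measure M {x\<in>space M. ennreal r \<le> v x}}"
  have "(\<lambda>n. measure M {x\<in>space M. ennreal (1 / real (Suc n)) \<le> v x}) \<longlonglongrightarrow>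
      measure M (\<Union>n. {x\<in>space M. ennreal (1 / real (Suc n)) \<le> v x})"
    by (rule finite_Lim_measure_incseq)
      (auto simp: incseq_def frac_le elim!: order_trans[rotated] intro!: ennreal_leI)
  also have "(\<Union>n. {x\<in>space M. ennreal (1 / real (Suc n)) \<le> v x}) = space M"
  proof (intro equalityI subsetI)
    fix x assume x: "x \<in> space M"
    have "(\<lambda>n. ennreal (1 / real (Suc n))) \<longlonglongrightarrow> ennreal 0"
      by (intro tendsto_ennrealI LIMSEQ_Suc lim_1_over_n)
    then have "\<forall>\<^sub>F n in sequentially. ennreal (1 / real (Suc n)) < v x"
      using pos[OF x] by (intro order_tendstoD(2)) auto
    then obtain n where "ennreal (1 / real (Suc n)) < v x" by (auto simp: eventually_sequentially)
    then show "x \<in> (\<Union>n. {x\<in>space M. ennreal (1 / real (Suc n)) \<le> v x})"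
      using x by (auto intro: less_imp_le)
  qed auto
  finally have "\<forall>\<^sub>F n in sequentially. ?c / 2 < measure M {x\<in>space M. ennreal (1 / real (Suc n)) \<le> v x}"
    using c by (intro order_tendstoD(1)) auto
  then obtain n where "?c / 2 < measure M {x\<in>space M. ennreal (1 / real (Suc n)) \<le> v x}"
    by (auto simp: eventually_sequentially)
  then have ne: "1 / real (Suc n) \<in> R" by (auto simp: R_def)
  have "(\<lambda>n. measure M {x\<in>space M. ennreal (real n) \<le> v x}) \<longlonglongrightarrow>
      measure M (\<Inter>n. {x\<in>space M. ennreal (real n) \<le> v x})"
    by (rule finite_Lim_measure_decseq)
      (auto simp: decseq_def elim!: order_trans[rotated] intro!: ennreal_leI)
  also have "measure M (\<Inter>n. {x\<in>space M. ennreal (real n) \<le> v x}) = measure M {}"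
  proof (rule measure_eq_AE)
    from fin show "AE x in M. x \<in> (\<Inter>n. {x\<in>space M. ennreal (real n) \<le> v x}) \<longleftrightarrow> x \<in> {}"
    proof eventually_elim
      case (elim x)
      then obtain n where "v x < of_nat n" using ennreal_Ex_less_of_nat by auto
      then have "\<not> ennreal (real n) \<le> v x" by (simp add: ennreal_of_nat_eq_real_of_nat not_le)
      then show ?case by auto
    qed
  qed auto
  finally have "\<forall>\<^sub>F n in sequentially. measure M {x\<in>space M. ennreal (real n) \<le> v x} < ?c / 2"
    using c by (intro order_tendstoD(2)) auto
  then obtain m where m: "measure M {x\<in>space M. ennreal (real m) \<le> v x} < ?c / 2"
    by (auto simp: eventually_sequentially)
  have le_m: "r \<le> real m" if "r \<in> R" for r
  proof (rule ccontr)
    assume "\<not> r \<le> real m"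
    then have "measure M {x\<in>space M. ennreal r \<le> v x} \<le> measure M {x\<in>space M. ennreal (real m) \<le> v x}"
      by (intro finite_measure_mono) (auto elim!: order_trans[rotated] intro!: ennreal_leI)
    with that m show False by (simp add: R_def)
  qed
  then have bdd: "bdd_above R" by (auto simp: bdd_above_def)
  have "0 < Sup R" using cSup_upper[OF ne bdd] by (rule less_le_trans[rotated]) simp
  \<comment> \<open>A level above half the supremum: its double is no longer admissible. The factor
    2 avoids the question whether the supremum is attained.\<close>
  then obtain r where r: "r \<in> R" "Sup R / 2 < r"
    using less_cSup_iff[OF _ bdd, of "Sup R / 2"] ne by auto
  have "2 * r \<notin> R" using cSup_upper[OF _ bdd, of "2 * r"] r(2) by auto
  then show ?thesis using r(1) by (intro exI[of _ r]) (auto simp: R_def)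
qed

context kernel_form
begin

text \<open>Applying \<open>K\<close> at a multiple of the step shifts the damped sum; what is lost
  is the initial terms and a power of the damping factor.\<close>

lemma exists_almost_excessive:
  fixes p :: nat
  shows "\<exists>v. v \<in> borel_measurable M \<and> (\<forall>x\<in>space M. 0 < v x) \<and> (AE x in M. v x < \<infinity>) \<and>
    (\<forall>j. AE x in M. ennreal (exp (- (dyadic (j, p) / real (Suc p)))) * K (dyadic (j, p)) v x \<le> v x)"
proof -
  obtain g where g: "g \<in> L2 M" "\<And>x. 0 < g x" using exists_positive_L2_bounded by blast
  then have nn: "0 \<le> g x" for x by (simp add: less_imp_le)
  have [measurable]: "g \<in> borel_measurable M" using g(1) by (rule L2_measurable)
  define G where "G = (\<lambda>x. ennreal (g x))"
  have [measurable]: "G \<in> borel_measurable M" unfolding G_def by measurable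
  \<comment> \<open>The term at time 0 is set by hand, because \<open>K\<close> at time 0 is 0 by
    convention and not the identity.\<close>
  define W where "W i = (if i = 0 then G else K (real i / 2^p) G)" for i :: nat
  have [measurable]: "W i \<in> borel_measurable M" for i by (simp add: W_def)
  \<comment> \<open>The step \<open>2^-p\<close> divided by \<open>p + 1\<close>. A shift by time
    \<open>t\<close> then costs \<open>exp (t / (p + 1))\<close>, which tends to 1 for each fixed
    \<open>t\<close>.\<close>
  define a where "a = 1 / (2^p * real (Suc p))"
  have a: "0 < a" by (simp add: a_def)
  define v where "v x = (\<Sum>i. ennreal (exp (- a) ^ i) * W i x)" for x
  have [measurable]: "v \<in> borel_measurable M" unfolding v_def by measurable
  have pos: "0 < v x" for x
  proof -
    have "0 < ennreal (exp (- a) ^ 0) * W 0 x" using g(2)[of x] by (simp add: W_def G_def)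
    also have "\<dots> \<le> v x" unfolding v_def
      using sum_le_suminf[OF summableI, of "{0}" "\<lambda>i. ennreal (exp (- a) ^ i) * W i x"] by simp
    finally show ?thesis .
  qed
  \<comment> \<open>Bounded uniformly in \<open>i\<close> by contractivity, so the damped sum has a
    finite integral against the positive weight \<open>G\<close> and is finite a.e.\<close>
  have WG: "(\<integral>\<^sup>+x. W i x * G x \<partial>M) \<le> ennreal (ip g g)" for i
  proof (cases "i = 0")
    case True
    then have "(\<integral>\<^sup>+x. W i x * G x \<partial>M) = (\<integral>\<^sup>+x. ennreal (g x * g x) \<partial>M)"
      using nn by (simp add: W_def G_def ennreal_mult)
    also have "\<dots> = ennreal (ip g g)"
      unfolding l2_inner_def by (rule nn_integral_eq_integral[OF L2_mult_integrable[OF g(1) g(1)]]) (simp add: nn)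
    finally show ?thesis by simp
  next
    case False
    then have t: "0 < real i / 2^p" by simp
    have "(\<integral>\<^sup>+x. W i x * G x \<partial>M) = (\<integral>\<^sup>+x. ennreal (T (real i / 2^p) g x * g x) \<partial>M)"
    proof (rule nn_integral_cong_AE)
      show "AE x in M. W i x * G x = ennreal (T (real i / 2^p) g x * g x)"
        using K_eq_T[OF t g(1) nn]
        by eventually_elim (use False nn in \<open>simp add: W_def G_def ennreal_mult\<close>)
    qed
    also have "\<dots> = ennreal (ip (T (real i / 2^p) g) g)"
      unfolding l2_inner_def
    proof (rule nn_integral_eq_integral[OF L2_mult_integrable[OF T_L2[OF t g(1)] g(1)]])
      show "AE x in M. 0 \<le> T (real i / 2^p) g x * g x"
        using K_eq_T[OF t g(1) nn] by eventually_elim (simp add: nn)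
    qed
    also have "\<dots> \<le> ennreal (ip g g)" by (intro ennreal_leI T_contraction t g)
    finally show ?thesis .
  qed
  have "AE x in M. v x < \<infinity>"
  proof -
    have "(\<integral>\<^sup>+x. v x * G x \<partial>M) = (\<integral>\<^sup>+x. (\<Sum>i. ennreal (exp (- a) ^ i) * (W i x * G x)) \<partial>M)"
      by (simp add: v_def mult.assoc flip: ennreal_suminf_multc)
    also have "\<dots> = (\<Sum>i. \<integral>\<^sup>+x. ennreal (exp (- a) ^ i) * (W i x * G x) \<partial>M)"
      by (rule nn_integral_suminf) measurable
    also have "\<dots> = (\<Sum>i. ennreal (exp (- a) ^ i) * (\<integral>\<^sup>+x. W i x * G x \<partial>M))"
      by (intro suminf_cong nn_integral_cmult) measurable
    also have "\<dots> \<le> (\<Sum>i. ennreal (exp (- a) ^ i) * ennreal (ip g g))"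
      by (intro suminf_le mult_left_mono WG) auto
    also have "\<dots> = (\<Sum>i. ennreal (exp (- a) ^ i)) * ennreal (ip g g)" by simp
    also have "(\<Sum>i. ennreal (exp (- a) ^ i)) = ennreal (\<Sum>i. exp (- a) ^ i)"
      using a by (intro suminf_ennreal2 summable_geometric) auto
    also have "ennreal (\<Sum>i. exp (- a) ^ i) * ennreal (ip g g) < \<infinity>" by (simp add: ennreal_mult_less_top)
    finally have "AE x in M. v x * G x \<noteq> \<infinity>" by (intro nn_integral_noteq_infinite) auto
    moreover have "G x \<noteq> 0" for x using g(2)[of x] by (simp add: G_def)
    ultimately show ?thesis
      by (auto elim!: eventually_mono simp: ennreal_mult_eq_top_iff less_top[symmetric])
  qed
  moreover have "AE x in M. ennreal (exp (- (dyadic (j, p) / real (Suc p)))) * K (dyadic (j, p)) v x \<le> v x" for j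
  proof -
    have W: "AE x in M. K (dyadic (j, p)) (W i) x = W (i + Suc j) x" for i
    proof (cases "i = 0")
      case True
      then show ?thesis by (simp add: W_def dyadic_def)
    next
      case False
      have *: "dyadic (j, p) + real i / 2^p = real (i + Suc j) / 2^p"
        by (simp add: dyadic_def add_divide_distrib)
      show ?thesis
        using K_semigroup_L2[OF dyadic_pos[of "(j, p)"] _ g(1) nn, of "real i / 2^p"] False
        unfolding * by (simp add: W_def G_def)
    qed
    have "AE x in M. \<forall>i. K (dyadic (j, p)) (W i) x = W (i + Suc j) x"
      unfolding AE_all_countable using W by blast
    then show ?thesis using AE_space
    proof eventually_elim
      case (elim x)
      let ?e = "exp (- (dyadic (j, p) / real (Suc p)))"
      have e: "?e * exp (- a) ^ i = exp (- a) ^ (i + Suc j)" for i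
      proof -
        have "?e = exp (real (Suc j) * - a)" by (simp add: dyadic_def a_def)
        then have "?e = exp (- a) ^ Suc j" unfolding exp_of_nat_mult .
        then show ?thesis by (simp only: power_add mult.commute)
      qed
      have "K (dyadic (j, p)) v x = (\<Sum>i. K (dyadic (j, p)) (\<lambda>x. ennreal (exp (- a) ^ i) * W i x) x)"
        unfolding v_def using elim by (intro K_suminf) auto
      also have "\<dots> = (\<Sum>i. ennreal (exp (- a) ^ i) * W (i + Suc j) x)"
      proof (rule suminf_cong)
        fix i
        show "K (dyadic (j, p)) (\<lambda>x. ennreal (exp (- a) ^ i) * W i x) x = ennreal (exp (- a) ^ i) * W (i + Suc j) x"
          using elim(1) by (subst K_cmult) (auto simp: elim(2))
      qed
      finally have "ennreal ?e * K (dyadic (j, p)) v x = (\<Sum>i. ennreal ?e * (ennreal (exp (- a) ^ i) * W (i + Suc j) x))"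
        by simp
      also have "\<dots> = (\<Sum>i. ennreal (exp (- a) ^ (i + Suc j)) * W (i + Suc j) x)"
        unfolding e[symmetric] by (simp only: ennreal_mult' exp_ge_zero mult.assoc)
      \<comment> \<open>The shifted series is \<open>v\<close> without its first
        \<open>Suc j\<close> terms.\<close>
      also have "\<dots> \<le> v x"
        unfolding v_def by (subst (2) suminf_offset[where i = "Suc j"]) auto
      finally show ?case .
    qed
  qed
  ultimately show ?thesis using pos by (intro exI[of _ v]) auto
qed

end

section \<open>The excessive function\<close>

context kernel_form
begin

section \<open>Uniform lower bounds for sums of kernels\<close>

definition kk_sum :: "nat \<Rightarrow> 'a \<times> 'a \<Rightarrow> ennreal" where
  "kk_sum m p = (\<Sum>i<m. kk (dyadic (from_nat i)) p)"

lemma kk_sum_measurable [measurable]: "kk_sum m \<in> borel_measurable (M \<Otimes>\<^sub>M M)"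
  unfolding kk_sum_def by measurable

text \<open>For a.e. \<open>x\<close> the weighted measure of the set where the partial sum is below
  \<open>1 / (m + 1)\<close> tends to 0, by positivity of the kernels. So a single \<open>m\<close>
  works on a set of \<open>x\<close> that is not null.\<close>

lemma exists_small_set:
  assumes g: "g \<in> borel_measurable M" "integrable M g" and c: "0 < c"
    and nz: "\<not> (AE x in M. False)"
  obtains A m where "A \<in> sets M" "\<not> (AE x in M. x \<notin> A)"
    "\<And>x. x \<in> A \<Longrightarrow> (\<integral>\<^sup>+y. ennreal (g y) * indicator {y. kk_sum m (x, y) < ennreal (1 / real (Suc m))} y \<partial>M) \<le> ennreal c"
proof -
  note [measurable] = g(1)
  define D where "D m x = {y. kk_sum m (x, y) < ennreal (1 / real (Suc m))}" for m x
  define \<phi> where "\<phi> m x = (\<integral>\<^sup>+y. ennreal (g y) * indicator {p. kk_sum m p < ennreal (1 / real (Suc m))} (x, y) \<partial>M)" for m x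
  have \<phi>_D: "\<phi> m x = (\<integral>\<^sup>+y. ennreal (g y) * indicator (D m x) y \<partial>M)" for m x
    unfolding \<phi>_def D_def by (intro nn_integral_cong) (simp add: indicator_def)
  have [measurable]: "\<phi> m \<in> borel_measurable M" for m
  proof -
    have "(\<lambda>p. ennreal (g (snd p)) * indicator {p\<in>space (M \<Otimes>\<^sub>M M). kk_sum m p < ennreal (1 / real (Suc m))} p)
       \<in> borel_measurable (M \<Otimes>\<^sub>M M)" by measurable
    from borel_measurable_nn_integral_fst[OF this] show ?thesis
      by (rule measurable_cong[THEN iffD1, rotated])
        (auto simp: \<phi>_def space_pair_measure indicator_def intro!: nn_integral_cong)
  qed
  have lim: "AE x in M. (\<lambda>m. \<phi> m x) \<longlonglongrightarrow> 0"
    using AE_kernel_positive AE_space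
  proof eventually_elim
    case (elim x)
    have "(\<lambda>m. \<phi> m x) \<longlonglongrightarrow> (\<integral>\<^sup>+y. 0 \<partial>M)"
      unfolding \<phi>_def
    proof (rule nn_integral_dominated_convergence[where w = "\<lambda>y. ennreal (g y)"])
      show "(\<integral>\<^sup>+y. ennreal (g y) \<partial>M) < \<infinity>"
        using g(2) by (simp add: real_integrable_def less_top)
      from elim(1) show "AE y in M. (\<lambda>m. ennreal (g y) * indicator {p. kk_sum m p < ennreal (1 / real (Suc m))} (x, y)) \<longlonglongrightarrow> 0"
      proof eventually_elim
        case (elim y)
        then obtain a where a: "0 < kk (dyadic a) (x, y)" using not_gr_zero by blast
        \<comment> \<open>One parameter \<open>m\<close> governs both the number of kernels and the
          threshold: beyond \<open>?n\<close> the sum contains the positive kernel, and eventually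
          the threshold falls below it.\<close>
        let ?n = "to_nat a"
        have le: "kk (dyadic a) (x, y) \<le> kk_sum m (x, y)" if "?n < m" for m
        proof -
          have "kk (dyadic (from_nat ?n)) (x, y) \<le> (\<Sum>i<m. kk (dyadic (from_nat i)) (x, y))"
            using that by (intro sum_nonneg_leq_bound[where f = "\<lambda>i. kk (dyadic (from_nat i)) (x, y)", OF _ _ refl]) auto
          then show ?thesis by (simp add: kk_sum_def)
        qed
        have "(\<lambda>n. ennreal (1 / real (Suc n))) \<longlonglongrightarrow> ennreal 0"
          by (intro tendsto_ennrealI LIMSEQ_Suc lim_1_over_n)
        then have "\<forall>\<^sub>F n in sequentially. ennreal (1 / real (Suc n)) < kk (dyadic a) (x, y)"
          using a by (intro order_tendstoD(2)) auto
        then show ?case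
          using eventually_gt_at_top[of ?n]
          by (intro tendsto_eventually, eventually_elim)
            (use le in \<open>auto simp: indicator_def not_less intro: order_trans less_imp_le\<close>)
      qed
      show "AE y in M. ennreal (g y) * indicator {p. kk_sum m p < ennreal (1 / real (Suc m))} (x, y) \<le> ennreal (g y)" for m
        by (auto simp: indicator_def)
      fix m
      have "(\<lambda>y. ennreal (g y) * indicator {y\<in>space M. kk_sum m (x, y) < ennreal (1 / real (Suc m))} y) \<in> borel_measurable M"
        using elim(2) by measurable
      then show "(\<lambda>y. ennreal (g y) * indicator {p. kk_sum m p < ennreal (1 / real (Suc m))} (x, y)) \<in> borel_measurable M"
        by (rule measurable_cong[THEN iffD1, rotated]) (auto simp: indicator_def)
    qed auto
    then show ?case by simp
  qed
  define A where "A m = {x \<in> space M. \<phi> m x \<le> ennreal c}" for m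
  have [measurable]: "A m \<in> sets M" for m unfolding A_def by measurable
  have "\<exists>m. \<not> (AE x in M. x \<notin> A m)"
  proof (rule ccontr)
    assume "\<not> ?thesis"
    then have "AE x in M. \<forall>m. x \<notin> A m" by (simp add: AE_all_countable)
    then have "AE x in M. False"
      using lim AE_space
    proof eventually_elim
      case (elim x)
      from order_tendstoD(2)[OF elim(2), of "ennreal c"] c
      obtain m where "\<phi> m x < ennreal c" by (auto simp: eventually_sequentially)
      then have "x \<in> A m" using elim(3) by (simp add: A_def)
      with elim(1) show False by blast
    qed
    with nz show False by blast
  qed
  then obtain m where "\<not> (AE x in M. x \<notin> A m)" by blast
  then show ?thesis by (rule that[rotated]) (auto simp: A_def \<phi>_D D_def)
qed

text \<open>Fatou's lemma with a factor tending to 1. The start \<open>n0\<close> is there because a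
  given time is a multiple of the step \<open>2^-p\<close> only for large \<open>p\<close>.\<close>

lemma K_liminf:
  assumes [measurable]: "\<And>p. w p \<in> borel_measurable M" and x: "x \<in> space M"
    and le: "\<And>p. n0 \<le> p \<Longrightarrow> e p * K t (w p) x \<le> w p x" and e: "e \<longlonglongrightarrow> 1" "incseq e"
  shows "K t (\<lambda>y. SUP n. INF p\<in>{n..}. w p y) x \<le> (SUP n. INF p\<in>{n..}. w p x)"
proof -
  define I where "I n y = (INF p\<in>{n..}. w p y)" for n y
  have [measurable]: "I n \<in> borel_measurable M" for n unfolding I_def by measurable
  have inc: "incseq I" by (auto simp: incseq_def le_fun_def I_def intro!: INF_superset_mono)
  have "K t (\<lambda>y. SUP n. I n y) x = (SUP n. K t (I n) x)" by (rule K_SUP) (use inc x in auto)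
  also have "\<dots> \<le> (SUP n. I n x)"
  proof (rule SUP_least)
    fix n
    have "(\<lambda>m. e m * K t (I n) x) \<longlonglongrightarrow> 1 * K t (I n) x"
      by (intro tendsto_mult_ennreal e tendsto_const) auto
    moreover have "e m * K t (I n) x \<le> (SUP n. I n x)" if m: "max n n0 \<le> m" for m
    proof -
      \<comment> \<open>Here \<open>n\<close> stays fixed while \<open>m\<close> will tend to
        infinity; \<open>e\<close> being increasing allows one factor for all
        \<open>p \<ge> m\<close>.\<close>
      have "e m * K t (I n) x \<le> w p x" if "m \<le> p" for p
      proof -
        have "e m * K t (I n) x \<le> e p * K t (w p) x"
          using that m incseqD[OF e(2) that]
          by (intro mult_mono K_mono_AE AE_I2) (auto simp: I_def intro: INF_lower)
        also have "\<dots> \<le> w p x" using that m by (intro le) auto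
        finally show ?thesis .
      qed
      then have "e m * K t (I n) x \<le> I m x" unfolding I_def[of m] by (intro INF_greatest) auto
      also have "\<dots> \<le> (SUP n. I n x)" by (rule SUP_upper) simp
      finally show ?thesis .
    qed
    ultimately have "1 * K t (I n) x \<le> (SUP n. I n x)" by (intro LIMSEQ_le_const2 exI[of _ "max n n0"]) auto
    then show "K t (I n) x \<le> (SUP n. I n x)" by simp
  qed
  finally show ?thesis by (simp add: I_def)
qed

lemma exists_excessive_ennreal:
  assumes nz: "\<not> (AE x in M. False)"
  obtains h where "h \<in> borel_measurable M" "AE x in M. 0 < h x \<and> h x < \<infinity>"
    "\<And>n. AE x in M. K ((1/2)^n) h x \<le> h x"
proof -
  obtain g where g: "g \<in> L2 M" "integrable M g" "\<And>x. 0 < g x \<and> g x \<le> 1"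
    using exists_positive_L2_bounded by blast
  have [measurable]: "g \<in> borel_measurable M" using g(1) by (rule L2_measurable)
  \<comment> \<open>A finite measure with the null sets of \<open>M\<close>, so that medians make
    sense. Its density is at most 1, which is used below to compare with integrals over
    \<open>M\<close>.\<close>
  define \<nu> where "\<nu> = density M (\<lambda>x. ennreal (g x))"
  have [simp]: "space \<nu> = space M" and [simp, measurable_cong]: "sets \<nu> = sets M" by (auto simp: \<nu>_def)
  have em: "emeasure \<nu> B = (\<integral>\<^sup>+x. ennreal (g x) * indicator B x \<partial>M)" if "B \<in> sets M" for B
    unfolding \<nu>_def using that by (intro emeasure_density) auto
  interpret \<nu>: finite_measure \<nu>
  proof
    have "emeasure \<nu> (space \<nu>) = (\<integral>\<^sup>+x. ennreal (g x) \<partial>M)"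
      by (auto simp: em intro!: nn_integral_cong)
    then show "emeasure \<nu> (space \<nu>) \<noteq> \<infinity>" using g(2) by (simp add: real_integrable_def)
  qed
  have AE\<nu>: "(AE x in \<nu>. P x) \<longleftrightarrow> (AE x in M. P x)" for P
    unfolding \<nu>_def using g(3) by (subst AE_density) auto
  define c where "c = measure \<nu> (space M)"
  have c: "0 < c"
  proof (rule ccontr)
    assume "\<not> 0 < c"
    then have "emeasure \<nu> (space M) = 0"
      using measure_nonneg[of \<nu> "space M"] by (simp add: c_def \<nu>.emeasure_eq_measure)
    then have "AE x in \<nu>. False" by (intro AE_I[where N = "space M"]) auto
    with nz show False by (simp add: AE\<nu>)
  qed
  have ex: "\<exists>w. w \<in> borel_measurable M \<and>
     (\<forall>j. AE x in M. ennreal (exp (- (dyadic (j, p) / real (Suc p)))) * K (dyadic (j, p)) w x \<le> w x) \<and>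
     c / 2 \<le> measure \<nu> {x\<in>space M. 1 \<le> w x} \<and> measure \<nu> {x\<in>space M. 2 \<le> w x} < c / 2" for p
  proof -
    obtain v where [measurable]: "v \<in> borel_measurable M"
      and v: "\<And>x. x \<in> space M \<Longrightarrow> 0 < v x" "AE x in M. v x < \<infinity>"
        "\<And>j. AE x in M. ennreal (exp (- (dyadic (j, p) / real (Suc p)))) * K (dyadic (j, p)) v x \<le> v x"
      using exists_almost_excessive[of p] by blast
    obtain r where r: "0 < r" "c / 2 \<le> measure \<nu> {x\<in>space M. ennreal r \<le> v x}"
      "measure \<nu> {x\<in>space M. ennreal (2 * r) \<le> v x} < c / 2"
      using \<nu>.exists_median_scale[of v] v(1,2) c by (auto simp: c_def AE\<nu>)
    define w where "w x = ennreal (1 / r) * v x" for x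
    have w_le: "ennreal s \<le> w x \<longleftrightarrow> ennreal (s * r) \<le> v x" if "0 \<le> s" for s x
    proof -
      have "ennreal (s * r) = ennreal r * ennreal s" using that r(1) by (simp add: ennreal_mult' mult.commute)
      moreover have "v x = ennreal r * w x"
        using r(1) by (simp add: w_def mult.assoc[symmetric] ennreal_mult'[symmetric])
      ultimately show ?thesis using r(1) by (simp add: ennreal_mult_le_mult_iff)
    qed
    have "AE x in M. ennreal (exp (- (dyadic (j, p) / real (Suc p)))) * K (dyadic (j, p)) w x \<le> w x" for j
      using v(3)[of j] AE_space
    proof eventually_elim
      case (elim x)
      have "ennreal (exp (- (dyadic (j, p) / real (Suc p)))) * K (dyadic (j, p)) w x
         = ennreal (1 / r) * (ennreal (exp (- (dyadic (j, p) / real (Suc p)))) * K (dyadic (j, p)) v x)"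
        unfolding w_def using elim(2) by (subst K_cmult) (auto simp: ac_simps)
      also have "\<dots> \<le> w x" unfolding w_def by (intro mult_left_mono elim) simp
      finally show ?case .
    qed
    moreover have "w \<in> borel_measurable M" unfolding w_def by measurable
    ultimately show ?thesis using r w_le[of 1] w_le[of 2] by (intro exI[of _ w]) simp
  qed
  from choice[OF allI[OF ex]] obtain w where W: "\<forall>p. w p \<in> borel_measurable M \<and>
     (\<forall>j. AE x in M. ennreal (exp (- (dyadic (j, p) / real (Suc p)))) * K (dyadic (j, p)) (w p) x \<le> w p x) \<and>
     c / 2 \<le> measure \<nu> {x\<in>space M. 1 \<le> w p x} \<and> measure \<nu> {x\<in>space M. 2 \<le> w p x} < c / 2" ..
  have w_meas [measurable]: "w p \<in> borel_measurable M" for p using W by blast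
  have w: "AE x in M. ennreal (exp (- (dyadic (j, p) / real (Suc p)))) * K (dyadic (j, p)) (w p) x \<le> w p x" for p j
    using W by blast
  have w1: "c / 2 \<le> measure \<nu> {x\<in>space M. 1 \<le> w p x}" for p using W by blast
  have w2: "measure \<nu> {x\<in>space M. 2 \<le> w p x} < c / 2" for p using W by blast
  have w_dyadic: "AE x in M. ennreal (exp (- (dyadic a / real (Suc p)))) * K (dyadic a) (w p) x \<le> w p x"
    if p: "snd a \<le> p" for a p
  proof -
    \<comment> \<open>Rewrites the time with denominator \<open>2^p\<close>, which is possible as
      its own level is at most \<open>p\<close>.\<close>
    have "Suc (fst a) * 2 ^ (p - snd a) \<noteq> 0" by simp
    then obtain j where j: "Suc (fst a) * 2 ^ (p - snd a) = Suc j" using not0_implies_Suc by blast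
    have "(2::real) ^ p = 2 ^ (p - snd a) * 2 ^ snd a" using p by (simp flip: power_add)
    then have "dyadic a = real (Suc (fst a) * 2 ^ (p - snd a)) / 2 ^ p"
      by (simp add: dyadic_def field_simps)
    then have "dyadic a = dyadic (j, p)" unfolding j by (simp add: dyadic_def)
    then show ?thesis using w[where p = p and j = j] by simp
  qed
  define h where "h x = (SUP n. INF p\<in>{n..}. w p x)" for x
  have [measurable]: "h \<in> borel_measurable M" unfolding h_def by measurable
  have Kh: "AE x in M. K (dyadic a) h x \<le> h x" for a
  proof -
    have "AE x in M. \<forall>p. snd a \<le> p \<longrightarrow> ennreal (exp (- (dyadic a / real (Suc p)))) * K (dyadic a) (w p) x \<le> w p x"
      unfolding AE_all_countable using w_dyadic by auto
    then show ?thesis using AE_space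
    proof eventually_elim
      case (elim x)
      show ?case unfolding h_def
      proof (rule K_liminf)
        show "ennreal (exp (- (dyadic a / real (Suc p)))) * K (dyadic a) (w p) x \<le> w p x" if "snd a \<le> p" for p
          using elim that by blast
        have "(\<lambda>p. dyadic a * (1 / real (Suc p))) \<longlonglongrightarrow> dyadic a * 0"
          by (intro tendsto_mult tendsto_const LIMSEQ_Suc lim_1_over_n)
        then have "(\<lambda>p. ennreal (exp (- (dyadic a / real (Suc p))))) \<longlonglongrightarrow> ennreal (exp (- 0))"
          by (intro tendsto_ennrealI tendsto_exp tendsto_minus) simp
        then show "(\<lambda>p. ennreal (exp (- (dyadic a / real (Suc p))))) \<longlonglongrightarrow> 1" by simp
        show "incseq (\<lambda>p. ennreal (exp (- (dyadic a / real (Suc p)))))"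
          by (auto simp: incseq_def intro!: ennreal_leI divide_left_mono dyadic_pos[THEN less_imp_le])
      qed (use elim in auto)
    qed
  qed
  have Kh': "AE x in M. K ((1/2)^n) h x \<le> h x" for n
    using Kh[of "(0, n)"] by (simp only: dyadic_half_power)
  have pos: "AE x in M. 0 < h x"
  proof -
    \<comment> \<open>The set where \<open>w p \<ge> 1\<close> has mass at least
      \<open>c / 2\<close>; discarding a set of mass \<open>c / 4\<close> leaves
      \<open>c / 4\<close>, for every \<open>p\<close> and every \<open>x\<close> in
      \<open>A\<close>.\<close>
    obtain A m where [measurable]: "A \<in> sets M" and A: "\<not> (AE x in M. x \<notin> A)"
      and small: "\<And>x. x \<in> A \<Longrightarrow>
        (\<integral>\<^sup>+y. ennreal (g y) * indicator {y. kk_sum m (x, y) < ennreal (1 / real (Suc m))} y \<partial>M) \<le> ennreal (c / 4)"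
      by (rule exists_small_set[OF \<open>g \<in> borel_measurable M\<close> g(2) _ nz, of "c / 4"]) (use c in simp, rule that)
    define p0 where "p0 = Max (insert 0 ((\<lambda>i. snd (from_nat i :: nat \<times> nat)) ` {..<m}))"
    have p0: "snd (from_nat i :: nat \<times> nat) \<le> p0" if "i < m" for i
      unfolding p0_def using that by (intro Max_ge) auto
    \<comment> \<open>At time \<open>t\<close> the damping costs
      \<open>exp (t / (p + 1)) \<le> exp t\<close>, so this constant works for all \<open>p\<close>
      at once.\<close>
    define C where "C = (\<Sum>i<m. exp (dyadic (from_nat i)))"
    have lower: "AE x in M. x \<in> A \<longrightarrow> (\<forall>p. p0 \<le> p \<longrightarrow> ennreal (c / 4 / real (Suc m)) \<le> ennreal C * w p x)"
    proof -
      have "AE x in M. \<forall>p i. p0 \<le> p \<and> i < m \<longrightarrow>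
        ennreal (exp (- (dyadic (from_nat i) / real (Suc p)))) * K (dyadic (from_nat i)) (w p) x \<le> w p x"
        unfolding AE_all_countable
      proof (intro allI)
        fix p i
        show "AE x in M. p0 \<le> p \<and> i < m \<longrightarrow>
          ennreal (exp (- (dyadic (from_nat i) / real (Suc p)))) * K (dyadic (from_nat i)) (w p) x \<le> w p x"
        proof (cases "p0 \<le> p \<and> i < m")
          case True
          then have "snd (from_nat i :: nat \<times> nat) \<le> p" using p0[of i] by linarith
          from w_dyadic[OF this] show ?thesis by eventually_elim blast
        next
          case False
          then show ?thesis by (intro AE_I2) blast
        qed
      qed
      then show ?thesis using AE_space
      proof eventually_elim
        case (elim x)
        show ?case
        proof (intro impI allI)
          fix p assume xA: "x \<in> A" and p: "p0 \<le> p"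
          define D where "D = {y\<in>space M. kk_sum m (x, y) < ennreal (1 / real (Suc m))}"
          define B where "B = {y\<in>space M. 1 \<le> w p y}"
          have [measurable]: "D \<in> sets M" "B \<in> sets M" unfolding D_def B_def using elim(2) by measurable
          have "emeasure \<nu> D \<le> ennreal (c / 4)"
            using small[OF xA] unfolding em[OF \<open>D \<in> sets M\<close>]
            by (rule order_trans[rotated]) (auto intro!: nn_integral_mono simp: D_def indicator_def)
          then have "measure \<nu> D \<le> c / 4" using c by (simp add: \<nu>.emeasure_eq_measure)
          moreover have "measure \<nu> B \<le> measure \<nu> (B - D) + measure \<nu> D"
          proof -
            have "measure \<nu> B \<le> measure \<nu> ((B - D) \<union> D)" by (rule \<nu>.finite_measure_mono) auto
            also have "\<dots> \<le> measure \<nu> (B - D) + measure \<nu> D" by (rule measure_Un_le) auto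
            finally show ?thesis .
          qed
          ultimately have BD: "c / 4 \<le> measure \<nu> (B - D)" using w1[of p] by (simp add: B_def)
          have "ennreal (c / 4 / real (Suc m)) = ennreal (1 / real (Suc m)) * ennreal (c / 4)"
            by (subst ennreal_mult'[symmetric]) (auto simp: mult.commute)
          also have "\<dots> \<le> ennreal (1 / real (Suc m)) * emeasure \<nu> (B - D)"
            using BD by (intro mult_left_mono) (auto simp: \<nu>.emeasure_eq_measure intro!: ennreal_leI)
          also have "\<dots> = (\<integral>\<^sup>+y. ennreal (1 / real (Suc m)) * (ennreal (g y) * indicator (B - D) y) \<partial>M)"
            by (subst nn_integral_cmult) (auto simp: em)
          also have "\<dots> \<le> (\<integral>\<^sup>+y. kk_sum m (x, y) * w p y \<partial>M)"
          proof (rule nn_integral_mono)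
            fix y assume y: "y \<in> space M"
            have gy: "ennreal (g y) \<le> 1" using g(3)[of y] by (simp add: ennreal_le_1)
            show "ennreal (1 / real (Suc m)) * (ennreal (g y) * indicator (B - D) y) \<le> kk_sum m (x, y) * w p y"
            proof (cases "y \<in> B - D")
              case True
              then have "ennreal (1 / real (Suc m)) \<le> kk_sum m (x, y)" "1 \<le> w p y"
                using y by (auto simp: B_def D_def not_less)
              moreover have "ennreal (g y) * indicator (B - D) y \<le> w p y"
                using order_trans[OF gy \<open>1 \<le> w p y\<close>] True by simp
              ultimately show ?thesis by (intro mult_mono) auto
            qed simp
          qed
          also have "\<dots> = (\<Sum>i<m. K (dyadic (from_nat i)) (w p) x)"
            unfolding kk_sum_def K_def sum_distrib_right using elim(2) by (subst nn_integral_sum) auto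
          also have "\<dots> \<le> (\<Sum>i<m. ennreal (exp (dyadic (from_nat i))) * w p x)"
          proof (rule sum_mono)
            fix i assume i: "i \<in> {..<m}"
            let ?t = "dyadic (from_nat i)"
            have "?t / real (Suc p) \<le> ?t" by (simp add: field_simps less_imp_le)
            then have "1 \<le> exp ?t * exp (- (?t / real (Suc p)))" by (simp add: exp_add[symmetric])
            then have "ennreal 1 \<le> ennreal (exp ?t * exp (- (?t / real (Suc p))))" by (rule ennreal_leI)
            then have "1 * K ?t (w p) x \<le> ennreal (exp ?t * exp (- (?t / real (Suc p)))) * K ?t (w p) x"
              by (intro mult_right_mono) auto
            also have "\<dots> = ennreal (exp ?t) * (ennreal (exp (- (?t / real (Suc p)))) * K ?t (w p) x)"
              by (simp add: ennreal_mult' mult.assoc)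
            also have "\<dots> \<le> ennreal (exp ?t) * w p x"
              using elim(1) i p by (intro mult_left_mono) auto
            finally show "K ?t (w p) x \<le> ennreal (exp ?t) * w p x" by simp
          qed
          also have "\<dots> = ennreal C * w p x"
            unfolding C_def by (simp add: sum_distrib_right[symmetric])
          finally show "ennreal (c / 4 / real (Suc m)) \<le> ennreal C * w p x" .
        qed
      qed
    qed
    have A_pos: "AE x in M. x \<in> A \<longrightarrow> 0 < h x"
      using lower
    proof eventually_elim
      case (elim x)
      show ?case
      proof
        assume "x \<in> A"
        with elim have le: "ennreal (c / 4 / real (Suc m)) \<le> ennreal C * w p x" if "p0 \<le> p" for p
          using that by blast
        have c': "0 < c / 4 / real (Suc m)" using c by simp
        have "0 < C"
        proof (rule ccontr)
          assume "\<not> 0 < C"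
          then have "ennreal C = 0" by (simp add: ennreal_neg)
          with le[of p0] c' show False by simp
        qed
        then have "ennreal (c / 4 / real (Suc m) / C) \<le> w p x" if "p0 \<le> p" for p
        proof -
          have "ennreal (1 / C) * ennreal (c / 4 / real (Suc m)) \<le> ennreal (1 / C) * (ennreal C * w p x)"
            by (intro mult_left_mono le that) simp
          also have "\<dots> = w p x" using \<open>0 < C\<close> by (simp add: mult.assoc[symmetric] ennreal_mult'[symmetric])
          also have "ennreal (1 / C) * ennreal (c / 4 / real (Suc m)) = ennreal (c / 4 / real (Suc m) / C)"
            using \<open>0 < C\<close> c by (subst ennreal_mult'[symmetric]) auto
          finally show ?thesis .
        qed
        then have "ennreal (c / 4 / real (Suc m) / C) \<le> (INF p\<in>{p0..}. w p x)" by (intro INF_greatest) simp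
        also have "\<dots> \<le> h x" unfolding h_def by (rule SUP_upper) simp
        finally have "ennreal (c / 4 / real (Suc m) / C) \<le> h x" .
        moreover have "0 < ennreal (c / 4 / real (Suc m) / C)"
          using divide_pos_pos[OF c' \<open>0 < C\<close>] by (simp only: ennreal_less_zero_iff)
        ultimately show "0 < h x" by (rule less_le_trans[rotated])
      qed
    qed
    \<comment> \<open>Where \<open>h\<close> vanishes, so does \<open>K h\<close>, hence the kernel
      is 0 a.e. on \<open>N\<close>. As \<open>h\<close> is positive a.e. on \<open>A\<close>, which
      is not null, \<open>N\<close> must be conull.\<close>
    define N where "N = {x\<in>space M. 0 < h x}"
    have [measurable]: "N \<in> sets M" unfolding N_def by measurable
    have "(AE x in M. x \<notin> N) \<or> (AE x in M. x \<in> N)"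
    proof (rule null_or_conull)
      fix n
      show "AE x in M. x \<notin> N \<longrightarrow> K ((1/2)^n) (indicator N) x = 0"
        using Kh'[of n] AE_space
      proof eventually_elim
        case (elim x)
        show ?case
        proof
          assume "x \<notin> N"
          then have "K ((1/2)^n) h x = 0" using elim by (auto simp: N_def)
          then have "AE y in M. kk ((1/2)^n) (x, y) * h y = 0"
            unfolding K_def using elim(2) by (subst (asm) nn_integral_0_iff_AE) auto
          then have "AE y in M. kk ((1/2)^n) (x, y) * indicator N y = 0"
            by eventually_elim (auto simp: N_def indicator_def)
          then show "K ((1/2)^n) (indicator N) x = 0"
            unfolding K_def using elim(2) by (subst nn_integral_0_iff_AE) auto
        qed
      qed
    qed measurable
    moreover have "\<not> (AE x in M. x \<notin> N)"
    proof
      assume "AE x in M. x \<notin> N"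
      with A_pos AE_space have "AE x in M. x \<notin> A" by eventually_elim (auto simp: N_def)
      with A show False by blast
    qed
    ultimately have "AE x in M. x \<in> N" by blast
    then show ?thesis by eventually_elim (simp add: N_def)
  qed
  have fin: "AE x in M. h x < \<infinity>"
  proof -
    \<comment> \<open>Where \<open>h\<close> is finite, so is \<open>K h\<close>, and a kernel with
      finite integral against \<open>h\<close> vanishes a.e. on \<open>N\<close>.\<close>
    define N where "N = {x\<in>space M. h x = \<infinity>}"
    have [measurable]: "N \<in> sets M" unfolding N_def by measurable
    have "(AE x in M. x \<notin> N) \<or> (AE x in M. x \<in> N)"
    proof (rule null_or_conull)
      fix n
      show "AE x in M. x \<notin> N \<longrightarrow> K ((1/2)^n) (indicator N) x = 0"
        using Kh'[of n] AE_space
      proof eventually_elim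
        case (elim x)
        show ?case
        proof
          assume "x \<notin> N"
          then have "K ((1/2)^n) h x \<noteq> \<infinity>" using elim by (auto simp: N_def top_unique)
          then have "AE y in M. kk ((1/2)^n) (x, y) * h y \<noteq> \<infinity>"
            unfolding K_def using elim(2) by (intro nn_integral_noteq_infinite) auto
          then have "AE y in M. kk ((1/2)^n) (x, y) * indicator N y = 0"
            by eventually_elim (auto simp: N_def indicator_def ennreal_mult_eq_top_iff)
          then show "K ((1/2)^n) (indicator N) x = 0"
            unfolding K_def using elim(2) by (subst nn_integral_0_iff_AE) auto
        qed
      qed
    qed measurable
    moreover have "\<not> (AE x in M. x \<in> N)"
    proof
      assume N: "AE x in M. x \<in> N"
      \<comment> \<open>If \<open>h\<close> were infinite a.e., these sets would exhaust the space,
        and some \<open>w n\<close> would be at least 2 on more than half of the mass, against the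
        upper median bound.\<close>
      define S where "S n = {x\<in>space M. 2 \<le> (INF p\<in>{n..}. w p x)}" for n
      have [measurable]: "S n \<in> sets M" for n unfolding S_def by measurable
      have "(\<lambda>n. measure \<nu> (S n)) \<longlonglongrightarrow> measure \<nu> (\<Union>n. S n)"
      proof (rule \<nu>.finite_Lim_measure_incseq)
        show "incseq S"
          unfolding incseq_def S_def
          by (auto elim!: order_trans intro!: INF_superset_mono)
      qed auto
      also have "measure \<nu> (\<Union>n. S n) = measure \<nu> (space M)"
      proof (rule measure_eq_AE)
        have "AE x in M. x \<in> (\<Union>n. S n) \<longleftrightarrow> x \<in> space M"
          using N AE_space
        proof eventually_elim
          case (elim x)
          then have "2 < h x" by (simp add: N_def)
          then obtain n where "2 < (INF p\<in>{n..}. w p x)" unfolding h_def less_SUP_iff by blast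
          then show ?case using elim(2) by (auto simp: S_def intro!: exI[of _ n])
        qed
        then show "AE x in \<nu>. x \<in> (\<Union>n. S n) \<longleftrightarrow> x \<in> space M" by (simp add: AE\<nu>)
      qed auto
      finally have "(\<lambda>n. measure \<nu> (S n)) \<longlonglongrightarrow> c" by (simp add: c_def)
      then have "\<forall>\<^sub>F n in sequentially. c / 2 < measure \<nu> (S n)" using c by (intro order_tendstoD(1)) auto
      then obtain n where n: "c / 2 < measure \<nu> (S n)" by (auto simp: eventually_sequentially)
      have "measure \<nu> (S n) \<le> measure \<nu> {x\<in>space M. 2 \<le> w n x}"
        by (rule \<nu>.finite_measure_mono) (auto simp: S_def le_INF_iff)
      with n w2[of n] show False by linarith
    qed
    ultimately have "AE x in M. x \<notin> N" by blast
    then show ?thesis using AE_space by eventually_elim (simp add: N_def less_top)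
  qed
  from pos fin have "AE x in M. 0 < h x \<and> h x < \<infinity>" by eventually_elim simp
  then show ?thesis using Kh' by (intro that[of h]) auto
qed

text \<open>With \<open>p\<close> the minimum and \<open>d\<close> the excess of \<open>f\<close>
  over it, the mixed term only sees points where \<open>f > h\<close>. There \<open>p = h\<close>,
  and excessivity of \<open>h\<close> bounds \<open>T p\<close> by \<open>p\<close>.\<close>

lemma form_min_le:
  assumes [measurable]: "h \<in> borel_measurable M" and pos: "\<And>x. 0 < h x"
    and exc: "\<And>n. AE x in M. K ((1/2)^n) (\<lambda>y. ennreal (h y)) x \<le> ennreal (h x)"
    and f: "f \<in> L2 M"
  shows "q (\<lambda>x. min (f x) (h x)) \<le> q f"
proof -
  have [measurable]: "f \<in> borel_measurable M" using f by (rule L2_measurable)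
  let ?p = "\<lambda>x. min (f x) (h x)" and ?d = "\<lambda>x. f x - min (f x) (h x)"
  have p: "?p \<in> L2 M"
  proof (rule L2_dominated[OF f])
    have "\<bar>min (f x) (h x)\<bar> \<le> \<bar>f x\<bar>" for x using pos[of x] by linarith
    then show "AE x in M. \<bar>min (f x) (h x)\<bar> \<le> \<bar>f x\<bar>" by simp
  qed measurable
  have d: "?d \<in> L2 M" by (rule L2_diff[OF f p])
  have "q ?p \<le> q (\<lambda>x. ?p x + ?d x)"
  proof (rule form_le_add[OF p d])
    fix n
    have t: "(0::real) < (1/2)^n" by simp
    have "AE x in M. T ((1/2)^n) ?p x * ?d x \<le> ?p x * ?d x"
      using T_le_K[OF t p] exc[of n]
    proof eventually_elim
      case (elim x)
      show ?case
      proof (cases "f x \<le> h x")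
        case False
        \<comment> \<open>The minimum may be negative; \<open>T_le_K\<close> discards that part
          before comparison with \<open>h\<close>.\<close>
        have "ennreal (T ((1/2)^n) ?p x) \<le> K ((1/2)^n) (\<lambda>y. ennreal (h y)) x"
          by (rule order_trans[OF elim(1)], rule K_mono_AE) (auto intro!: AE_I2 ennreal_leI)
        also note elim(2)
        finally have "T ((1/2)^n) ?p x \<le> h x" using pos[of x] by (simp add: ennreal_le_iff less_imp_le)
        then show ?thesis using False by (intro mult_right_mono) (auto simp: min_def)
      qed (simp add: min_def)
    qed
    then show "ip (T ((1/2)^n) ?p) ?d \<le> ip ?p ?d"
      unfolding l2_inner_def by (rule integral_mono_AE[OF L2_mult_integrable[OF T_L2[OF t p] d] L2_mult_integrable[OF p d]])
  qed
  then show ?thesis by simp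
qed

lemma exists_strictly_positive_excessive: "\<exists>h. strictly_positive_excessive M q h"
proof (cases "AE x in M. False")
  case True
  \<comment> \<open>On a null space all functions agree a.e., so the constant 1 serves. The median
    argument requires positive total mass.\<close>
  have "q (\<lambda>x. min (f x) 1) \<le> q f" if "f \<in> L2 M" for f
  proof -
    have "AE x in M. min (f x) 1 = f x" using True by eventually_elim simp
    moreover have "(\<lambda>x. min (f x) 1) \<in> L2 M"
      by (rule L2_cong_AE[OF that]) (use that True in \<open>auto dest: L2_measurable elim: eventually_mono\<close>)
    ultimately show ?thesis using form_cong_AE[OF qf] that by (metis order_refl)
  qed
  then show ?thesis by (intro exI[of _ "\<lambda>_. 1"]) (simp add: strictly_positive_excessive_def)
next
  case False
  then obtain h where [measurable]: "h \<in> borel_measurable M" and h: "AE x in M. 0 < h x \<and> h x < \<infinity>"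
    and Kh: "\<And>n. AE x in M. K ((1/2)^n) h x \<le> h x"
    using exists_excessive_ennreal by blast
  \<comment> \<open>A real representative, set to 1 on the exceptional null set so that it is
    positive everywhere, as \<open>form_min_le\<close> demands.\<close>
  define r where "r x = (if 0 < h x \<and> h x < \<infinity> then enn2real (h x) else 1)" for x
  have [measurable]: "r \<in> borel_measurable M" unfolding r_def by measurable
  have pos: "0 < r x" for x by (auto simp: r_def enn2real_positive_iff)
  have rh: "AE x in M. ennreal (r x) = h x" using h by eventually_elim (simp add: r_def)
  have "AE x in M. K ((1/2)^n) (\<lambda>y. ennreal (r y)) x \<le> ennreal (r x)" for n
    using Kh[of n] rh by eventually_elim (simp add: K_cong_AE[OF rh])
  then have "strictly_positive_excessive M q r"
    unfolding strictly_positive_excessive_def using pos form_min_le[of r] by auto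
  then show ?thesis by blast
qed

end

theorem theoremA3:
  fixes M :: "'a measure"
    and q :: "('a \<Rightarrow> real) \<Rightarrow> ennreal"
    and T :: "real \<Rightarrow> ('a \<Rightarrow> real) \<Rightarrow> 'a \<Rightarrow> real"
  assumes "sigma_finite_measure M"
    and "quadratic_form M q"
    and "densely_defined M q"
    and "closed_form M q"
    and "beurling_deny_first M q"
    and "irreducible_form M q"
    and "associated_semigroup M q T"
    and "kernel_operators M T"
  shows "\<exists>h. strictly_positive_excessive M q h"
proof -
  interpret sigma_finite_measure M by fact
  obtain E where E: "spectral_resolution M (form_operator M q) E"
    and T: "\<And>t f. 0 < t \<Longrightarrow> f \<in> L2 M \<Longrightarrow> spectral_integral M E (\<lambda>s. exp (- t * s)) f (T t f)"
    using \<open>associated_semigroup M q T\<close> unfolding associated_semigroup_def by blast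
  \<comment> \<open>Positivity of \<open>t\<close> is moved behind the quantifier over kernels, so
    that \<open>choice\<close> gives one function of all real times.\<close>
  have "\<forall>t. \<exists>k. 0 < t \<longrightarrow> (\<lambda>(x, y). k x y) \<in> borel_measurable (M \<Otimes>\<^sub>M M) \<and>
      (\<forall>x\<in>space M. \<forall>y\<in>space M. 0 \<le> k x y) \<and>
      (\<forall>f\<in>L2 M. AE x in M. integrable M (\<lambda>y. k x y * f y) \<and> T t f x = (LINT y|M. k x y * f y))"
    using \<open>kernel_operators M T\<close> unfolding kernel_operators_def by blast
  from choice[OF this] obtain k where k: "\<forall>t. 0 < t \<longrightarrow> (\<lambda>(x, y). k t x y) \<in> borel_measurable (M \<Otimes>\<^sub>M M) \<and>
      (\<forall>x\<in>space M. \<forall>y\<in>space M. 0 \<le> k t x y) \<and>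
      (\<forall>f\<in>L2 M. AE x in M. integrable M (\<lambda>y. k t x y * f y) \<and> T t f x = (LINT y|M. k t x y * f y))" ..
  interpret kernel_form M E q T k
  proof
    show "spectral_measure M E" "\<And>f g. form_operator M q f g \<longleftrightarrow> spectral_integral M E (\<lambda>s. s) f g"
      using E by (auto simp: spectral_resolution_def)
  qed (fact | use T k in blast)+
  show ?thesis by (rule exists_strictly_positive_excessive)
qed

end
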